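(* Let $(M,L)$ be a Finsler manifold and $g$ the Finsler metric defined by $L$. There exists a unique regular connection $\nabla$ on $\pi^{-1}(TM)$ such that: (a) $\nabla$ is metric: $\nabla g=0$; (b) the horizontal torsion of $\nabla$ vanishes: $Q=0$; (c) the mixed torsion $T$ of $\nabla$ satisfies $g(T(\overline{X},\overline{Y}),\overline{Z})=g(T(\overline{X},\overline{Z}),\overline{Y})$ for all $\overline{X},\overline{Y},\overline{Z}\in\mathfrak{X}(\pi(M))$. (This connection is called the Cartan connection associated with $(M,L)$.)
   Context: Pullback formalism. $M$ is a real $C^\infty$ manifold of finite dimension; all objects are $C^\infty$. $\pi_M:TM\to M$ is the tangent bundle, $\pi:\mathcal{T}M\to M$ its open subbundle of nonzero tangent vectors, and $\pi^{-1}(TM)\to\mathcal{T}M$ is the pullback of $TM$ by $\pi$ (fibre over $u$: pairs $(u,v)$ with $v\in T_{\pi(u)}M$). $\mathfrak{X}(\mathcal{T}M)$ denotes the vector fields on $\mathcal{T}M$, and $\mathfrak{X}(\pi(M))$ the smooth sections of $\pi^{-1}(TM)$, written with bars. The fundamental section is $\overline{\eta}(u)=(u,u)$. The bundle morphisms $\rho:T(\mathcal{T}M)\to\pi^{-1}(TM)$ and $\gamma:\pi^{-1}(TM)\to T(\mathcal{T}M)$ are $\rho(X)=(u,d\pi(X))$ for $X\in T_u(\mathcal{T}M)$ and $\gamma(u,v)=\frac{d}{dt}\big|_{t=0}(u+tv)$; the image of $\gamma$ is $\ker\rho=V(\mathcal{T}M)$, the vertical bundle. Put $J:=\gamma\circ\rho$.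 Regular connections. For a linear connection $D$ on the vector bundle $\pi^{-1}(TM)$, the connection map is $K(X)=D_X\overline{\eta}$, and the horizontal space at $u$ is $H_u(\mathcal{T}M)=\{X\in T_u(\mathcal{T}M):K(X)=0\}$. $D$ is regular if $T_u(\mathcal{T}M)=V_u(\mathcal{T}M)\oplus H_u(\mathcal{T}M)$ for all $u\in\mathcal{T}M$. Then $\rho|_{H(\mathcal{T}M)}$ is an isomorphism onto $\pi^{-1}(TM)$, and its inverse $\beta:=(\rho|_{H(\mathcal{T}M)})^{-1}$ is the horizontal map of $D$. Torsions. $\mathbf{T}(X,Y)=D_X\rho Y-D_Y\rho X-\rho[X,Y]$ for $X,Y\in\mathfrak{X}(\mathcal{T}M)$; the horizontal torsion is $Q(\overline{X},\overline{Y})=\mathbf{T}(\beta\overline{X},\beta\overline{Y})$ and the mixed ((h)hv-) torsion is $T(\overline{X},\overline{Y})=\mathbf{T}(\gamma\overline{X},\beta\overline{Y})$. Finsler structure. $(M,L)$ is a Finsler manifold: $L:TM\to\mathbb{R}$ is continuous, $C^\infty$ and positive on $\mathcal{T}M$, positively homogeneous of degree 1 on fibres, and with $E:=\frac12L^2$ the fibrewise Hessian of $E$ on $\mathcal{T}M$ is positive definite. The Finsler metric $g$ on $\pi^{-1}(TM)$ is this Hessian, i.e. $g(\rho X,\rho Y)=\Omega(JX,Y)$ with $\Omega:=dd_JE$, $d_JE:=dE\circ J$. *)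

theory Defs
  imports "HOL-Analysis.Analysis" "HOL-Library.Function_Algebras"
begin

section \<open>Smooth manifolds\<close>

text \<open>\<open>Ck_on k S f\<close>: \<open>f\<close> is k times continuously differentiable on the open set \<open>S\<close>,
  by recursion on all directional derivatives. It is only applied to open sets.\<close>

primrec Ck_on :: "nat \<Rightarrow> 'e::real_normed_vector set \<Rightarrow> ('e \<Rightarrow> 'f::real_normed_vector) \<Rightarrow> bool" where
  "Ck_on 0 S f \<longleftrightarrow> continuous_on S f"
| "Ck_on (Suc k) S f \<longleftrightarrow>
     (\<forall>x\<in>S. f differentiable (at x)) \<and> (\<forall>v. Ck_on k S (\<lambda>x. frechet_derivative f (at x) v))"

definition smooth_on :: "'e::real_normed_vector set \<Rightarrow> ('e \<Rightarrow> 'f::real_normed_vector) \<Rightarrow> bool" where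
  "smooth_on S f \<longleftrightarrow> (\<forall>k. Ck_on k S f)"

text \<open>A chart is a domain with a coordinate map; values of the coordinate map off the domain
  are irrelevant. A manifold modelled on the Euclidean space \<open>'e\<close> is given by an atlas \<open>A\<close>;
  its underlying set is \<open>carrier A\<close> and its topology is the one making all charts
  homeomorphisms onto open subsets of \<open>'e\<close>.\<close>

type_synonym ('p, 'e) chart = "'p set \<times> ('p \<Rightarrow> 'e)"
type_synonym ('p, 'e) atlas = "('p, 'e) chart set"

definition carrier :: "('p, 'e) atlas \<Rightarrow> 'p set" where
  "carrier A = (\<Union>(U, \<phi>)\<in>A. U)"

definition manifold_topology :: "('p, 'e::euclidean_space) atlas \<Rightarrow> 'p topology" where
  "manifold_topology A =
     topology (\<lambda>W. W \<subseteq> carrier A \<and> (\<forall>(U, \<phi>)\<in>A. open (\<phi> ` (W \<inter> U))))"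

definition smooth_atlas :: "('p, 'e::euclidean_space) atlas \<Rightarrow> bool" where
  "smooth_atlas A \<longleftrightarrow>
     (\<forall>(U, \<phi>)\<in>A. inj_on \<phi> U \<and> open (\<phi> ` U)) \<and>
     (\<forall>(U, \<phi>)\<in>A. \<forall>(V, \<psi>)\<in>A.
        open (\<phi> ` (U \<inter> V)) \<and> smooth_on (\<phi> ` (U \<inter> V)) (\<psi> \<circ> inv_into U \<phi>))"

definition smooth_manifold :: "('p, 'e::euclidean_space) atlas \<Rightarrow> bool" where
  "smooth_manifold A \<longleftrightarrow>
     smooth_atlas A \<and> Hausdorff_space (manifold_topology A) \<and>
     second_countable (manifold_topology A)"

text \<open>The predicate passed to \<^const>\<open>topology\<close> above really is a topology.\<close>

lemma openin_manifold_topology: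
  assumes "smooth_atlas A"
  shows "openin (manifold_topology A) W \<longleftrightarrow>
           W \<subseteq> carrier A \<and> (\<forall>(U, \<phi>)\<in>A. open (\<phi> ` (W \<inter> U)))"
proof -
  have "istopology (\<lambda>W. W \<subseteq> carrier A \<and> (\<forall>(U, \<phi>)\<in>A. open (\<phi> ` (W \<inter> U))))"
    unfolding istopology_def
  proof (intro conjI allI impI)
    fix S T
    assume S: "S \<subseteq> carrier A \<and> (\<forall>(U, \<phi>)\<in>A. open (\<phi> ` (S \<inter> U)))"
       and T: "T \<subseteq> carrier A \<and> (\<forall>(U, \<phi>)\<in>A. open (\<phi> ` (T \<inter> U)))"
    show "S \<inter> T \<subseteq> carrier A" using S by blast
    show "\<forall>(U, \<phi>)\<in>A. open (\<phi> ` (S \<inter> T \<inter> U))"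
    proof clarify
      fix U \<phi> assume U: "(U, \<phi>) \<in> A"
      then have "inj_on \<phi> U" using assms by (auto simp: smooth_atlas_def)
      then have "\<phi> ` (S \<inter> T \<inter> U) = \<phi> ` (S \<inter> U) \<inter> \<phi> ` (T \<inter> U)"
        by (auto simp: inj_on_def)
      moreover have "open (\<phi> ` (S \<inter> U))" "open (\<phi> ` (T \<inter> U))" using S T U by auto
      ultimately show "open (\<phi> ` (S \<inter> T \<inter> U))" by (simp add: open_Int)
    qed
  next
    fix \<K>
    assume K: "\<forall>K\<in>\<K>. K \<subseteq> carrier A \<and> (\<forall>(U, \<phi>)\<in>A. open (\<phi> ` (K \<inter> U)))"
    show "\<Union>\<K> \<subseteq> carrier A" using K by blast
    show "\<forall>(U, \<phi>)\<in>A. open (\<phi> ` (\<Union>\<K> \<inter> U))"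
    proof clarify
      fix U \<phi> assume U: "(U, \<phi>) \<in> A"
      have "\<phi> ` (\<Union>\<K> \<inter> U) = (\<Union>K\<in>\<K>. \<phi> ` (K \<inter> U))" by blast
      moreover have "\<forall>K\<in>\<K>. open (\<phi> ` (K \<inter> U))" using K U by auto
      ultimately show "open (\<phi> ` (\<Union>\<K> \<inter> U))" by (simp add: open_UN)
    qed
  qed
  then show ?thesis by (simp add: manifold_topology_def topology_inverse')
qed

text \<open>\<open>smooth_at A B F p\<close>: the map \<open>F\<close> between the manifolds \<open>A\<close> and \<open>B\<close> is smooth on some
  neighbourhood of \<open>p\<close>.\<close>

definition smooth_at ::
  "('p, 'e::euclidean_space) atlas \<Rightarrow> ('q, 'f::euclidean_space) atlas \<Rightarrow> ('p \<Rightarrow> 'q) \<Rightarrow> 'p \<Rightarrow> bool" where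
  "smooth_at A B F p \<longleftrightarrow>
     (\<exists>(U, \<phi>)\<in>A. \<exists>(V, \<psi>)\<in>B. p \<in> U \<and> F p \<in> V \<and>
        (\<exists>W. open W \<and> \<phi> p \<in> W \<and> W \<subseteq> \<phi> ` U \<and> F ` inv_into U \<phi> ` W \<subseteq> V \<and>
             smooth_on W (\<psi> \<circ> F \<circ> inv_into U \<phi>)))"

definition std_atlas :: "('e, 'e::euclidean_space) atlas" where
  "std_atlas = {(UNIV, id)}"

abbreviation smooth_fun_at :: "('p, 'e::euclidean_space) atlas \<Rightarrow> ('p \<Rightarrow> real) \<Rightarrow> 'p \<Rightarrow> bool" where
  "smooth_fun_at A f p \<equiv> smooth_at A std_atlas f p"

definition smooth_fun :: "('p, 'e::euclidean_space) atlas \<Rightarrow> ('p \<Rightarrow> real) \<Rightarrow> bool" where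
  "smooth_fun A f \<longleftrightarrow> (\<forall>p\<in>carrier A. smooth_fun_at A f p)"


section \<open>Tangent vectors and the tangent bundle\<close>

text \<open>A tangent vector at \<open>p\<close> is the operator \<open>f \<mapsto> (f \<circ> c)'(0)\<close> of differentiation along a
  smooth curve \<open>c\<close> with \<open>c 0 = p\<close>, acting on the real functions that are smooth near \<open>p\<close>;
  it is extended by 0 to all other functions. Sums of tangent vectors are pointwise.\<close>

type_synonym 'p tvec = "('p \<Rightarrow> real) \<Rightarrow> real"

definition velocity :: "('p, 'e::euclidean_space) atlas \<Rightarrow> (real \<Rightarrow> 'p) \<Rightarrow> 'p tvec" where
  "velocity A c = (\<lambda>f. if smooth_fun_at A f (c 0) then deriv (f \<circ> c) 0 else 0)"

definition tangent_space :: "('p, 'e::euclidean_space) atlas \<Rightarrow> 'p \<Rightarrow> 'p tvec set" where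
  "tangent_space A p = {velocity A c | c. c 0 = p \<and> smooth_at std_atlas A c 0}"

definition tscale :: "real \<Rightarrow> 'p tvec \<Rightarrow> 'p tvec"  (infixr \<open>*\<^sub>T\<close> 75) where
  "a *\<^sub>T v = (\<lambda>f. a * v f)"

definition differential ::
  "('q, 'f::euclidean_space) atlas \<Rightarrow> ('p \<Rightarrow> 'q) \<Rightarrow> 'p \<Rightarrow> 'p tvec \<Rightarrow> 'q tvec" where
  "differential B F p v = (\<lambda>f. if smooth_fun_at B f (F p) then v (f \<circ> F) else 0)"

text \<open>Points of \<open>TM\<close> are pairs of a base point and a tangent vector; the chart induced by
  \<open>(U, \<phi>)\<close> sends \<open>(p, v)\<close> to \<open>\<phi> p\<close> and the components \<open>v(\<phi>\<^sup>i)\<close>.\<close>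

type_synonym 'p tpoint = "'p \<times> 'p tvec"

definition tangent_chart ::
  "('p, 'e::euclidean_space) atlas \<Rightarrow> ('p, 'e) chart \<Rightarrow> ('p tpoint, 'e \<times> 'e) chart" where
  "tangent_chart A = (\<lambda>(U, \<phi>).
     ({(p, v). p \<in> U \<and> v \<in> tangent_space A p},
      \<lambda>(p, v). (\<phi> p, \<Sum>b\<in>Basis. v (\<lambda>q. \<phi> q \<bullet> b) *\<^sub>R b)))"

definition tangent_atlas :: "('p, 'e::euclidean_space) atlas \<Rightarrow> ('p tpoint, 'e \<times> 'e) atlas" where
  "tangent_atlas A = tangent_chart A ` A"

text \<open>The open submanifold of nonzero tangent vectors.\<close>

definition slit_atlas :: "('p, 'e::euclidean_space) atlas \<Rightarrow> ('p tpoint, 'e \<times> 'e) atlas" where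
  "slit_atlas A = (\<lambda>(U, \<phi>). (U \<inter> {u. snd u \<noteq> 0}, \<phi>)) ` tangent_atlas A"

abbreviation slit :: "('p, 'e::euclidean_space) atlas \<Rightarrow> 'p tpoint set" where
  "slit A \<equiv> carrier (slit_atlas A)"

definition vector_fields :: "('p, 'e::euclidean_space) atlas \<Rightarrow> ('p \<Rightarrow> 'p tvec) set" where
  "vector_fields A =
     {X \<in> (\<Pi>\<^sub>E p\<in>carrier A. tangent_space A p).
        \<forall>p\<in>carrier A. smooth_at A (tangent_atlas A) (\<lambda>q. (q, X q)) p}"

definition lie_bracket ::
  "('p, 'e::euclidean_space) atlas \<Rightarrow> ('p \<Rightarrow> 'p tvec) \<Rightarrow> ('p \<Rightarrow> 'p tvec) \<Rightarrow> 'p \<Rightarrow> 'p tvec" where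
  "lie_bracket A X Y = (\<lambda>p f.
     if smooth_fun_at A f p then X p (\<lambda>q. Y q f) - Y p (\<lambda>q. X q f) else 0)"


section \<open>The pullback bundle over the slit tangent bundle\<close>

text \<open>The fibre \<open>{u} \<times> T\<^bsub>\<pi>(u)\<^esub>M\<close> of the pullback bundle over \<open>u\<close> is identified with
  \<open>T\<^bsub>\<pi>(u)\<^esub>M\<close>, i.e. the first component of the pair \<open>(u, v)\<close> is dropped. Thus a section is a
  map \<open>Y\<close> on \<open>slit A\<close> with \<open>Y u \<in> T\<^bsub>\<pi>(u)\<^esub>M\<close>, and it is smooth iff \<open>u \<mapsto> (\<pi> u, Y u)\<close> is a
  smooth map into \<open>TM\<close>. Base point \<open>u\<close> and tangent vector at \<open>u\<close> are passed separately.\<close>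

abbreviation fibre :: "('p, 'e::euclidean_space) atlas \<Rightarrow> 'p tpoint \<Rightarrow> 'p tvec set" where
  "fibre A u \<equiv> tangent_space A (fst u)"

type_synonym 'p bsection = "'p tpoint \<Rightarrow> 'p tvec"

definition sections :: "('p, 'e::euclidean_space) atlas \<Rightarrow> 'p bsection set" where
  "sections A =
     {Y \<in> (\<Pi>\<^sub>E u\<in>slit A. fibre A u).
        \<forall>u\<in>slit A. smooth_at (slit_atlas A) (tangent_atlas A) (\<lambda>w. (fst w, Y w)) u}"

definition fundamental_section :: "('p, 'e::euclidean_space) atlas \<Rightarrow> 'p bsection" where
  "fundamental_section A = (\<lambda>u\<in>slit A. snd u)"

definition rho :: "('p, 'e::euclidean_space) atlas \<Rightarrow> 'p tpoint \<Rightarrow> 'p tpoint tvec \<Rightarrow> 'p tvec" where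
  "rho A u = differential A fst u"

definition gamma :: "('p, 'e::euclidean_space) atlas \<Rightarrow> 'p tpoint \<Rightarrow> 'p tvec \<Rightarrow> 'p tpoint tvec" where
  "gamma A u v = velocity (slit_atlas A) (\<lambda>t. (fst u, snd u + t *\<^sub>T v))"

definition vertical_space :: "('p, 'e::euclidean_space) atlas \<Rightarrow> 'p tpoint \<Rightarrow> 'p tpoint tvec set" where
  "vertical_space A u = {X \<in> tangent_space (slit_atlas A) u. rho A u X = 0}"


section \<open>Regular connections and their torsions\<close>

text \<open>A linear connection takes a point \<open>u\<close> of the slit tangent bundle, a tangent vector \<open>X\<close>
  there and a smooth section \<open>Y\<close>, and returns \<open>D\<^sub>X Y\<close> in the fibre over \<open>u\<close>. Being an element
  of the extensional function space, it has no junk values.\<close>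

type_synonym 'p connection = "'p tpoint \<Rightarrow> 'p tpoint tvec \<Rightarrow> 'p bsection \<Rightarrow> 'p tvec"

definition linear_connection :: "('p, 'e::euclidean_space) atlas \<Rightarrow> 'p connection \<Rightarrow> bool" where
  "linear_connection A D \<longleftrightarrow>
     D \<in> (\<Pi>\<^sub>E u\<in>slit A. \<Pi>\<^sub>E X\<in>tangent_space (slit_atlas A) u. sections A \<rightarrow>\<^sub>E fibre A u) \<and>
     (\<forall>u\<in>slit A. \<forall>X\<in>tangent_space (slit_atlas A) u. \<forall>X'\<in>tangent_space (slit_atlas A) u.
        \<forall>a b. \<forall>Y\<in>sections A.
          D u (a *\<^sub>T X + b *\<^sub>T X') Y = a *\<^sub>T D u X Y + b *\<^sub>T D u X' Y) \<and>
     (\<forall>u\<in>slit A. \<forall>X\<in>tangent_space (slit_atlas A) u. \<forall>Y\<in>sections A. \<forall>Y'\<in>sections A.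
          D u X (\<lambda>w\<in>slit A. Y w + Y' w) = D u X Y + D u X Y') \<and>
     (\<forall>u\<in>slit A. \<forall>X\<in>tangent_space (slit_atlas A) u. \<forall>f. \<forall>Y\<in>sections A.
        smooth_fun (slit_atlas A) f \<longrightarrow>
          D u X (\<lambda>w\<in>slit A. f w *\<^sub>T Y w) = X f *\<^sub>T Y u + f u *\<^sub>T D u X Y) \<and>
     (\<forall>X\<in>vector_fields (slit_atlas A). \<forall>Y\<in>sections A.
        (\<lambda>u\<in>slit A. D u (X u) Y) \<in> sections A)"

definition connection_map ::
  "('p, 'e::euclidean_space) atlas \<Rightarrow> 'p connection \<Rightarrow> 'p tpoint \<Rightarrow> 'p tpoint tvec \<Rightarrow> 'p tvec" where
  "connection_map A D u X = D u X (fundamental_section A)"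

definition horizontal_space ::
  "('p, 'e::euclidean_space) atlas \<Rightarrow> 'p connection \<Rightarrow> 'p tpoint \<Rightarrow> 'p tpoint tvec set" where
  "horizontal_space A D u = {X \<in> tangent_space (slit_atlas A) u. connection_map A D u X = 0}"

definition regular_connection :: "('p, 'e::euclidean_space) atlas \<Rightarrow> 'p connection \<Rightarrow> bool" where
  "regular_connection A D \<longleftrightarrow>
     linear_connection A D \<and>
     (\<forall>u\<in>slit A. \<forall>X\<in>tangent_space (slit_atlas A) u.
        \<exists>!VH. VH \<in> vertical_space A u \<times> horizontal_space A D u \<and> X = fst VH + snd VH)"

definition horizontal_map ::
  "('p, 'e::euclidean_space) atlas \<Rightarrow> 'p connection \<Rightarrow> 'p tpoint \<Rightarrow> 'p tvec \<Rightarrow> 'p tpoint tvec" where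
  "horizontal_map A D u = inv_into (horizontal_space A D u) (rho A u)"

definition rho_field ::
  "('p, 'e::euclidean_space) atlas \<Rightarrow> ('p tpoint \<Rightarrow> 'p tpoint tvec) \<Rightarrow> 'p bsection" where
  "rho_field A X = (\<lambda>u\<in>slit A. rho A u (X u))"

definition gamma_section ::
  "('p, 'e::euclidean_space) atlas \<Rightarrow> 'p bsection \<Rightarrow> 'p tpoint \<Rightarrow> 'p tpoint tvec" where
  "gamma_section A Y = (\<lambda>u\<in>slit A. gamma A u (Y u))"

definition beta_section ::
  "('p, 'e::euclidean_space) atlas \<Rightarrow> 'p connection \<Rightarrow> 'p bsection \<Rightarrow> 'p tpoint \<Rightarrow> 'p tpoint tvec" where
  "beta_section A D Y = (\<lambda>u\<in>slit A. horizontal_map A D u (Y u))"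

definition torsion ::
  "('p, 'e::euclidean_space) atlas \<Rightarrow> 'p connection \<Rightarrow>
     ('p tpoint \<Rightarrow> 'p tpoint tvec) \<Rightarrow> ('p tpoint \<Rightarrow> 'p tpoint tvec) \<Rightarrow> 'p bsection" where
  "torsion A D X Y = (\<lambda>u\<in>slit A.
     D u (X u) (rho_field A Y) - D u (Y u) (rho_field A X)
       - rho A u (lie_bracket (slit_atlas A) X Y u))"

definition horizontal_torsion ::
  "('p, 'e::euclidean_space) atlas \<Rightarrow> 'p connection \<Rightarrow> 'p bsection \<Rightarrow> 'p bsection \<Rightarrow> 'p bsection" where
  "horizontal_torsion A D X Y = torsion A D (beta_section A D X) (beta_section A D Y)"

definition mixed_torsion ::
  "('p, 'e::euclidean_space) atlas \<Rightarrow> 'p connection \<Rightarrow> 'p bsection \<Rightarrow> 'p bsection \<Rightarrow> 'p bsection" where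
  "mixed_torsion A D X Y = torsion A D (gamma_section A X) (beta_section A D Y)"


section \<open>Finsler structures\<close>

definition energy :: "('p tpoint \<Rightarrow> real) \<Rightarrow> 'p tpoint \<Rightarrow> real" where
  "energy L u = (L u)\<^sup>2 / 2"

text \<open>The fibrewise Hessian of the energy at \<open>u\<close>, evaluated on \<open>v, w \<in> T\<^bsub>\<pi>(u)\<^esub>M\<close>.\<close>

definition finsler_metric :: "('p tpoint \<Rightarrow> real) \<Rightarrow> 'p tpoint \<Rightarrow> 'p tvec \<Rightarrow> 'p tvec \<Rightarrow> real" where
  "finsler_metric L u v w =
     deriv (\<lambda>s. deriv (\<lambda>t. energy L (fst u, snd u + s *\<^sub>T v + t *\<^sub>T w)) 0) 0"

definition finsler_manifold ::
  "('p, 'e::euclidean_space) atlas \<Rightarrow> ('p tpoint \<Rightarrow> real) \<Rightarrow> bool" where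
  "finsler_manifold A L \<longleftrightarrow>
     smooth_manifold A \<and>
     continuous_map (manifold_topology (tangent_atlas A)) euclideanreal L \<and>
     smooth_fun (slit_atlas A) L \<and>
     (\<forall>u\<in>slit A. L u > 0) \<and>
     (\<forall>p\<in>carrier A. \<forall>v\<in>tangent_space A p. \<forall>t>0. L (p, t *\<^sub>T v) = t * L (p, v)) \<and>
     (\<forall>u\<in>slit A. \<forall>v\<in>fibre A u. v \<noteq> 0 \<longrightarrow> finsler_metric L u v v > 0)"

definition metric_connection ::
  "('p, 'e::euclidean_space) atlas \<Rightarrow> ('p tpoint \<Rightarrow> 'p tvec \<Rightarrow> 'p tvec \<Rightarrow> real) \<Rightarrow>
     'p connection \<Rightarrow> bool" where
  "metric_connection A g D \<longleftrightarrow>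
     (\<forall>u\<in>slit A. \<forall>X\<in>tangent_space (slit_atlas A) u. \<forall>Y\<in>sections A. \<forall>Z\<in>sections A.
        X (\<lambda>w. g w (Y w) (Z w)) - g u (D u X Y) (Z u) - g u (Y u) (D u X Z) = 0)"

end

theory Submission
  imports Defs
begin

text \<open>
  Everything happens at a single point \<open>u\<close> of the slit tangent bundle. A connection has coefficients
  \<open>\<Gamma>(a, b)\<close> in a chart, for \<open>a\<close> the base component and \<open>b\<close> the fibre component of the
  direction (\<open>connection_at_coefficients\<close>). The torsions look as if they involved derivatives of the horizontal
  map, but \<open>\<rho>[X, Y]\<close> only sees the projections of the two fields and their values at \<open>u\<close>
  (\<open>rho_lie_bracket\<close>). Hence the three conditions become algebraic equations for \<open>\<Gamma>\<close> at \<open>u\<close>, in which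
  the metric enters through its value and its first derivative: \<open>g\<close> is parallel, the horizontal
  coefficients \<open>\<Gamma>(\<beta> v) w\<close> are symmetric in \<open>v\<close> and \<open>w\<close>, and \<open>g(\<Gamma>(0, b) v, w)\<close> is symmetric in \<open>v\<close>
  and \<open>w\<close>.

  These equations have exactly one solution. In vertical directions, metricity and the symmetry give
  \<open>2 g(\<Gamma>(0, b) v, w) = \<partial>\<^sub>b g(v, w)\<close>, the derivative of \<open>g\<close> along the fibre (the Cartan
  tensor). It is a third derivative of the energy, hence totally symmetric, and by homogeneity it
  vanishes on the fundamental section \<open>y\<close>. Consequently the connection map is the identity on vertical
  vectors, and the connection is regular. In horizontal directions the Koszul argument expresses \<open>\<Gamma>(\<beta> v) w\<close> through derivatives of \<open>g\<close> along horizontal lifts \<open>\<beta>\<close>.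
  This is circular, because \<open>\<beta> v = (v, - N v)\<close> depends on the connection through
  \<open>N v = \<Gamma>(\<beta> v) y\<close>. The circle is broken by the vanishing of the Cartan tensor on \<open>y\<close>: with
  \<open>w = y\<close> the formula for \<open>N v\<close> contains the unknown \<open>N\<close> only as \<open>N y\<close>, and with \<open>v = w = y\<close> it contains
  no unknown at all. So \<open>N y\<close> (the canonical spray), then \<open>N\<close> (the canonical nonlinear connection),
  then the coefficients are determined in turn, and the same formulas define a solution
  (\<open>cartan_unique\<close>, \<open>cartan_metric\<close>, \<open>cartan_mixed\<close>, \<open>cartan_horizontal\<close>).

  For existence the solution is written down at each point in some chart around it. By pointwise
  uniqueness the result has the same expression in every chart, so it is smooth, since each of its
  ingredients is obtained by solving a linear system whose matrix is the positive definite metric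
  (\<open>smooth_linear_system\<close>). Passing from global sections to coefficients at a point needs enough
  global sections; they are made with bump functions on the base, which extend by zero because \<open>M\<close> is
  Hausdorff.
\<close>

section \<open>Calculus of smooth functions on open sets\<close>

abbreviation dird :: "('e::real_normed_vector \<Rightarrow> 'f::real_normed_vector) \<Rightarrow> 'e \<Rightarrow> 'e \<Rightarrow> 'f" where
  "dird f x v \<equiv> frechet_derivative f (at x) v"

lemma dird_eqI: "(f has_derivative f') (at x) \<Longrightarrow> dird f x v = f' v"
  using frechet_derivative_at by metis

lemma dird_cong_open:
  assumes "open S" "x \<in> S" "\<And>z. z \<in> S \<Longrightarrow> f z = g z"
  shows "dird f x v = dird g x v"
proof -
  have "(f has_derivative D) (at x) \<longleftrightarrow> (g has_derivative D) (at x)" for D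
    using has_derivative_transform_within_open[OF _ assms(1,2)] assms(3) by metis
  then show ?thesis unfolding frechet_derivative_def by simp
qed

lemma Ck_on_subset: "Ck_on k S f \<Longrightarrow> T \<subseteq> S \<Longrightarrow> Ck_on k T f"
  by (induction k arbitrary: f) (auto intro: continuous_on_subset)

lemma Ck_on_cong_imp:
  assumes "open S"
  shows "(\<And>x. x \<in> S \<Longrightarrow> f x = g x) \<Longrightarrow> Ck_on k S f \<Longrightarrow> Ck_on k S g"
proof (induction k arbitrary: f g)
  case 0
  then show ?case by (simp cong: continuous_on_cong)
next
  case (Suc k)
  have "g differentiable (at x)" if "x \<in> S" for x
  proof -
    have "(f has_derivative dird f x) (at x)"
      using Suc.prems(2) that frechet_derivative_works by auto
    then have "(g has_derivative dird f x) (at x)"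
      by (rule has_derivative_transform_within_open[OF _ assms that]) (use Suc.prems(1) in simp)
    then show ?thesis by (auto simp: differentiable_def)
  qed
  moreover have "Ck_on k S (\<lambda>x. dird g x v)" for v
    by (rule Suc.IH[where f = "\<lambda>x. dird f x v"])
      (use Suc.prems in \<open>auto intro: dird_cong_open[OF assms]\<close>)
  ultimately show ?case by simp
qed

lemma Ck_on_cong:
  assumes "open S" "\<And>x. x \<in> S \<Longrightarrow> f x = g x"
  shows "Ck_on k S f \<longleftrightarrow> Ck_on k S g"
  using Ck_on_cong_imp[OF assms(1)] assms(2) by metis

lemma Ck_on_local:
  "(\<And>x. x \<in> S \<Longrightarrow> \<exists>W. open W \<and> x \<in> W \<and> Ck_on k W f) \<Longrightarrow> Ck_on k S f"
proof (induction k arbitrary: f)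
  case 0
  have "isCont f x" if "x \<in> S" for x
    using 0[OF that] by (auto simp: continuous_on_eq_continuous_at)
  then show ?case by (simp add: continuous_at_imp_continuous_on)
next
  case (Suc k)
  have "Ck_on k S (\<lambda>x. dird f x v)" for v
    by (rule Suc.IH) (use Suc.prems in \<open>force simp: Ck_on.simps(2)\<close>)
  moreover have "f differentiable (at x)" if "x \<in> S" for x
    using Suc.prems[OF that] by auto
  ultimately show ?case by simp
qed

lemma Ck_on_SucD: "Ck_on (Suc k) S f \<Longrightarrow> Ck_on k S f"
proof (induction k arbitrary: f)
  case 0
  then show ?case
    by (simp add: differentiable_imp_continuous_within continuous_at_imp_continuous_on)
next
  case (Suc k)
  then show ?case by (metis Ck_on.simps(2))
qed

lemma Ck_on_const: "Ck_on k S (\<lambda>x. c)"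
  by (induction k arbitrary: c) auto

lemma Ck_on_linear: "bounded_linear h \<Longrightarrow> Ck_on k S h"
proof (cases k)
  case (Suc m)
  assume h: "bounded_linear h"
  then have "(h has_derivative h) (at x)" for x
    by (simp add: bounded_linear_imp_has_derivative)
  then have "h differentiable (at x)" "dird h x v = h v" for x v
    using dird_eqI differentiable_def by blast+
  then show ?thesis using Suc by (simp add: Ck_on_const)
qed (simp add: linear_continuous_on)

lemma Ck_on_add: 
  assumes "open S"
  shows "Ck_on k S f \<Longrightarrow> Ck_on k S g \<Longrightarrow> Ck_on k S (\<lambda>x. f x + g x)"
proof (induction k arbitrary: f g)
  case 0 then show ?case by (simp add: continuous_on_add)
next
  case (Suc k)
  have *: "((\<lambda>x. f x + g x) has_derivative (\<lambda>v. dird f x v + dird g x v)) (at x)" if "x \<in> S" for x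
    using Suc.prems that by (auto intro!: has_derivative_add simp: frechet_derivative_works[symmetric])
  have "Ck_on k S (\<lambda>x. dird (\<lambda>x. f x + g x) x v)" for v
    by (rule Ck_on_cong_imp[OF assms, where f = "\<lambda>x. dird f x v + dird g x v"])
      (use Suc.prems in \<open>auto intro!: Suc.IH simp: dird_eqI[OF *]\<close>)
  then show ?case using * by (auto simp: differentiable_def)
qed

lemma Ck_on_bilinear:
  assumes "open S" "bounded_bilinear B"
  shows "Ck_on k S f \<Longrightarrow> Ck_on k S g \<Longrightarrow> Ck_on k S (\<lambda>x. B (f x) (g x))"
proof (induction k arbitrary: f g)
  case 0 then show ?case by (simp add: bounded_bilinear.continuous_on[OF assms(2)])
next
  case (Suc k)
  have *: "((\<lambda>x. B (f x) (g x)) has_derivative (\<lambda>v. B (f x) (dird g x v) + B (dird f x v) (g x))) (at x)"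
    if "x \<in> S" for x
    using Suc.prems that
    by (auto intro!: bounded_bilinear.FDERIV[OF assms(2)] simp: frechet_derivative_works[symmetric])
  have "Ck_on k S (\<lambda>x. dird (\<lambda>x. B (f x) (g x)) x v)" for v
  proof (rule Ck_on_cong_imp[OF assms(1)])
    show "Ck_on k S (\<lambda>x. B (f x) (dird g x v) + B (dird f x v) (g x))"
      using Suc.prems Ck_on_SucD[OF Suc.prems(1)] Ck_on_SucD[OF Suc.prems(2)]
      by (intro Ck_on_add[OF assms(1)] Suc.IH) simp_all
  qed (simp add: dird_eqI[OF *])
  then show ?case using * by (auto simp: differentiable_def)
qed

lemma Ck_on_sum:
  assumes "open S" "\<And>i. i \<in> I \<Longrightarrow> Ck_on k S (f i)"
  shows "Ck_on k S (\<lambda>x. \<Sum>i\<in>I. f i x)"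
  using assms(2)
  by (induction I rule: infinite_finite_induct) (auto intro: Ck_on_add Ck_on_const assms(1))

lemma linear_Basis_expand:
  assumes "linear h"
  shows "h (w::'e::euclidean_space) = (\<Sum>b\<in>Basis. (w \<bullet> b) *\<^sub>R h b)"
proof -
  have "h w = h (\<Sum>b\<in>Basis. (w \<bullet> b) *\<^sub>R b)" by (simp add: euclidean_representation)
  then show ?thesis by (simp add: linear_sum[OF assms] linear_cmul[OF assms])
qed

lemma linear_dird: "f differentiable (at x) \<Longrightarrow> linear (dird f x)"
  by (simp add: linear_frechet_derivative)

text \<open>The chain rule gives the derivative of a composition as a composition with a varying vector in it;
  expanding that vector in a basis leaves only compositions with fixed directions, to which the
  induction hypothesis applies.\<close>

lemma Ck_on_compose:
  fixes f :: "'e::euclidean_space \<Rightarrow> 'f::real_normed_vector"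
    and g :: "'d::real_normed_vector \<Rightarrow> 'e"
  assumes "open S" "open T" "g ` S \<subseteq> T"
  shows "Ck_on k S g \<Longrightarrow> Ck_on k T f \<Longrightarrow> Ck_on k S (\<lambda>x. f (g x))"
proof (induction k arbitrary: f)
  case 0
  then show ?case using continuous_on_compose2[OF _ _ assms(3)] by simp
next
  case (Suc k)
  have *: "((\<lambda>x. f (g x)) has_derivative (\<lambda>v. dird f (g x) (dird g x v))) (at x)"
    if "x \<in> S" for x
  proof -
    have "(g has_derivative dird g x) (at x)" "(f has_derivative dird f (g x)) (at (g x))"
      using Suc.prems that assms(3) by (auto simp: frechet_derivative_works[symmetric])
    then show ?thesis by (rule has_derivative_compose)
  qed
  have "Ck_on k S (\<lambda>x. dird (\<lambda>x. f (g x)) x v)" for v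
  proof (rule Ck_on_cong_imp[OF assms(1)])
    show "Ck_on k S (\<lambda>x. \<Sum>b\<in>Basis. (dird g x v \<bullet> b) *\<^sub>R dird f (g x) b)"
    proof (intro Ck_on_sum[OF assms(1)] Ck_on_bilinear[OF assms(1) bounded_bilinear_scaleR])
      fix b :: 'e
      show "Ck_on k S (\<lambda>x. dird g x v \<bullet> b)"
        using Suc.prems(1) by (intro Ck_on_bilinear[OF assms(1) bounded_bilinear_inner] Ck_on_const) simp
      show "Ck_on k S (\<lambda>x. dird f (g x) b)"
        using Suc.prems(2) by (intro Suc.IH Ck_on_SucD[OF Suc.prems(1)]) simp
    qed
    fix x assume "x \<in> S"
    then show "(\<Sum>b\<in>Basis. (dird g x v \<bullet> b) *\<^sub>R dird f (g x) b) = dird (\<lambda>x. f (g x)) x v"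
      using dird_eqI[OF *] Suc.prems(2) assms(3)
        linear_Basis_expand[OF linear_dird[of f "g x"], of "dird g x v"] by auto
  qed
  then show ?case using * by (auto simp: differentiable_def)
qed

lemma Ck_on_inverse:
  fixes f :: "'e::real_normed_vector \<Rightarrow> real"
  assumes "open S" "\<And>x. x \<in> S \<Longrightarrow> f x \<noteq> 0"
  shows "Ck_on k S f \<Longrightarrow> Ck_on k S (\<lambda>x. inverse (f x))"
proof (induction k)
  case 0
  then show ?case using assms(2) by (auto intro: continuous_on_inverse)
next
  case (Suc k)
  have *: "((\<lambda>x. inverse (f x)) has_derivative (\<lambda>v. - (inverse (f x) * dird f x v * inverse (f x)))) (at x)"
    if "x \<in> S" for x
    using Suc.prems that assms(2)
    by (auto intro!: has_derivative_inverse simp: frechet_derivative_works[symmetric])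
  have "Ck_on k S (\<lambda>x. dird (\<lambda>x. inverse (f x)) x v)" for v
  proof (rule Ck_on_cong_imp[OF assms(1)])
    show "Ck_on k S (\<lambda>x. (-1) * (inverse (f x) * dird f x v * inverse (f x)))"
      using Suc.prems Ck_on_SucD[OF Suc.prems(1)] Suc.IH
      by (intro Ck_on_bilinear[OF assms(1) bounded_bilinear_mult] Ck_on_const) auto
  qed (simp add: dird_eqI[OF *])
  then show ?case using * by (auto simp: differentiable_def)
qed

lemma smooth_on_subset: "smooth_on S f \<Longrightarrow> T \<subseteq> S \<Longrightarrow> smooth_on T f"
  by (auto simp: smooth_on_def intro: Ck_on_subset)

lemma smooth_on_cong:
  "open S \<Longrightarrow> (\<And>x. x \<in> S \<Longrightarrow> f x = g x) \<Longrightarrow> smooth_on S f \<longleftrightarrow> smooth_on S g"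
  using Ck_on_cong[of S f g] by (simp add: smooth_on_def)

lemma smooth_on_transform:
  "smooth_on S f \<Longrightarrow> open S \<Longrightarrow> (\<And>x. x \<in> S \<Longrightarrow> g x = f x) \<Longrightarrow> smooth_on S g"
  using smooth_on_cong[of S g f] by simp

lemma smooth_on_local:
  "(\<And>x. x \<in> S \<Longrightarrow> \<exists>W. open W \<and> x \<in> W \<and> smooth_on W f) \<Longrightarrow> smooth_on S f"
  unfolding smooth_on_def by (intro allI Ck_on_local) blast

lemma smooth_on_const: "smooth_on S (\<lambda>x. c)"
  by (simp add: smooth_on_def Ck_on_const)

lemma smooth_on_linear: "bounded_linear h \<Longrightarrow> smooth_on S h"
  by (simp add: smooth_on_def Ck_on_linear)

lemma smooth_on_add:
  "open S \<Longrightarrow> smooth_on S f \<Longrightarrow> smooth_on S g \<Longrightarrow> smooth_on S (\<lambda>x. f x + g x)"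
  by (simp add: smooth_on_def Ck_on_add)

lemma smooth_on_bilinear:
  "bounded_bilinear B \<Longrightarrow> open S \<Longrightarrow> smooth_on S f \<Longrightarrow> smooth_on S g \<Longrightarrow> smooth_on S (\<lambda>x. B (f x) (g x))"
  by (simp add: smooth_on_def Ck_on_bilinear)

lemmas smooth_on_mult = smooth_on_bilinear[OF bounded_bilinear_mult]
lemmas smooth_on_scaleR = smooth_on_bilinear[OF bounded_bilinear_scaleR]
lemmas smooth_on_inner = smooth_on_bilinear[OF bounded_bilinear_inner]

lemma smooth_on_sum:
  "open S \<Longrightarrow> (\<And>i. i \<in> I \<Longrightarrow> smooth_on S (f i)) \<Longrightarrow> smooth_on S (\<lambda>x. \<Sum>i\<in>I. f i x)"
  by (simp add: smooth_on_def Ck_on_sum)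

lemma smooth_on_compose:
  fixes f :: "'e::euclidean_space \<Rightarrow> 'f::real_normed_vector"
  assumes "smooth_on T f" "open T" "smooth_on S g" "open S" "g ` S \<subseteq> T"
  shows "smooth_on S (\<lambda>x. f (g x))"
  using assms by (simp add: smooth_on_def Ck_on_compose)

lemma smooth_on_linear_compose:
  fixes h :: "'e::euclidean_space \<Rightarrow> 'f::real_normed_vector"
  assumes "bounded_linear h" "open S" "smooth_on S g"
  shows "smooth_on S (\<lambda>x. h (g x))"
  using smooth_on_compose[OF smooth_on_linear[OF assms(1), of UNIV] open_UNIV assms(3,2)] by simp

lemma smooth_on_minus:
  fixes f :: "_ \<Rightarrow> 'f::euclidean_space"
  shows "open S \<Longrightarrow> smooth_on S f \<Longrightarrow> smooth_on S (\<lambda>x. - f x)"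
  by (rule smooth_on_linear_compose[OF bounded_linear_minus[OF bounded_linear_ident]])

lemma smooth_on_diff:
  fixes f :: "_ \<Rightarrow> 'f::euclidean_space"
  shows "open S \<Longrightarrow> smooth_on S f \<Longrightarrow> smooth_on S g \<Longrightarrow> smooth_on S (\<lambda>x. f x - g x)"
  using smooth_on_add[OF _ _ smooth_on_minus, of S f g] by simp

lemma smooth_on_fst: "open S \<Longrightarrow> smooth_on S f \<Longrightarrow> smooth_on S (\<lambda>x. fst (f x :: 'e::euclidean_space \<times> 'f::euclidean_space))"
  by (rule smooth_on_linear_compose[OF bounded_linear_fst])

lemma smooth_on_snd: "open S \<Longrightarrow> smooth_on S f \<Longrightarrow> smooth_on S (\<lambda>x. snd (f x :: 'e::euclidean_space \<times> 'f::euclidean_space))"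
  by (rule smooth_on_linear_compose[OF bounded_linear_snd])

lemma smooth_on_Pair:
  fixes f :: "_ \<Rightarrow> 'e::euclidean_space" and g :: "_ \<Rightarrow> 'f::euclidean_space"
  assumes "open S" "smooth_on S f" "smooth_on S g"
  shows "smooth_on S (\<lambda>x. (f x, g x))"
proof -
  have "smooth_on S (\<lambda>x. (f x, 0) + (0, g x))"
    using assms
    by (intro smooth_on_add smooth_on_linear_compose[of "\<lambda>a. (a, 0)"] smooth_on_linear_compose[of "\<lambda>a. (0, a)"]
         bounded_linear_Pair bounded_linear_ident bounded_linear_zero) auto
  then show ?thesis by simp
qed

lemma smooth_on_inverse:
  fixes f :: "_ \<Rightarrow> real"
  shows "open S \<Longrightarrow> smooth_on S f \<Longrightarrow> (\<And>x. x \<in> S \<Longrightarrow> f x \<noteq> 0) \<Longrightarrow> smooth_on S (\<lambda>x. inverse (f x))"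
  by (simp add: smooth_on_def Ck_on_inverse)

lemma smooth_on_differentiable: "smooth_on S f \<Longrightarrow> x \<in> S \<Longrightarrow> f differentiable (at x)"
  unfolding smooth_on_def by (metis Ck_on.simps(2))

lemma smooth_on_has_derivative: "smooth_on S f \<Longrightarrow> x \<in> S \<Longrightarrow> (f has_derivative dird f x) (at x)"
  using smooth_on_differentiable frechet_derivative_works by blast

lemma smooth_on_linear_dird: "smooth_on S f \<Longrightarrow> x \<in> S \<Longrightarrow> linear (dird f x)"
  using smooth_on_differentiable linear_dird by blast

lemma smooth_on_continuous_on: "smooth_on S f \<Longrightarrow> continuous_on S f"
  unfolding smooth_on_def by (metis Ck_on.simps(1))

lemma smooth_on_dird: "smooth_on S f \<Longrightarrow> smooth_on S (\<lambda>x. dird f x v)"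
  unfolding smooth_on_def by (metis Ck_on.simps(2))

text \<open>Expanding the argument in a basis reduces smoothness in the point and the argument jointly to
  smoothness in the point for each fixed argument.\<close>

lemma smooth_on_linear_apply:
  fixes v :: "_ \<Rightarrow> 'e::euclidean_space"
  assumes "open S" "\<And>x. x \<in> S \<Longrightarrow> linear (T x)" "\<And>e. smooth_on S (\<lambda>x. T x e)" "smooth_on S v"
  shows "smooth_on S (\<lambda>x. T x (v x))"
proof -
  have "smooth_on S (\<lambda>x. \<Sum>b\<in>Basis. (v x \<bullet> b) *\<^sub>R T x b)"
    using assms by (intro smooth_on_sum smooth_on_scaleR smooth_on_inner smooth_on_const) auto
  then show ?thesis
    using smooth_on_cong[OF assms(1), of "\<lambda>x. T x (v x)" "\<lambda>x. \<Sum>b\<in>Basis. (v x \<bullet> b) *\<^sub>R T x b"]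
      linear_Basis_expand[OF assms(2)] by blast
qed

lemma dird_chain:
  assumes "smooth_on S g" "x \<in> S" "smooth_on T f" "g x \<in> T"
  shows "dird (\<lambda>x. f (g x)) x v = dird f (g x) (dird g x v)"
  using dird_eqI[OF has_derivative_compose[OF smooth_on_has_derivative smooth_on_has_derivative]] assms
  by blast

text \<open>The product rule for the pairing of a family of linear maps with a vector-valued function.\<close>

lemma dird_linear_apply:
  fixes v :: "_ \<Rightarrow> 'e::euclidean_space"
  assumes S: "open S" "x \<in> S" and T: "\<And>x. x \<in> S \<Longrightarrow> linear (T x)" "\<And>e. smooth_on S (\<lambda>x. T x e)"
    and v: "smooth_on S v"
  shows "dird (\<lambda>x. T x (v x)) x w = dird (\<lambda>z. T z (v x)) x w + T x (dird v x w)"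
proof -
  have "dird (\<lambda>x. T x (v x)) x w = dird (\<lambda>x. \<Sum>b\<in>Basis. (v x \<bullet> b) *\<^sub>R T x b) x w"
    by (rule dird_cong_open[OF S]) (rule linear_Basis_expand[OF T(1)])
  also have "\<dots> = (\<Sum>b\<in>Basis. (v x \<bullet> b) *\<^sub>R dird (\<lambda>x. T x b) x w + (dird v x w \<bullet> b) *\<^sub>R T x b)"
    by (rule dird_eqI)
      (auto intro!: derivative_eq_intros smooth_on_has_derivative[OF v S(2)]
        smooth_on_has_derivative[OF T(2) S(2)])
  also have "\<dots> = (\<Sum>b\<in>Basis. (v x \<bullet> b) *\<^sub>R dird (\<lambda>x. T x b) x w) + T x (dird v x w)"
    by (simp add: sum.distrib linear_Basis_expand[OF T(1)[OF S(2)], of "dird v x w"])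
  also have "(\<Sum>b\<in>Basis. (v x \<bullet> b) *\<^sub>R dird (\<lambda>x. T x b) x w) = dird (\<lambda>z. \<Sum>b\<in>Basis. (v x \<bullet> b) *\<^sub>R T z b) x w"
    by (rule dird_eqI[symmetric]) (auto intro!: derivative_eq_intros smooth_on_has_derivative[OF T(2) S(2)])
  also have "\<dots> = dird (\<lambda>z. T z (v x)) x w"
    by (rule dird_cong_open[OF S]) (rule linear_Basis_expand[OF T(1), symmetric])
  finally show ?thesis .
qed

section \<open>Symmetry of second derivatives\<close>

lemma has_vector_derivative_along_line:
  assumes "smooth_on S f" "p + t *\<^sub>R v \<in> S"
  shows "((\<lambda>t. f (p + t *\<^sub>R v)) has_vector_derivative dird f (p + t *\<^sub>R v) v) (at t)"
proof -
  have "((\<lambda>t. p + t *\<^sub>R v) has_derivative (\<lambda>h. h *\<^sub>R v)) (at t)"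
    by (auto intro!: derivative_eq_intros)
  then have "((\<lambda>t. f (p + t *\<^sub>R v)) has_derivative (\<lambda>h. dird f (p + t *\<^sub>R v) (h *\<^sub>R v))) (at t)"
    by (rule has_derivative_compose) (rule smooth_on_has_derivative[OF assms])
  then show ?thesis
    by (simp add: has_vector_derivative_def linear_cmul[OF smooth_on_linear_dird[OF assms]])
qed

lemma DERIV_along_line:
  fixes f :: "_ \<Rightarrow> real"
  assumes "smooth_on S f" "p + t *\<^sub>R v \<in> S"
  shows "((\<lambda>t. f (p + t *\<^sub>R v)) has_real_derivative dird f (p + t *\<^sub>R v) v) (at t)"
  using has_vector_derivative_along_line[OF assms]
  by (simp add: has_real_derivative_iff_has_vector_derivative)

text \<open>The mean value theorem, used first in the direction \<open>v\<close> and then in the direction \<open>w\<close>, turns the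
  second difference into a mixed derivative at some point of the parallelogram.\<close>

lemma second_difference_mean_value:
  fixes f :: "'e::real_normed_vector \<Rightarrow> real"
  assumes f: "smooth_on S f" and e: "e > 0"
    and S: "\<And>a b. 0 \<le> a \<Longrightarrow> a \<le> e \<Longrightarrow> 0 \<le> b \<Longrightarrow> b \<le> e \<Longrightarrow> x + a *\<^sub>R v + b *\<^sub>R w \<in> S"
  shows "\<exists>a b. 0 < a \<and> a < e \<and> 0 < b \<and> b < e \<and>
    f (x + e *\<^sub>R v + e *\<^sub>R w) - f (x + e *\<^sub>R v) - f (x + e *\<^sub>R w) + f x =
      e * (e * dird (\<lambda>z. dird f z v) (x + a *\<^sub>R v + b *\<^sub>R w) w)"
proof -
  define F where "F = (\<lambda>s. f ((x + e *\<^sub>R w) + s *\<^sub>R v) - f (x + s *\<^sub>R v))"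
  have "(F has_real_derivative dird f ((x + e *\<^sub>R w) + s *\<^sub>R v) v - dird f (x + s *\<^sub>R v) v) (at s)"
    if "0 \<le> s" "s \<le> e" for s
    unfolding F_def using S[of s e] S[of s 0] that e
    by (intro DERIV_diff DERIV_along_line[OF f]) (simp_all add: algebra_simps)
  then obtain a where a: "0 < a" "a < e"
    "F e - F 0 = (e - 0) * (dird f ((x + e *\<^sub>R w) + a *\<^sub>R v) v - dird f (x + a *\<^sub>R v) v)"
    using MVT2[OF e, of F "\<lambda>s. dird f ((x + e *\<^sub>R w) + s *\<^sub>R v) v - dird f (x + s *\<^sub>R v) v"] by metis
  define G where "G = (\<lambda>t. dird f ((x + a *\<^sub>R v) + t *\<^sub>R w) v)"
  have "(G has_real_derivative dird (\<lambda>z. dird f z v) (x + a *\<^sub>R v + t *\<^sub>R w) w) (at t)"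
    if "0 \<le> t" "t \<le> e" for t
    unfolding G_def using S[of a t] that a by (intro DERIV_along_line[OF smooth_on_dird[OF f]]) simp
  then obtain b where b: "0 < b" "b < e"
    "G e - G 0 = (e - 0) * dird (\<lambda>z. dird f z v) (x + a *\<^sub>R v + b *\<^sub>R w) w"
    using MVT2[OF e, of G "\<lambda>t. dird (\<lambda>z. dird f z v) (x + a *\<^sub>R v + t *\<^sub>R w) w"] by metis
  have "F e - F 0 = e * (G e - G 0)"
    using a(3) by (simp add: G_def algebra_simps)
  moreover have "F e - F 0 = f (x + e *\<^sub>R v + e *\<^sub>R w) - f (x + e *\<^sub>R v) - f (x + e *\<^sub>R w) + f x"
    by (simp add: F_def algebra_simps)
  ultimately have "f (x + e *\<^sub>R v + e *\<^sub>R w) - f (x + e *\<^sub>R v) - f (x + e *\<^sub>R w) + f x =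
      e * (e * dird (\<lambda>z. dird f z v) (x + a *\<^sub>R v + b *\<^sub>R w) w)"
    using b(3) by simp
  then show ?thesis using a b by blast
qed

text \<open>Both mixed derivatives occur, at nearby points, as the same second difference quotient over a
  small parallelogram; continuity of the second derivatives then identifies their values at the vertex.\<close>

lemma second_dird_symmetric:
  fixes f :: "'e::real_normed_vector \<Rightarrow> real"
  assumes f: "smooth_on S f" and S: "open S" "x \<in> S"
  shows "dird (\<lambda>z. dird f z v) x w = dird (\<lambda>z. dird f z w) x v"
proof (rule ccontr)
  define P where "P = (\<lambda>z. dird (\<lambda>z. dird f z v) z w)"
  define Q where "Q = (\<lambda>z. dird (\<lambda>z. dird f z w) z v)"
  assume "\<not> ?thesis"
  then have pos: "dist (P x) (Q x) / 2 > 0" by (simp add: P_def Q_def)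
  have "smooth_on S P" "smooth_on S Q"
    unfolding P_def Q_def by (intro smooth_on_dird f)+
  then have cont: "isCont P x" "isCont Q x"
    using smooth_on_continuous_on continuous_on_eq_continuous_at[OF S(1)] S(2) by blast+
  obtain d1 where d1: "d1 > 0" "\<And>z. dist z x < d1 \<Longrightarrow> dist (P z) (P x) < dist (P x) (Q x) / 2"
    using cont(1) pos unfolding continuous_at_eps_delta by blast
  obtain d2 where d2: "d2 > 0" "\<And>z. dist z x < d2 \<Longrightarrow> dist (Q z) (Q x) < dist (P x) (Q x) / 2"
    using cont(2) pos unfolding continuous_at_eps_delta by blast
  obtain d3 where d3: "d3 > 0" "ball x d3 \<subseteq> S" using S open_contains_ball by blast
  define d where "d = min d1 (min d2 d3)"
  have d: "d > 0" using d1 d2 d3 by (simp add: d_def)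
  \<comment> \<open>With this side length the whole parallelogram lies in the ball of radius \<open>d\<close>.\<close>
  define e where "e = d / (2 * (norm v + norm w + 1))"
  have e: "e > 0" using d by (simp add: e_def add_nonneg_pos)
  have e2: "e * (norm v + norm w) < d"
  proof -
    have "e * (norm v + norm w) \<le> e * (norm v + norm w + 1)" using e by simp
    also have "\<dots> = d / 2" by (simp add: e_def field_simps add_nonneg_eq_0_iff)
    finally show ?thesis using d by simp
  qed
  have close: "dist (x + a *\<^sub>R v + b *\<^sub>R w) x < d" if "0 \<le> a" "a \<le> e" "0 \<le> b" "b \<le> e" for a b
  proof -
    have "dist (x + a *\<^sub>R v + b *\<^sub>R w) x = norm (a *\<^sub>R v + b *\<^sub>R w)" by (simp add: dist_norm)
    also have "\<dots> \<le> a * norm v + b * norm w"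
      using norm_triangle_ineq[of "a *\<^sub>R v" "b *\<^sub>R w"] that by simp
    also have "\<dots> \<le> e * norm v + e * norm w"
      using that by (intro add_mono mult_right_mono) auto
    finally show ?thesis using e2 by (simp add: distrib_left)
  qed
  have inS: "x + a *\<^sub>R v + b *\<^sub>R w \<in> S" if "0 \<le> a" "a \<le> e" "0 \<le> b" "b \<le> e" for a b
    using close[OF that] d3 by (auto simp: d_def dist_commute)
  obtain a b where ab: "0 < a" "a < e" "0 < b" "b < e"
    "f (x + e *\<^sub>R v + e *\<^sub>R w) - f (x + e *\<^sub>R v) - f (x + e *\<^sub>R w) + f x = e * (e * P (x + a *\<^sub>R v + b *\<^sub>R w))"
    using second_difference_mean_value[OF f e inS] unfolding P_def by blast
  have inS': "x + a *\<^sub>R w + b *\<^sub>R v \<in> S" if "0 \<le> a" "a \<le> e" "0 \<le> b" "b \<le> e" for a b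
    using inS[of b a] that by (simp add: algebra_simps)
  obtain a' b' where ab': "0 < a'" "a' < e" "0 < b'" "b' < e"
    "f (x + e *\<^sub>R w + e *\<^sub>R v) - f (x + e *\<^sub>R w) - f (x + e *\<^sub>R v) + f x = e * (e * Q (x + a' *\<^sub>R w + b' *\<^sub>R v))"
    using second_difference_mean_value[OF f e inS'] unfolding Q_def by blast
  have "e * (e * P (x + a *\<^sub>R v + b *\<^sub>R w)) = e * (e * Q (x + b' *\<^sub>R v + a' *\<^sub>R w))"
    using ab(5) ab'(5) by (simp add: algebra_simps)
  then have "P (x + a *\<^sub>R v + b *\<^sub>R w) = Q (x + b' *\<^sub>R v + a' *\<^sub>R w)" using e by simp
  moreover have "dist (P (x + a *\<^sub>R v + b *\<^sub>R w)) (P x) < dist (P x) (Q x) / 2"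
    using d1(2) close[of a b] ab by (simp add: d_def)
  moreover have "dist (Q (x + b' *\<^sub>R v + a' *\<^sub>R w)) (Q x) < dist (P x) (Q x) / 2"
    using d2(2) close[of b' a'] ab' by (simp add: d_def)
  ultimately show False
    by (metis dist_commute dist_triangle_half_l less_irrefl)
qed

section \<open>A bump function\<close>

text \<open>All derivatives of \<open>exp (- 1 / x)\<close> are combinations of members of this family, and every member
  vanishes to second order at \<open>0\<close>.\<close>

definition flat :: "nat \<Rightarrow> real \<Rightarrow> real" where
  "flat n x = (if x > 0 then (1 / x) ^ n * exp (- (1 / x)) else 0)"

lemma flat_bound: "\<bar>flat n x\<bar> \<le> fact (n + 2) * x\<^sup>2"
proof (cases "x > 0")
  case True
  define y where "y = 1 / x"
  have y: "y > 0" using True by (simp add: y_def)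
  \<comment> \<open>A single term of the exponential series.\<close>
  have "y ^ (n + 2) / fact (n + 2) \<le> exp y"
  proof -
    have "sum (\<lambda>k. y ^ k /\<^sub>R fact k) {n + 2} \<le> suminf (\<lambda>k. y ^ k /\<^sub>R fact k)"
      using y exp_converges[of y] by (intro sum_le_suminf) (auto simp: sums_iff)
    then show ?thesis using exp_converges[of y] by (simp add: sums_iff divide_inverse mult.commute)
  qed
  then have "y ^ n * y\<^sup>2 \<le> fact (n + 2) * exp y"
    by (simp only: pos_divide_le_eq[OF fact_gt_zero] power_add mult.commute)
  then have "y ^ n * exp (- y) * y\<^sup>2 \<le> fact (n + 2)"
    by (simp add: exp_minus field_simps)
  then have *: "y ^ n * exp (- y) * y\<^sup>2 * x\<^sup>2 \<le> fact (n + 2) * x\<^sup>2"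
    by (rule mult_right_mono) simp
  have "y * x = 1" using True by (simp add: y_def)
  moreover have "y ^ n * exp (- y) * y\<^sup>2 * x\<^sup>2 = y ^ n * exp (- y) * (y * x)\<^sup>2"
    by (simp add: power_mult_distrib)
  ultimately have "y ^ n * exp (- y) * (y * x)\<^sup>2 \<le> fact (n + 2) * x\<^sup>2"
    using * by (simp only:)
  then have "y ^ n * exp (- y) \<le> fact (n + 2) * x\<^sup>2" using \<open>y * x = 1\<close> by simp
  then show ?thesis using True y by (simp add: flat_def y_def abs_mult)
qed (simp add: flat_def)

lemma flat_DERIV: "(flat n has_real_derivative (- real n * flat (n + 1) x + flat (n + 2) x)) (at x)"
proof -
  consider "x > 0" | "x < 0" | "x = 0" by linarith
  then show ?thesis
  proof cases
    case 1
    have "((\<lambda>x. (1 / x) ^ n * exp (- (1 / x))) has_real_derivative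
        (- real n * flat (n + 1) x + flat (n + 2) x)) (at x)"
    proof -
      have y: "((\<lambda>x. 1 / x) has_real_derivative - (1 / x)\<^sup>2) (at x)"
        using 1 by (auto intro!: derivative_eq_intros simp: power2_eq_square)
      have "((\<lambda>x. exp (- (1 / x))) has_real_derivative exp (- (1 / x)) * (- (- (1 / x)\<^sup>2))) (at x)"
        by (rule DERIV_fun_exp[OF DERIV_minus[OF y]])
      from DERIV_mult[OF DERIV_power[OF y, of n] this] show ?thesis
        by (rule DERIV_cong) (use 1 in \<open>cases n; simp add: flat_def field_simps power2_eq_square\<close>)
    qed
    then show ?thesis
      by (rule has_field_derivative_transform_within_open[where S = "{0<..}"]) (use 1 in \<open>auto simp: flat_def\<close>)
  next
    case 2
    have "((\<lambda>x. 0) has_real_derivative 0) (at x)" by simp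
    then have "(flat n has_real_derivative 0) (at x)"
      by (rule has_field_derivative_transform_within_open[where S = "{..<0}"]) (use 2 in \<open>auto simp: flat_def\<close>)
    then show ?thesis using 2 by (simp add: flat_def)
  next
    case 3
    have "((\<lambda>h. flat n h / h) \<longlongrightarrow> 0) (at 0)"
    proof (rule Lim_null_comparison)
      show "\<forall>\<^sub>F h in at 0. norm (flat n h / h) \<le> fact (n + 2) * \<bar>h\<bar>"
      proof (rule always_eventually, rule allI)
        fix h :: real
        have "\<bar>flat n h\<bar> \<le> fact (n + 2) * \<bar>h\<bar> * \<bar>h\<bar>"
          using flat_bound[of n h] by (simp only: power2_eq_square abs_mult_self_eq mult.assoc)
        then show "norm (flat n h / h) \<le> fact (n + 2) * \<bar>h\<bar>"
          by (cases "h = 0") (simp_all only: real_norm_def abs_divide pos_divide_le_eq zero_less_abs_iff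
              division_ring_divide_zero abs_zero mult_zero_right order_refl not_False_eq_True)
      qed
      show "((\<lambda>h::real. fact (n + 2) * \<bar>h\<bar>) \<longlongrightarrow> 0) (at 0)"
        by (auto intro!: tendsto_eq_intros)
    qed
    then have "(flat n has_real_derivative 0) (at 0)"
      by (simp add: DERIV_def flat_def)
    then show ?thesis using 3 by (simp add: flat_def)
  qed
qed

lemma Ck_on_flat: "Ck_on k UNIV (flat n)"
proof (induction k arbitrary: n)
  case 0
  then show ?case by (simp add: DERIV_continuous_on[OF flat_DERIV])
next
  case (Suc k)
  have *: "(flat n has_derivative (\<lambda>v. (- real n * flat (n + 1) x + flat (n + 2) x) * v)) (at x)" for x
    using flat_DERIV by (simp add: has_field_derivative_def)
  have "Ck_on k UNIV (\<lambda>x. (- real n * flat (n + 1) x + flat (n + 2) x) * v)" for v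
    by (intro Ck_on_bilinear[OF open_UNIV bounded_bilinear_mult] Ck_on_add Ck_on_const Suc.IH open_UNIV)
  then show ?case using * by (auto simp: dird_eqI[OF *] differentiable_def)
qed

definition bump :: "'e::euclidean_space \<Rightarrow> real \<Rightarrow> 'e \<Rightarrow> real" where
  "bump c r x = flat 0 (r\<^sup>2 - (x - c) \<bullet> (x - c))"

lemma smooth_on_bump: "smooth_on UNIV (bump c r)"
proof -
  have id: "smooth_on UNIV (\<lambda>x::'a. x)" by (rule smooth_on_linear) simp
  show ?thesis unfolding bump_def
    by (rule smooth_on_compose[of UNIV])
      (auto simp: smooth_on_def[of UNIV "flat 0"] Ck_on_flat
        intro!: smooth_on_diff smooth_on_inner smooth_on_const id)
qed

lemma bump_pos: "dist x c < r \<Longrightarrow> bump c r x > 0"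
  unfolding bump_def flat_def dist_norm dot_square_norm
  by (auto simp: power_strict_mono)

lemma bump_eq_0: "r > 0 \<Longrightarrow> dist x c \<ge> r \<Longrightarrow> bump c r x = 0"
  unfolding bump_def flat_def dist_norm dot_square_norm
  by (auto simp: power_mono not_less)

section \<open>Solving linear equations with smooth coefficients\<close>

text \<open>Gaussian elimination: positive definiteness keeps every pivot positive, so that the solution is
  obtained from the coefficients by ring operations and inverses of nonvanishing functions.\<close>

lemma smooth_linear_system:
  assumes "open S" "finite B"
    and "\<And>i j. i \<in> B \<Longrightarrow> j \<in> B \<Longrightarrow> smooth_on S (a i j)"
    and "\<And>i. i \<in> B \<Longrightarrow> smooth_on S (h i)"
    and "\<And>x c. x \<in> S \<Longrightarrow> \<exists>i\<in>B. c i \<noteq> 0 \<Longrightarrow> (\<Sum>i\<in>B. \<Sum>j\<in>B. a i j x * c i * c j) > (0::real)"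
  shows "\<exists>c. (\<forall>j\<in>B. smooth_on S (c j)) \<and> (\<forall>x\<in>S. \<forall>i\<in>B. (\<Sum>j\<in>B. a i j x * c j x) = h i x)"
  using assms(2-)
proof (induction B arbitrary: a h rule: finite_induct)
  case empty
  then show ?case by auto
next
  case (insert k B)
  note pos = insert.prems(3)
  define r where "r = (\<lambda>x. inverse (a k k x))"
  have sum_ins: "(\<Sum>i\<in>insert k B. F i) = F k + (\<Sum>i\<in>B. F i)" for F :: "_ \<Rightarrow> real"
    using insert.hyps by simp
  have kk: "a k k x > 0" if "x \<in> S" for x
  proof -
    have "(\<Sum>j\<in>B. a i j x * (if i = k then 1 else 0) * (if j = k then 1 else 0)) = 0" for i
      using insert.hyps by (intro sum.neutral) auto
    moreover have "(\<Sum>i\<in>B. \<Sum>j\<in>insert k B. a i j x * (if i = k then 1 else 0) * (if j = k then 1 else 0)) = 0"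
      using insert.hyps by (intro sum.neutral) auto
    ultimately show ?thesis
      using pos[OF that, of "\<lambda>i. if i = k then 1 else 0"] by (simp add: sum_ins)
  qed
  have r: "smooth_on S r" unfolding r_def
    using insert.prems(1) kk by (intro smooth_on_inverse assms(1)) force+
  \<comment> \<open>The Schur complement of the pivot.\<close>
  define a' where "a' = (\<lambda>i j x. a i j x - a i k x * a k j x * r x)"
  define h' where "h' = (\<lambda>i x. h i x - a i k x * h k x * r x)"
  have 1: "smooth_on S (a' i j)" if "i \<in> B" "j \<in> B" for i j
    unfolding a'_def using that insert.prems(1) r
    by (intro smooth_on_diff smooth_on_mult assms(1)) auto
  have 2: "smooth_on S (h' i)" if "i \<in> B" for i
    unfolding h'_def using that insert.prems(1,2) r
    by (intro smooth_on_diff smooth_on_mult assms(1)) auto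
  have 3: "(\<Sum>i\<in>B. \<Sum>j\<in>B. a' i j x * c i * c j) > 0" if x: "x \<in> S" and c: "\<exists>i\<in>B. c i \<noteq> 0" for x c
  proof -
    \<comment> \<open>This coordinate makes the row of the pivot vanish, so the form takes the same value on both vectors.\<close>
    define ck where "ck = - (\<Sum>j\<in>B. a k j x * c j) * r x"
    define c' where "c' = (\<lambda>i. if i = k then ck else c i)"
    have c'B: "(\<Sum>j\<in>B. F j (c' j)) = (\<Sum>j\<in>B. F j (c j))" for F :: "_ \<Rightarrow> real \<Rightarrow> real"
      using insert.hyps by (intro sum.cong) (auto simp: c'_def)
    have "a k k x * ck + (\<Sum>j\<in>B. a k j x * c j) = 0"
      using kk[OF x] by (simp add: ck_def r_def)
    then have row_k: "(\<Sum>j\<in>insert k B. a k j x * c' j) = 0"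
      unfolding sum_ins c'B[of "\<lambda>j t. a k j x * t"] by (simp add: c'_def)
    have row: "(\<Sum>j\<in>insert k B. a i j x * c' j) = (\<Sum>j\<in>B. a' i j x * c j)" for i
      unfolding sum_ins c'B[of "\<lambda>j t. a i j x * t"]
      by (simp add: a'_def c'_def ck_def sum_subtractf left_diff_distrib right_diff_distrib sum_distrib_left
        sum_distrib_right sum_negf mult_ac)
    have "0 < (\<Sum>i\<in>insert k B. \<Sum>j\<in>insert k B. a i j x * c' i * c' j)"
      using c insert.hyps by (intro pos[OF x]) (auto simp: c'_def)
    also have "\<dots> = (\<Sum>i\<in>insert k B. c' i * (\<Sum>j\<in>insert k B. a i j x * c' j))"
      unfolding sum_distrib_left by (intro sum.cong) (auto simp: mult_ac)
    also have "\<dots> = (\<Sum>i\<in>B. c' i * (\<Sum>j\<in>insert k B. a i j x * c' j))"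
      unfolding sum_ins[of "\<lambda>i. c' i * (\<Sum>j\<in>insert k B. a i j x * c' j)"] by (simp add: row_k)
    also have "\<dots> = (\<Sum>i\<in>B. c i * (\<Sum>j\<in>B. a' i j x * c j))"
      unfolding row c'B[of "\<lambda>i t. t * (\<Sum>j\<in>B. a' i j x * c j)"] by simp
    also have "\<dots> = (\<Sum>i\<in>B. \<Sum>j\<in>B. a' i j x * c i * c j)"
      unfolding sum_distrib_left by (intro sum.cong) (auto simp: mult_ac)
    finally show ?thesis .
  qed
  from insert.IH[of a' h', OF 1 2 3] obtain c where c: "\<And>j. j \<in> B \<Longrightarrow> smooth_on S (c j)"
    "\<And>x i. x \<in> S \<Longrightarrow> i \<in> B \<Longrightarrow> (\<Sum>j\<in>B. a' i j x * c j x) = h' i x" by auto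
  define c' where "c' = (\<lambda>j x. if j = k then (h k x - (\<Sum>j\<in>B. a k j x * c j x)) * r x else c j x)"
  have c'B: "(\<Sum>j\<in>B. F j (c' j x)) = (\<Sum>j\<in>B. F j (c j x))" for F :: "_ \<Rightarrow> real \<Rightarrow> real" and x
    using insert.hyps by (intro sum.cong) (auto simp: c'_def)
  show ?case
  proof (intro exI[of _ c'] conjI ballI)
    fix j assume j: "j \<in> insert k B"
    show "smooth_on S (c' j)"
    proof (cases "j = k")
      case True
      then show ?thesis unfolding c'_def using insert.prems(1,2) r c(1)
        by (auto intro!: smooth_on_diff smooth_on_mult smooth_on_sum assms(1))
    next
      case False
      then show ?thesis using c(1) j by (simp add: c'_def)
    qed
  next
    fix x i assume x: "x \<in> S" and i: "i \<in> insert k B"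
    have *: "(\<Sum>j\<in>insert k B. a i j x * c' j x) =
      a i k x * ((h k x - (\<Sum>j\<in>B. a k j x * c j x)) * r x) + (\<Sum>j\<in>B. a i j x * c j x)"
      unfolding sum_ins c'B[of "\<lambda>j t. a i j x * t"] by (simp add: c'_def)
    show "(\<Sum>j\<in>insert k B. a i j x * c' j x) = h i x"
    proof (cases "i = k")
      case True
      then show ?thesis using kk[OF x] unfolding * by (simp add: r_def field_simps)
    next
      case False
      then have "(\<Sum>j\<in>B. a' i j x * c j x) = h' i x" using c(2) x i by simp
      then show ?thesis unfolding *
        by (simp add: a'_def h'_def algebra_simps sum_subtractf sum_distrib_left sum_distrib_right)
    qed
  qed
qed

definition inner_form :: "('e::real_vector \<Rightarrow> 'e \<Rightarrow> real) \<Rightarrow> bool" where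
  "inner_form g \<longleftrightarrow> bilinear g \<and> (\<forall>v w. g v w = g w v) \<and> (\<forall>v. v \<noteq> 0 \<longrightarrow> g v v > 0)"

text \<open>The vector that represents the linear form \<open>h\<close> with respect to \<open>g\<close>.\<close>

definition sharp :: "('e::real_vector \<Rightarrow> 'e \<Rightarrow> real) \<Rightarrow> ('e \<Rightarrow> real) \<Rightarrow> 'e" where
  "sharp g h = (THE e. \<forall>w. g e w = h w)"

text \<open>A form that is positive on nonzero vectors is nondegenerate.\<close>

lemma inner_form_cancel:
  assumes "inner_form g" "\<And>w. g e w = g e' w"
  shows "e = e'"
proof -
  have "g (e - e') (e - e') = 0"
    using assms bilinear_lsub[of g e e'] by (simp add: inner_form_def)
  then have "e - e' = 0" using assms(1) unfolding inner_form_def by (metis less_irrefl)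
  then show ?thesis by simp
qed

lemma sharp_eqI: "inner_form g \<Longrightarrow> (\<And>w. g e w = h w) \<Longrightarrow> sharp g h = e"
  unfolding sharp_def by (rule the_equality) (auto intro: inner_form_cancel)

text \<open>The system is solved in terms of the Gram matrix of a basis.\<close>

lemma smooth_representative:
  fixes g :: "'d::real_normed_vector \<Rightarrow> 'e::euclidean_space \<Rightarrow> 'e \<Rightarrow> real"
  assumes S: "open S" and g: "\<And>x. x \<in> S \<Longrightarrow> inner_form (g x)" "\<And>v w. smooth_on S (\<lambda>x. g x v w)"
    and h: "\<And>x. x \<in> S \<Longrightarrow> linear (h x)" "\<And>w. smooth_on S (\<lambda>x. h x w)"
  shows "\<exists>\<xi>. smooth_on S \<xi> \<and> (\<forall>x\<in>S. \<forall>w. g x (\<xi> x) w = h x w)"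
proof -
  have lin: "linear (\<lambda>v. g x v w)" "linear (\<lambda>w. g x v w)" if "x \<in> S" for x v w
    using g(1)[OF that] by (auto simp: inner_form_def bilinear_def)
  have "\<exists>c. (\<forall>j\<in>Basis. smooth_on S (c j)) \<and>
      (\<forall>x\<in>S. \<forall>i\<in>Basis. (\<Sum>j\<in>Basis. g x j i * c j x) = h x i)"
  proof (rule smooth_linear_system[OF S finite_Basis, where a = "\<lambda>i j x. g x j i"])
    fix x and c :: "'e \<Rightarrow> real" assume x: "x \<in> S" and c: "\<exists>i\<in>Basis. c i \<noteq> 0"
    define e where "e = (\<Sum>i\<in>Basis. c i *\<^sub>R i)"
    have eb: "e \<bullet> i = c i" if "i \<in> Basis" for i
      using that by (simp add: e_def)
    have "e \<noteq> 0" using c eb by auto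
    then have "g x e e > 0" using g(1)[OF x] by (simp add: inner_form_def)
    also have "g x e e = (\<Sum>i\<in>Basis. \<Sum>j\<in>Basis. g x j i * c i * c j)"
      by (subst linear_Basis_expand[OF lin(2)[OF x]])
        (simp add: linear_Basis_expand[OF lin(1)[OF x], of e] eb sum_distrib_left mult_ac)
    finally show "(\<Sum>i\<in>Basis. \<Sum>j\<in>Basis. g x j i * c i * c j) > 0" .
  qed (use g(2) h(2) in auto)
  then obtain c where c: "\<And>j. j \<in> Basis \<Longrightarrow> smooth_on S (c j)"
    "\<And>x i. x \<in> S \<Longrightarrow> i \<in> Basis \<Longrightarrow> (\<Sum>j\<in>Basis. g x j i * c j x) = h x i" by blast
  define \<xi> where "\<xi> = (\<lambda>x. \<Sum>j\<in>Basis. c j x *\<^sub>R j)"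
  have "g x (\<xi> x) w = h x w" if x: "x \<in> S" for x w
  proof -
    have "g x (\<xi> x) i = h x i" if "i \<in> Basis" for i
      using c(2)[OF x that] linear_Basis_expand[OF lin(1)[OF x], of "\<xi> x" i]
      by (simp add: \<xi>_def mult.commute)
    then show ?thesis
      using linear_Basis_expand[OF lin(2)[OF x], of "\<xi> x" w] linear_Basis_expand[OF h(1)[OF x], of w] by simp
  qed
  moreover have "smooth_on S \<xi>" unfolding \<xi>_def
    using c(1) by (intro smooth_on_sum smooth_on_scaleR smooth_on_const S)
  ultimately show ?thesis by blast
qed

lemma sharp_works:
  fixes g :: "'e::euclidean_space \<Rightarrow> 'e \<Rightarrow> real"
  assumes g: "inner_form g" and h: "linear h"
  shows "g (sharp g h) w = h w"
proof -
  obtain \<xi> :: "real \<Rightarrow> 'e" where "\<And>w. g (\<xi> 0) w = h w"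
    using smooth_representative[of "UNIV::real set" "\<lambda>_. g" "\<lambda>_. h"] g h
    by (auto simp: smooth_on_const)
  then show ?thesis using sharp_eqI[OF g] by metis
qed

lemma smooth_on_sharp:
  fixes g :: "'d::real_normed_vector \<Rightarrow> 'e::euclidean_space \<Rightarrow> 'e \<Rightarrow> real"
  assumes "open S" "\<And>x. x \<in> S \<Longrightarrow> inner_form (g x)" "\<And>v w. smooth_on S (\<lambda>x. g x v w)"
    and "\<And>x. x \<in> S \<Longrightarrow> linear (h x)" "\<And>w. smooth_on S (\<lambda>x. h x w)"
  shows "smooth_on S (\<lambda>x. sharp (g x) (h x))"
proof -
  obtain \<xi> where \<xi>: "smooth_on S \<xi>" "\<And>x w. x \<in> S \<Longrightarrow> g x (\<xi> x) w = h x w"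
    using smooth_representative[OF assms] by blast
  have "\<xi> x = sharp (g x) (h x)" if "x \<in> S" for x
    using sharp_eqI[OF assms(2)[OF that]] \<xi>(2)[OF that] by metis
  then have "smooth_on S \<xi> \<longleftrightarrow> smooth_on S (\<lambda>x. sharp (g x) (h x))"
    by (intro smooth_on_cong[OF assms(1)]) simp
  then show ?thesis using \<xi>(1) by simp
qed

section \<open>Charts and tangent vectors\<close>

definition coords :: "('p \<Rightarrow> 'e::euclidean_space) \<Rightarrow> 'p tvec \<Rightarrow> 'e" where
  "coords \<phi> v = (\<Sum>b\<in>Basis. v (\<lambda>q. \<phi> q \<bullet> b) *\<^sub>R b)"

text \<open>The tangent vector with components \<open>e\<close> in the chart \<open>(U, \<phi>)\<close>: differentiation in the direction \<open>e\<close> of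
  the coordinate expression, and \<open>0\<close> on functions that are not smooth, as for \<^const>\<open>velocity\<close>.\<close>

definition tv :: "('p, 'e::euclidean_space) atlas \<Rightarrow> 'p set \<Rightarrow> ('p \<Rightarrow> 'e) \<Rightarrow> 'p \<Rightarrow> 'e \<Rightarrow> 'p tvec" where
  "tv A U \<phi> p e = (\<lambda>f. if smooth_fun_at A f p then dird (f \<circ> inv_into U \<phi>) (\<phi> p) e else 0)"

lemma smooth_atlas_std: "smooth_atlas std_atlas"
proof -
  have "inv_into UNIV id = (id :: 'a \<Rightarrow> 'a)" using inv_id by simp
  then show ?thesis
    using smooth_on_linear[OF bounded_linear_ident, of "UNIV :: 'a set"]
    by (auto simp: smooth_atlas_def std_atlas_def id_def comp_def)
qed

lemma std_chart: "(UNIV, id) \<in> std_atlas"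
  by (simp add: std_atlas_def)

lemma open_vimage_smooth: "smooth_on S f \<Longrightarrow> open S \<Longrightarrow> open T \<Longrightarrow> open {x \<in> S. f x \<in> T}"
  using continuous_open_preimage[OF smooth_on_continuous_on] by (simp add: vimage_def Int_def)

locale chart =
  fixes A :: "('p, 'e::euclidean_space) atlas" and U :: "'p set" and \<phi> :: "'p \<Rightarrow> 'e"
  assumes atlas: "smooth_atlas A" and chart: "(U, \<phi>) \<in> A"
begin

abbreviation \<phi>inv :: "'e \<Rightarrow> 'p" where "\<phi>inv \<equiv> inv_into U \<phi>"

lemma inj: "inj_on \<phi> U" and open_image: "open (\<phi> ` U)"
  using atlas chart by (auto simp: smooth_atlas_def)

lemma inv_chart [simp]: "p \<in> U \<Longrightarrow> \<phi>inv (\<phi> p) = p"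
  using inj by simp

lemma chart_inv [simp]: "x \<in> \<phi> ` U \<Longrightarrow> \<phi> (\<phi>inv x) = x"
  by (simp add: f_inv_into_f)

lemma inv_in [simp]: "x \<in> \<phi> ` U \<Longrightarrow> \<phi>inv x \<in> U"
  by (simp add: inv_into_into)

lemma in_carrier: "p \<in> U \<Longrightarrow> p \<in> carrier A"
  using chart by (auto simp: carrier_def)

lemma transition:
  assumes "(V, \<psi>) \<in> A"
  shows "open (\<phi> ` (U \<inter> V))" "smooth_on (\<phi> ` (U \<inter> V)) (\<psi> \<circ> \<phi>inv)"
  using atlas chart assms by (auto simp: smooth_atlas_def)

end

text \<open>Smoothness is defined by means of some pair of charts. Composing with the transition maps on a smaller
  open set carries it over to any prescribed pair of charts around the two points.\<close>

lemma smooth_atD: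
  assumes A: "smooth_atlas A" "(U, \<phi>) \<in> A" "p \<in> U"
    and B: "smooth_atlas B" "(V, \<psi>) \<in> B" "F p \<in> V" and F: "smooth_at A B F p"
  shows "\<exists>W. open W \<and> \<phi> p \<in> W \<and> W \<subseteq> \<phi> ` U \<and> F ` inv_into U \<phi> ` W \<subseteq> V \<and>
    smooth_on W (\<psi> \<circ> F \<circ> inv_into U \<phi>)"
proof -
  from F obtain U' \<phi>' V' \<psi>' W' where
    1: "(U', \<phi>') \<in> A" "(V', \<psi>') \<in> B" "p \<in> U'" "F p \<in> V'" and
    W': "open W'" "\<phi>' p \<in> W'" "W' \<subseteq> \<phi>' ` U'" "F ` inv_into U' \<phi>' ` W' \<subseteq> V'"
      "smooth_on W' (\<psi>' \<circ> F \<circ> inv_into U' \<phi>')"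
    unfolding smooth_at_def by auto
  interpret P: chart A U \<phi> using A by unfold_locales
  interpret P': chart A U' \<phi>' using A 1 by unfold_locales
  interpret Q: chart B V \<psi> using B by unfold_locales
  interpret Q': chart B V' \<psi>' using B 1 by unfold_locales
  define T where "T = \<psi>' ` (V' \<inter> V)"
  have T: "open T" "smooth_on T (\<psi> \<circ> Q'.\<phi>inv)" unfolding T_def using Q'.transition[OF B(2)] .
  define W1 where "W1 = {x \<in> W'. (\<psi>' \<circ> F \<circ> inv_into U' \<phi>') x \<in> T}"
  have W1: "open W1" unfolding W1_def by (rule open_vimage_smooth[OF W'(5,1) T(1)])
  define \<tau> where "\<tau> = \<phi>' \<circ> P.\<phi>inv"
  have \<tau>: "open (\<phi> ` (U \<inter> U'))" "smooth_on (\<phi> ` (U \<inter> U')) \<tau>"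
    unfolding \<tau>_def using P.transition[OF 1(1)] .
  define W where "W = {x \<in> \<phi> ` (U \<inter> U'). \<tau> x \<in> W1}"
  have W: "open W" unfolding W_def by (rule open_vimage_smooth[OF \<tau>(2,1) W1])
  have key: "P.\<phi>inv x \<in> U \<inter> U'" "P'.\<phi>inv (\<tau> x) = P.\<phi>inv x" "F (P.\<phi>inv x) \<in> V' \<inter> V" if "x \<in> W" for x
  proof -
    obtain q where q: "q \<in> U" "q \<in> U'" "x = \<phi> q" using \<open>x \<in> W\<close> by (auto simp: W_def)
    show "P.\<phi>inv x \<in> U \<inter> U'" "P'.\<phi>inv (\<tau> x) = P.\<phi>inv x" using q by (simp_all add: \<tau>_def)
    have t: "\<phi>' q \<in> W'" "\<psi>' (F q) \<in> T" using \<open>x \<in> W\<close> q by (auto simp: W_def W1_def \<tau>_def)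
    then have "F q \<in> V'" using W'(4) q by force
    moreover obtain r where "r \<in> V'" "r \<in> V" "\<psi>' r = \<psi>' (F q)" using t(2) by (auto simp: T_def)
    ultimately have "F q = r" using Q'.inj by (auto dest: inj_onD)
    then show "F (P.\<phi>inv x) \<in> V' \<inter> V" using q \<open>r \<in> V\<close> \<open>r \<in> V'\<close> by simp
  qed
  have eq: "(\<psi> \<circ> F \<circ> P.\<phi>inv) x = (\<psi> \<circ> Q'.\<phi>inv) ((\<psi>' \<circ> F \<circ> inv_into U' \<phi>') (\<tau> x))" if "x \<in> W" for x
    using key[OF that] by simp
  have s1: "smooth_on W (\<lambda>x. (\<psi>' \<circ> F \<circ> inv_into U' \<phi>') (\<tau> x))"
    by (rule smooth_on_compose[OF W'(5,1) smooth_on_subset[OF \<tau>(2)] W]) (auto simp: W_def W1_def)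
  have "smooth_on W (\<lambda>x. (\<psi> \<circ> Q'.\<phi>inv) ((\<psi>' \<circ> F \<circ> inv_into U' \<phi>') (\<tau> x)))"
    by (rule smooth_on_compose[OF T(2,1) s1 W]) (auto simp: W_def W1_def)
  then have "smooth_on W (\<psi> \<circ> F \<circ> P.\<phi>inv)"
    by (rule smooth_on_transform[OF _ W eq])
  moreover have "\<phi> p \<in> W"
    using A(3) 1 W'(2) B(3) by (auto simp: W_def W1_def \<tau>_def T_def)
  moreover have "W \<subseteq> \<phi> ` U" by (auto simp: W_def)
  moreover have "F ` P.\<phi>inv ` W \<subseteq> V" using key(3) by blast
  ultimately show ?thesis using W by blast
qed

lemma smooth_atI:
  assumes "(U, \<phi>) \<in> A" "p \<in> U" "(V, \<psi>) \<in> B" "F p \<in> V"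
    and "open W" "\<phi> p \<in> W" "W \<subseteq> \<phi> ` U" "F ` inv_into U \<phi> ` W \<subseteq> V" "smooth_on W (\<psi> \<circ> F \<circ> inv_into U \<phi>)"
  shows "smooth_at A B F p"
  unfolding smooth_at_def using assms by blast

text \<open>For a map that carries the domain of one chart into the domain of another, smoothness at every
  point of the domain is smoothness of the coordinate expression.\<close>

lemma smooth_on_chart_iff:
  assumes A: "smooth_atlas A" "(U, \<phi>) \<in> A" and B: "smooth_atlas B" "(V, \<psi>) \<in> B" "F ` U \<subseteq> V"
  shows "(\<forall>p\<in>U. smooth_at A B F p) \<longleftrightarrow> smooth_on (\<phi> ` U) (\<psi> \<circ> F \<circ> inv_into U \<phi>)"
proof
  assume F: "\<forall>p\<in>U. smooth_at A B F p"
  show "smooth_on (\<phi> ` U) (\<psi> \<circ> F \<circ> inv_into U \<phi>)"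
  proof (rule smooth_on_local)
    fix x assume "x \<in> \<phi> ` U"
    then obtain p where "p \<in> U" "x = \<phi> p" by blast
    with smooth_atD[OF A this(1) B(1,2), of F] F B(3)
    show "\<exists>W. open W \<and> x \<in> W \<and> smooth_on W (\<psi> \<circ> F \<circ> inv_into U \<phi>)" by auto
  qed
next
  interpret chart A U \<phi> using A by unfold_locales
  assume F: "smooth_on (\<phi> ` U) (\<psi> \<circ> F \<circ> inv_into U \<phi>)"
  show "\<forall>p\<in>U. smooth_at A B F p"
  proof
    fix p assume "p \<in> U"
    then show "smooth_at A B F p"
      by (intro smooth_atI[OF A(2) _ B(2) _ open_image _ _ _ F]) (use B(3) in auto)
  qed
qed

context chart
begin

lemma smooth_fun_atD:
  assumes "smooth_fun_at A f p" "p \<in> U"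
  shows "\<exists>W. open W \<and> \<phi> p \<in> W \<and> W \<subseteq> \<phi> ` U \<and> smooth_on W (f \<circ> \<phi>inv)"
  using smooth_atD[OF atlas chart assms(2) smooth_atlas_std std_chart _ assms(1)] by auto

lemma smooth_fun_atI:
  assumes "p \<in> U" "open W" "\<phi> p \<in> W" "W \<subseteq> \<phi> ` U" "smooth_on W (f \<circ> \<phi>inv)"
  shows "smooth_fun_at A f p"
  using assms by (intro smooth_atI[OF chart assms(1) std_chart]) auto

lemma smooth_fun_at_nearby:
  assumes "smooth_fun_at A f p" "p \<in> U"
  shows "\<exists>W. open W \<and> \<phi> p \<in> W \<and> W \<subseteq> \<phi> ` U \<and> smooth_on W (f \<circ> \<phi>inv) \<and>
    (\<forall>x\<in>W. smooth_fun_at A f (\<phi>inv x))"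
proof -
  obtain W where W: "open W" "\<phi> p \<in> W" "W \<subseteq> \<phi> ` U" "smooth_on W (f \<circ> \<phi>inv)"
    using smooth_fun_atD[OF assms] by blast
  then have "smooth_fun_at A f (\<phi>inv x)" if "x \<in> W" for x
    using that by (intro smooth_fun_atI[of _ W]) auto
  then show ?thesis using W by blast
qed

lemma smooth_fun_chart_iff:
  "(\<forall>p\<in>U. smooth_fun_at A f p) \<longleftrightarrow> smooth_on (\<phi> ` U) (f \<circ> \<phi>inv)"
  using smooth_on_chart_iff[OF atlas chart smooth_atlas_std std_chart, of f] by simp

lemma smooth_fun_at_coordinate: "p \<in> U \<Longrightarrow> smooth_fun_at A (\<lambda>q. \<phi> q \<bullet> b) p"
proof -
  have "smooth_on (\<phi> ` U) (\<lambda>x. x \<bullet> b)"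
    by (rule smooth_on_linear) (rule bounded_linear_inner_left)
  then have "smooth_on (\<phi> ` U) ((\<lambda>q. \<phi> q \<bullet> b) \<circ> \<phi>inv)"
    by (rule smooth_on_transform[OF _ open_image]) simp
  then show "p \<in> U \<Longrightarrow> smooth_fun_at A (\<lambda>q. \<phi> q \<bullet> b) p"
    using smooth_fun_chart_iff by blast
qed

lemma tv_apply: "smooth_fun_at A f p \<Longrightarrow> tv A U \<phi> p e f = dird (f \<circ> \<phi>inv) (\<phi> p) e"
  by (simp add: tv_def)

text \<open>The transformation law of components under a change of chart.\<close>

lemma coords_tv_other:
  assumes V: "(V, \<psi>) \<in> A" and p: "p \<in> U" "p \<in> V"
  shows "coords \<psi> (tv A U \<phi> p e) = dird (\<psi> \<circ> \<phi>inv) (\<phi> p) e"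
proof -
  interpret V: chart A V \<psi> using atlas V by unfold_locales
  have "((\<psi> \<circ> \<phi>inv) has_derivative dird (\<psi> \<circ> \<phi>inv) (\<phi> p)) (at (\<phi> p))"
    using p by (intro smooth_on_has_derivative[OF transition(2)[OF V]]) auto
  then have "((\<lambda>x. (\<psi> \<circ> \<phi>inv) x \<bullet> b) has_derivative (\<lambda>h. dird (\<psi> \<circ> \<phi>inv) (\<phi> p) h \<bullet> b)) (at (\<phi> p))" for b
    by (rule has_derivative_inner_left)
  then have "tv A U \<phi> p e (\<lambda>q. \<psi> q \<bullet> b) = dird (\<psi> \<circ> \<phi>inv) (\<phi> p) e \<bullet> b" for b
    unfolding tv_apply[OF V.smooth_fun_at_coordinate[OF p(2)]]
    by (intro dird_eqI) (simp add: comp_def)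
  then show ?thesis by (simp add: coords_def euclidean_representation)
qed

lemma coords_tv [simp]:
  assumes "p \<in> U"
  shows "coords \<phi> (tv A U \<phi> p e) = e"
proof -
  have "dird (\<phi> \<circ> \<phi>inv) (\<phi> p) e = dird (\<lambda>x. x) (\<phi> p) e"
    by (rule dird_cong_open[OF open_image]) (use assms in auto)
  then show ?thesis using coords_tv_other[OF chart assms assms] by simp
qed

lemma tv_linear:
  assumes "p \<in> U"
  shows "tv A U \<phi> p (a *\<^sub>R e + b *\<^sub>R e') = a *\<^sub>T tv A U \<phi> p e + b *\<^sub>T tv A U \<phi> p e'"
proof (rule ext)
  fix f
  show "tv A U \<phi> p (a *\<^sub>R e + b *\<^sub>R e') f = (a *\<^sub>T tv A U \<phi> p e + b *\<^sub>T tv A U \<phi> p e') f"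
  proof (cases "smooth_fun_at A f p")
    case True
    then obtain W where "smooth_on W (f \<circ> \<phi>inv)" "\<phi> p \<in> W" using smooth_fun_atD[OF True assms] by blast
    from smooth_on_linear_dird[OF this] show ?thesis
      by (simp add: tv_def tscale_def linear_add linear_cmul)
  qed (simp add: tv_def tscale_def)
qed

lemma tv_add: "p \<in> U \<Longrightarrow> tv A U \<phi> p (e + e') = tv A U \<phi> p e + tv A U \<phi> p e'"
  using tv_linear[of p 1 e 1 e'] by (simp add: tscale_def)

lemma tv_scale: "p \<in> U \<Longrightarrow> tv A U \<phi> p (a *\<^sub>R e) = a *\<^sub>T tv A U \<phi> p e"
  using tv_linear[of p a e 0 e] by (simp add: tscale_def fun_eq_iff)

lemma tv_zero: "p \<in> U \<Longrightarrow> tv A U \<phi> p 0 = 0"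
  using tv_scale[of p 0 0] by (simp add: tscale_def fun_eq_iff)

lemma tv_diff: "p \<in> U \<Longrightarrow> tv A U \<phi> p (e - e') = tv A U \<phi> p e - tv A U \<phi> p e'"
  using tv_linear[of p 1 e "-1" e'] by (simp add: tscale_def fun_eq_iff)

lemma tv_inject: "p \<in> U \<Longrightarrow> tv A U \<phi> p e = tv A U \<phi> p e' \<longleftrightarrow> e = e'"
  using coords_tv by metis

lemma tv_eq_0_iff: "p \<in> U \<Longrightarrow> tv A U \<phi> p e = 0 \<longleftrightarrow> e = 0"
  using tv_inject[of p e 0] by (simp add: tv_zero)

lemma velocity_eq_tv:
  assumes c: "\<forall>\<^sub>F t in nhds 0. c t \<in> U" "((\<lambda>t. \<phi> (c t)) has_vector_derivative d) (at 0)"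
  shows "velocity A c = tv A U \<phi> (c 0) d"
proof (rule ext)
  fix f
  have c0: "c 0 \<in> U" using c(1) eventually_nhds_x_imp_x by blast
  show "velocity A c f = tv A U \<phi> (c 0) d f"
  proof (cases "smooth_fun_at A f (c 0)")
    case True
    then obtain W where W: "smooth_on W (f \<circ> \<phi>inv)" "\<phi> (c 0) \<in> W" using smooth_fun_atD[OF True c0] by blast
    have "((\<lambda>t. (f \<circ> \<phi>inv) (\<phi> (c t))) has_derivative (\<lambda>h. dird (f \<circ> \<phi>inv) (\<phi> (c 0)) (h *\<^sub>R d))) (at 0)"
      using c(2) smooth_on_has_derivative[OF W] unfolding has_vector_derivative_def
      by (rule has_derivative_compose)
    then have "((\<lambda>t. (f \<circ> \<phi>inv) (\<phi> (c t))) has_real_derivative dird (f \<circ> \<phi>inv) (\<phi> (c 0)) d) (at 0)"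
      by (simp add: has_real_derivative_iff_has_vector_derivative has_vector_derivative_def
          linear_cmul[OF smooth_on_linear_dird[OF W]])
    moreover have ev: "\<forall>\<^sub>F t in nhds 0. (f \<circ> c) t = (f \<circ> \<phi>inv) (\<phi> (c t))"
      using c(1) by eventually_elim simp
    ultimately have "((f \<circ> c) has_real_derivative dird (f \<circ> \<phi>inv) (\<phi> (c 0)) d) (at 0)"
      by (intro iffD2[OF DERIV_cong_ev[OF refl ev refl]])
    then show ?thesis using True by (simp add: velocity_def tv_def DERIV_imp_deriv)
  qed (simp add: velocity_def tv_def)
qed

text \<open>A velocity has the derivative of the coordinate curve as its components, and a straight line in
  coordinates has any prescribed components.\<close>

lemma tangent_space_eq:
  assumes p: "p \<in> U"
  shows "tangent_space A p = range (tv A U \<phi> p)"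
proof (intro set_eqI iffI)
  fix v assume "v \<in> tangent_space A p"
  then obtain c where c: "v = velocity A c" "c 0 = p" "smooth_at std_atlas A c 0"
    by (auto simp: tangent_space_def)
  have "inv_into UNIV id = (id :: real \<Rightarrow> real)" using inv_id by simp
  then obtain W :: "real set" where W: "open W" "0 \<in> W" "c ` W \<subseteq> U" "smooth_on W (\<phi> \<circ> c)"
    using smooth_atD[OF smooth_atlas_std std_chart _ atlas chart _ c(3)] c(2) p by auto
  have "((\<lambda>t. (\<phi> \<circ> c) (0 + t *\<^sub>R 1)) has_vector_derivative dird (\<phi> \<circ> c) (0 + 0 *\<^sub>R 1) 1) (at 0)"
    by (rule has_vector_derivative_along_line[OF W(4)]) (use W(2) in simp)
  moreover have "\<forall>\<^sub>F t in nhds 0. c t \<in> U"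
    using eventually_nhds_in_open[OF W(1,2)] by eventually_elim (use W(3) in auto)
  ultimately have "velocity A c = tv A U \<phi> (c 0) (dird (\<phi> \<circ> c) 0 1)"
    by (intro velocity_eq_tv) simp_all
  then show "v \<in> range (tv A U \<phi> p)" using c by blast
next
  fix v assume "v \<in> range (tv A U \<phi> p)"
  then obtain e where v: "v = tv A U \<phi> p e" by blast
  define l where "l = (\<lambda>t::real. \<phi> p + t *\<^sub>R e)"
  define c where "c = (\<lambda>t. \<phi>inv (l t))"
  have l: "smooth_on UNIV l" unfolding l_def
    by (intro smooth_on_add smooth_on_const smooth_on_linear bounded_linear_scaleR_left) simp
  define W where "W = {t \<in> UNIV. l t \<in> \<phi> ` U}"
  have W: "open W" unfolding W_def by (rule open_vimage_smooth[OF l open_UNIV open_image])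
  have W0: "0 \<in> W" using p by (simp add: W_def l_def)
  have cW: "\<phi> (c t) = l t" "c t \<in> U" if "t \<in> W" for t
    using that by (auto simp: W_def c_def)
  have c0: "c 0 = p" using p by (simp add: c_def l_def)
  have "smooth_at std_atlas A c 0"
  proof (rule smooth_atI[OF std_chart _ chart _ W])
    have "inv_into UNIV id = (id :: real \<Rightarrow> real)" using inv_id by simp
    then show "smooth_on W (\<phi> \<circ> c \<circ> inv_into UNIV id)" "c ` inv_into UNIV id ` W \<subseteq> U"
      using smooth_on_cong[OF W, of "\<phi> \<circ> c" l] smooth_on_subset[OF l] cW by auto
  qed (use W0 c0 p in auto)
  then have "velocity A c \<in> tangent_space A p" using c0 by (auto simp: tangent_space_def)
  moreover have "velocity A c = tv A U \<phi> (c 0) e"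
  proof (rule velocity_eq_tv)
    show "\<forall>\<^sub>F t in nhds 0. c t \<in> U" 
      using eventually_nhds_in_open[OF W W0] by eventually_elim (rule cW(2))
    have "(l has_vector_derivative e) (at 0)" unfolding l_def
      by (auto intro!: derivative_eq_intros)
    then show "((\<lambda>t. \<phi> (c t)) has_vector_derivative e) (at 0)"
      by (rule has_vector_derivative_transform_within_open[OF _ W W0]) (use cW in auto)
  qed
  ultimately show "v \<in> tangent_space A p" using c0 v by simp
qed

lemma tv_in [simp]: "p \<in> U \<Longrightarrow> tv A U \<phi> p e \<in> tangent_space A p"
  by (simp add: tangent_space_eq)

lemma tv_coords [simp]: "p \<in> U \<Longrightarrow> v \<in> tangent_space A p \<Longrightarrow> tv A U \<phi> p (coords \<phi> v) = v"
  by (auto simp: tangent_space_eq)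

lemma coords_eq_iff:
  "p \<in> U \<Longrightarrow> v \<in> tangent_space A p \<Longrightarrow> v' \<in> tangent_space A p \<Longrightarrow> coords \<phi> v = coords \<phi> v' \<longleftrightarrow> v = v'"
  by (metis tv_coords)

end

lemma carrierE:
  assumes "p \<in> carrier A"
  obtains U \<phi> where "(U, \<phi>) \<in> A" "p \<in> U"
  using assms by (auto simp: carrier_def)

lemma tangent_space_closed:
  assumes "smooth_atlas A" "p \<in> carrier A" "v \<in> tangent_space A p" "v' \<in> tangent_space A p"
  shows "a *\<^sub>T v + b *\<^sub>T v' \<in> tangent_space A p" "v + v' \<in> tangent_space A p"
    "a *\<^sub>T v \<in> tangent_space A p" "0 \<in> tangent_space A p" "v - v' \<in> tangent_space A p"
proof -
  obtain U \<phi> where "(U, \<phi>) \<in> A" and p: "p \<in> U" using assms(2) by (rule carrierE)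
  then interpret chart A U \<phi> using assms(1) by unfold_locales
  have lin: "a *\<^sub>T v + b *\<^sub>T v' \<in> tangent_space A p" for a b
    using tv_linear[OF p, of a "coords \<phi> v" b "coords \<phi> v'"] assms(3,4) p
      tv_in[OF p, of "a *\<^sub>R coords \<phi> v + b *\<^sub>R coords \<phi> v'"] by simp
  from lin[of a b] lin[of 1 1] lin[of a 0] lin[of 0 0] lin[of 1 "-1"]
  show "a *\<^sub>T v + b *\<^sub>T v' \<in> tangent_space A p" "v + v' \<in> tangent_space A p"
    "a *\<^sub>T v \<in> tangent_space A p" "0 \<in> tangent_space A p" "v - v' \<in> tangent_space A p"
    by (simp_all add: tscale_def plus_fun_def zero_fun_def fun_diff_def)
qed

text \<open>The chain rule in coordinates.\<close>

lemma differential_tv: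
  assumes A: "smooth_atlas A" "(U, \<phi>) \<in> A" "p \<in> U"
    and B: "smooth_atlas B" "(V, \<psi>) \<in> B" "F p \<in> V" and F: "smooth_at A B F p"
  shows "differential B F p (tv A U \<phi> p e) = tv B V \<psi> (F p) (dird (\<psi> \<circ> F \<circ> inv_into U \<phi>) (\<phi> p) e)"
proof (rule ext)
  fix f
  interpret P: chart A U \<phi> using A by unfold_locales
  interpret Q: chart B V \<psi> using B by unfold_locales
  show "differential B F p (tv A U \<phi> p e) f = tv B V \<psi> (F p) (dird (\<psi> \<circ> F \<circ> inv_into U \<phi>) (\<phi> p) e) f"
  proof (cases "smooth_fun_at B f (F p)")
    case True
    obtain W where W: "open W" "\<phi> p \<in> W" "W \<subseteq> \<phi> ` U" "F ` inv_into U \<phi> ` W \<subseteq> V"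
      "smooth_on W (\<psi> \<circ> F \<circ> inv_into U \<phi>)" using smooth_atD[OF A B F] by blast
    obtain T where T: "open T" "\<psi> (F p) \<in> T" "smooth_on T (f \<circ> Q.\<phi>inv)"
      using Q.smooth_fun_atD[OF True B(3)] by blast
    define W1 where "W1 = {x \<in> W. (\<psi> \<circ> F \<circ> inv_into U \<phi>) x \<in> T}"
    have W1: "open W1" "W1 \<subseteq> W" unfolding W1_def using open_vimage_smooth[OF W(5,1) T(1)] by auto
    have pW1: "\<phi> p \<in> W1" using W(2) T(2) A(3) by (simp add: W1_def)
    have eq: "(f \<circ> F \<circ> P.\<phi>inv) x = (f \<circ> Q.\<phi>inv) ((\<psi> \<circ> F \<circ> inv_into U \<phi>) x)" if "x \<in> W1" for x
    proof -
      have "F (P.\<phi>inv x) \<in> V" using that W(4) W1(2) by blast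
      then show ?thesis by simp
    qed
    have sm: "smooth_on W1 (\<psi> \<circ> F \<circ> inv_into U \<phi>)" using smooth_on_subset[OF W(5) W1(2)] .
    have "smooth_on W1 (\<lambda>x. (f \<circ> Q.\<phi>inv) ((\<psi> \<circ> F \<circ> inv_into U \<phi>) x))"
      by (rule smooth_on_compose[OF T(3,1) sm W1(1)]) (auto simp: W1_def)
    then have "smooth_on W1 (f \<circ> F \<circ> P.\<phi>inv)"
      by (rule smooth_on_transform[OF _ W1(1) eq])
    then have "smooth_fun_at A (f \<circ> F) p"
      using W1 pW1 W(3) A(3) by (intro P.smooth_fun_atI[of p W1]) auto
    then have "tv A U \<phi> p e (f \<circ> F) = dird (f \<circ> F \<circ> P.\<phi>inv) (\<phi> p) e" by (rule P.tv_apply)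
    also have "\<dots> = dird (\<lambda>x. (f \<circ> Q.\<phi>inv) ((\<psi> \<circ> F \<circ> inv_into U \<phi>) x)) (\<phi> p) e"
      by (rule dird_cong_open[OF W1(1) pW1 eq])
    also have "\<dots> = dird (f \<circ> Q.\<phi>inv) (\<psi> (F p)) (dird (\<psi> \<circ> F \<circ> inv_into U \<phi>) (\<phi> p) e)"
      using dird_chain[OF sm pW1 T(3)] T(2) A(3) by simp
    finally show ?thesis using True by (simp add: differential_def tv_def)
  qed (simp add: differential_def tv_def)
qed

section \<open>The atlases of the tangent bundle and of the slit tangent bundle\<close>

text \<open>The chart domains of the two bundles over a chart domain \<open>U\<close>, and the coordinates that they share.\<close>

definition tset :: "('p, 'e::euclidean_space) atlas \<Rightarrow> 'p set \<Rightarrow> 'p tpoint set" where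
  "tset A U = {(p, v). p \<in> U \<and> v \<in> tangent_space A p}"

definition sset :: "('p, 'e::euclidean_space) atlas \<Rightarrow> 'p set \<Rightarrow> 'p tpoint set" where
  "sset A U = {(p, v). p \<in> U \<and> v \<in> tangent_space A p \<and> v \<noteq> 0}"

definition tmap :: "('p \<Rightarrow> 'e::euclidean_space) \<Rightarrow> 'p tpoint \<Rightarrow> 'e \<times> 'e" where
  "tmap \<phi> = (\<lambda>(p, v). (\<phi> p, coords \<phi> v))"

lemma tmap_apply [simp]: "tmap \<phi> (p, v) = (\<phi> p, coords \<phi> v)" by (simp add: tmap_def)

lemma tangent_atlas_eq: "tangent_atlas A = (\<lambda>(U, \<phi>). (tset A U, tmap \<phi>)) ` A"
  by (simp add: tangent_atlas_def tangent_chart_def tset_def tmap_def coords_def[abs_def] case_prod_beta')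

lemma slit_atlas_eq: "slit_atlas A = (\<lambda>(U, \<phi>). (sset A U, tmap \<phi>)) ` A"
proof -
  have "tset A U \<inter> {u. snd u \<noteq> 0} = sset A U" for U by (auto simp: tset_def sset_def)
  then show ?thesis
    by (simp add: slit_atlas_def tangent_atlas_eq image_image case_prod_beta')
qed

lemma slit_eq: "slit A = {u. fst u \<in> carrier A \<and> snd u \<in> fibre A u \<and> snd u \<noteq> 0}"
  unfolding carrier_def slit_atlas_eq sset_def by fastforce

context chart
begin

text \<open>Stated for subsets of the chart domain, so that it also covers the overlap of two charts.\<close>

lemma tmap_image_subset:
  assumes "W \<subseteq> U"
  shows "tmap \<phi> ` tset A W = \<phi> ` W \<times> UNIV"
proof (intro set_eqI iffI)
  fix z assume "z \<in> \<phi> ` W \<times> (UNIV :: 'e set)"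
  then obtain p e where "p \<in> W" "z = (\<phi> p, e)" by auto
  then have "z = tmap \<phi> (p, tv A U \<phi> p e)" "(p, tv A U \<phi> p e) \<in> tset A W"
    using assms by (auto simp: tset_def)
  then show "z \<in> tmap \<phi> ` tset A W" by blast
qed (auto simp: tset_def)

lemmas tmap_image = tmap_image_subset[OF order_refl]

lemma tmap_inj: "inj_on (tmap \<phi>) (tset A U)"
  using inj coords_eq_iff by (auto simp: inj_on_def tset_def)

lemma tmap_inv:
  assumes "x \<in> \<phi> ` U"
  shows "inv_into (tset A U) (tmap \<phi>) (x, e) = (\<phi>inv x, tv A U \<phi> (\<phi>inv x) e)"
  by (rule inv_into_f_eq[OF tmap_inj]) (use assms in \<open>auto simp: tset_def\<close>)

lemma smap_image_subset:
  assumes "W \<subseteq> U"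
  shows "tmap \<phi> ` sset A W = \<phi> ` W \<times> (- {0})"
proof (intro set_eqI iffI)
  fix z assume "z \<in> \<phi> ` W \<times> (- {0 :: 'e})"
  then obtain p e where "p \<in> W" "p \<in> U" "z = (\<phi> p, e)" "e \<noteq> 0" using assms by auto
  then have "z = tmap \<phi> (p, tv A U \<phi> p e)" "(p, tv A U \<phi> p e) \<in> sset A W"
    by (auto simp: sset_def tv_eq_0_iff)
  then show "z \<in> tmap \<phi> ` sset A W" by blast
next
  fix z assume "z \<in> tmap \<phi> ` sset A W"
  then obtain p v where z: "z = (\<phi> p, coords \<phi> v)" "p \<in> W" "v \<in> tangent_space A p" "v \<noteq> 0"
    by (auto simp: sset_def)
  then have "coords \<phi> v \<noteq> 0" using tv_coords[of p v] tv_zero[of p] assms by (metis subsetD)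
  then show "z \<in> \<phi> ` W \<times> (- {0 :: 'e})" using z by auto
qed

lemmas smap_image = smap_image_subset[OF order_refl]

lemma smap_inj: "inj_on (tmap \<phi>) (sset A U)"
  by (rule inj_on_subset[OF tmap_inj]) (auto simp: tset_def sset_def)

lemma smap_inv:
  assumes "x \<in> \<phi> ` U" "e \<noteq> 0"
  shows "inv_into (sset A U) (tmap \<phi>) (x, e) = (\<phi>inv x, tv A U \<phi> (\<phi>inv x) e)"
  by (rule inv_into_f_eq[OF smap_inj]) (use assms in \<open>auto simp: sset_def tv_eq_0_iff\<close>)

text \<open>The change of fibre coordinates is the derivative of the change of base coordinates, and it is jointly
  smooth because it is linear in the fibre.\<close>

lemma tmap_transition:
  assumes V: "(V, \<psi>) \<in> A"
  shows "smooth_on (\<phi> ` (U \<inter> V) \<times> UNIV) (tmap \<psi> \<circ> inv_into (tset A U) (tmap \<phi>))"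
proof -
  let ?O = "\<phi> ` (U \<inter> V) \<times> (UNIV :: 'e set)"
  have O: "open ?O" using transition(1)[OF V] by (intro open_Times) auto
  have x: "x \<in> \<phi> ` U \<and> \<phi>inv x \<in> U \<and> \<phi>inv x \<in> V" if "x \<in> \<phi> ` (U \<inter> V)" for x using that by auto
  have eq: "(tmap \<psi> \<circ> inv_into (tset A U) (tmap \<phi>)) z =
      ((\<psi> \<circ> \<phi>inv) (fst z), dird (\<psi> \<circ> \<phi>inv) (fst z) (snd z))" if "z \<in> ?O" for z
    using that x[of "fst z"] tmap_inv[of "fst z" "snd z"] coords_tv_other[OF V, of "\<phi>inv (fst z)" "snd z"]
    by (cases z) auto
  have f: "smooth_on ?O (\<lambda>z. fst z)" and s: "smooth_on ?O (\<lambda>z. snd z)"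
    by (intro smooth_on_linear bounded_linear_fst bounded_linear_snd)+
  have comp: "smooth_on ?O (\<lambda>z. h (fst z))" if "smooth_on (\<phi> ` (U \<inter> V)) h" for h :: "'e \<Rightarrow> 'e"
    by (rule smooth_on_compose[OF that transition(1)[OF V] f O]) auto
  have "smooth_on ?O (\<lambda>z. dird (\<psi> \<circ> \<phi>inv) (fst z) (snd z))"
  proof (rule smooth_on_linear_apply[OF O _ _ s])
    fix z assume "z \<in> ?O"
    then show "linear (dird (\<psi> \<circ> \<phi>inv) (fst z))"
      by (intro smooth_on_linear_dird[OF transition(2)[OF V]]) auto
  next
    fix e show "smooth_on ?O (\<lambda>z. dird (\<psi> \<circ> \<phi>inv) (fst z) e)"
      by (rule comp) (rule smooth_on_dird[OF transition(2)[OF V]])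
  qed
  then have "smooth_on ?O (\<lambda>z. ((\<psi> \<circ> \<phi>inv) (fst z), dird (\<psi> \<circ> \<phi>inv) (fst z) (snd z)))"
    by (intro smooth_on_Pair O comp transition(2) V)
  then show ?thesis by (rule smooth_on_transform[OF _ O eq])
qed

lemma restrict_chart:
  assumes V: "(V, \<psi>) \<in> A"
  shows "tmap \<phi> ` (tset A U \<inter> tset A V) = \<phi> ` (U \<inter> V) \<times> UNIV"
    "tmap \<phi> ` (sset A U \<inter> sset A V) = \<phi> ` (U \<inter> V) \<times> (- {0})"
proof -
  have "tset A U \<inter> tset A V = tset A (U \<inter> V)" "sset A U \<inter> sset A V = sset A (U \<inter> V)"
    by (auto simp: tset_def sset_def)
  then show "tmap \<phi> ` (tset A U \<inter> tset A V) = \<phi> ` (U \<inter> V) \<times> UNIV"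
    "tmap \<phi> ` (sset A U \<inter> sset A V) = \<phi> ` (U \<inter> V) \<times> (- {0})"
    using tmap_image_subset[of "U \<inter> V"] smap_image_subset[of "U \<inter> V"] by auto
qed

end

lemma open_Compl_0: "open (- {0 :: 'a::euclidean_space})"
  by (simp add: open_Compl)

lemma smooth_atlas_tangent:
  assumes "smooth_atlas A"
  shows "smooth_atlas (tangent_atlas A)"
proof -
  have c: "chart A U \<phi>" if "(U, \<phi>) \<in> A" for U \<phi> using that assms by unfold_locales
  show ?thesis
    unfolding smooth_atlas_def tangent_atlas_eq
    using chart.tmap_inj[OF c] chart.tmap_image[OF c] chart.open_image[OF c] chart.restrict_chart(1)[OF c]
      chart.tmap_transition[OF c] chart.transition(1)[OF c]
    by (auto simp: open_Times)
qed

lemma smooth_atlas_slit: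
  assumes "smooth_atlas A"
  shows "smooth_atlas (slit_atlas A)"
proof -
  have c: "chart A U \<phi>" if "(U, \<phi>) \<in> A" for U \<phi> using that assms by unfold_locales
  have "smooth_on (\<phi> ` (U \<inter> V) \<times> (- {0})) (tmap \<psi> \<circ> inv_into (sset A U) (tmap \<phi>))"
    if U: "(U, \<phi>) \<in> A" and V: "(V, \<psi>) \<in> A" for U \<phi> V \<psi>
  proof -
    interpret chart A U \<phi> using c[OF U] .
    let ?O = "\<phi> ` (U \<inter> V) \<times> (- {0 :: 'b})"
    have O: "open ?O" using transition(1)[OF V] open_Compl_0 by (intro open_Times) auto
    have eq: "(tmap \<psi> \<circ> inv_into (sset A U) (tmap \<phi>)) z = (tmap \<psi> \<circ> inv_into (tset A U) (tmap \<phi>)) z"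
      if "z \<in> ?O" for z
      using that smap_inv[of "fst z" "snd z"] tmap_inv[of "fst z" "snd z"] by (cases z) auto
    have "smooth_on ?O (tmap \<psi> \<circ> inv_into (tset A U) (tmap \<phi>))"
      by (rule smooth_on_subset[OF tmap_transition[OF V]]) auto
    then show ?thesis by (rule smooth_on_transform[OF _ O eq])
  qed
  then show ?thesis
    unfolding smooth_atlas_def slit_atlas_eq
    using chart.smap_inj[OF c] chart.smap_image[OF c] chart.open_image[OF c] chart.restrict_chart(2)[OF c]
      chart.transition(1)[OF c]
    by (auto simp: open_Times open_Compl_0)
qed

context chart
begin

lemma chart_tangent: "chart (tangent_atlas A) (tset A U) (tmap \<phi>)"
  using smooth_atlas_tangent[OF atlas] chart by unfold_locales (auto simp: tangent_atlas_eq)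

lemma chart_slit: "chart (slit_atlas A) (sset A U) (tmap \<phi>)"
  using smooth_atlas_slit[OF atlas] chart by unfold_locales (auto simp: slit_atlas_eq)

end

section \<open>Sections and vector fields in coordinates\<close>

text \<open>A section in coordinates, as a function of the point \<open>z = (x, y)\<close>.\<close>

definition srep :: "('p, 'e::euclidean_space) atlas \<Rightarrow> 'p set \<Rightarrow> ('p \<Rightarrow> 'e) \<Rightarrow> 'p bsection \<Rightarrow> 'e \<times> 'e \<Rightarrow> 'e" where
  "srep A U \<phi> Y z = coords \<phi> (Y (inv_into (sset A U) (tmap \<phi>) z))"

context chart
begin

text \<open>A tangent vector only sees the germ of a function, whether or not the function is smooth.\<close>

lemma tv_cong_germ:
  assumes p: "p \<in> U" and W: "open W" "\<phi> p \<in> W" "W \<subseteq> \<phi> ` U" "\<And>x. x \<in> W \<Longrightarrow> f (\<phi>inv x) = g (\<phi>inv x)"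
  shows "tv A U \<phi> p e f = tv A U \<phi> p e g"
proof -
  have imp: "smooth_fun_at A g' p" if f': "smooth_fun_at A f' p" and eq: "\<And>x. x \<in> W \<Longrightarrow> f' (\<phi>inv x) = g' (\<phi>inv x)"
    for f' g' :: "'p \<Rightarrow> real"
  proof -
    obtain T where T: "open T" "\<phi> p \<in> T" "T \<subseteq> \<phi> ` U" "smooth_on T (f' \<circ> \<phi>inv)"
      using smooth_fun_atD[OF f' p] by blast
    have "smooth_on (T \<inter> W) (g' \<circ> \<phi>inv)"
      by (rule smooth_on_transform[OF smooth_on_subset[OF T(4)]]) (use T W eq in auto)
    then show ?thesis using T W by (intro smooth_fun_atI[OF p, of "T \<inter> W"]) auto
  qed
  have "dird (f \<circ> \<phi>inv) (\<phi> p) e = dird (g \<circ> \<phi>inv) (\<phi> p) e"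
    by (rule dird_cong_open[OF W(1,2)]) (use W in simp)
  moreover have "smooth_fun_at A f p \<longleftrightarrow> smooth_fun_at A g p"
    using imp[of f g] imp[of g f] W(4) by metis
  ultimately show ?thesis by (simp add: tv_def)
qed

lemma smooth_field_coords:
  assumes X: "\<And>p. p \<in> U \<Longrightarrow> X p \<in> tangent_space A p"
    and sm: "\<And>p. p \<in> U \<Longrightarrow> smooth_at A (tangent_atlas A) (\<lambda>q. (q, X q)) p"
  shows "smooth_on (\<phi> ` U) (\<lambda>x. coords \<phi> (X (\<phi>inv x)))"
proof -
  interpret T: chart "tangent_atlas A" "tset A U" "tmap \<phi>" by (rule chart_tangent)
  have "smooth_on (\<phi> ` U) (tmap \<phi> \<circ> (\<lambda>q. (q, X q)) \<circ> \<phi>inv)"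
    using smooth_on_chart_iff[OF atlas chart T.atlas T.chart, of "\<lambda>q. (q, X q)"] X sm
    by (auto simp: tset_def)
  from smooth_on_snd[OF open_image this] show ?thesis by (simp add: comp_def)
qed

end

locale slit_chart = chart A U \<phi> + S: chart "slit_atlas A" "sset A U" "tmap \<phi>"
  for A :: "('p, 'e::euclidean_space) atlas" and U :: "'p set" and \<phi> :: "'p \<Rightarrow> 'e"

lemma slit_chartI: "smooth_atlas A \<Longrightarrow> (U, \<phi>) \<in> A \<Longrightarrow> slit_chart A U \<phi>"
  unfolding slit_chart_def using chart.chart_slit[of A U \<phi>] by (simp add: chart_def)

context slit_chart
begin

text \<open>Coordinates \<open>z = (x, y)\<close> range over \<open>cdom\<close>, and \<open>pt z\<close> is the point with these coordinates. The
  vector \<open>STv u (a, b)\<close> at \<open>u\<close> has base component \<open>a\<close> and fibre component \<open>b\<close>.\<close>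

abbreviation "cdom \<equiv> \<phi> ` U \<times> (- {0 :: 'e})"
abbreviation "pt \<equiv> inv_into (sset A U) (tmap \<phi>)"
abbreviation "rep \<equiv> srep A U \<phi>"
abbreviation "STv \<equiv> tv (slit_atlas A) (sset A U) (tmap \<phi>)"

lemma cdom_eq: "tmap \<phi> ` sset A U = cdom" by (rule smap_image)

lemma open_cdom: "open cdom" using S.open_image cdom_eq by simp

lemma pt_in: "z \<in> cdom \<Longrightarrow> pt z \<in> sset A U"
  by (rule S.inv_in) (simp only: cdom_eq)

lemma tmap_pt: "z \<in> cdom \<Longrightarrow> tmap \<phi> (pt z) = z"
  by (rule S.chart_inv) (simp only: cdom_eq)

lemma tmap_in: "u \<in> sset A U \<Longrightarrow> tmap \<phi> u \<in> cdom"
  using cdom_eq by blast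

lemma pt_eq: "z \<in> cdom \<Longrightarrow> pt z = (\<phi>inv (fst z), tv A U \<phi> (\<phi>inv (fst z)) (snd z))"
  using smap_inv[of "fst z" "snd z"] by (cases z) auto

lemma fst_pt: "z \<in> cdom \<Longrightarrow> fst (pt z) = \<phi>inv (fst z)"
  by (simp add: pt_eq)

lemma fst_tmap: "fst (tmap \<phi> u) = \<phi> (fst u)" "snd (tmap \<phi> u) = coords \<phi> (snd u)"
  by (cases u; simp)+

lemma sset_iff: "u \<in> sset A U \<longleftrightarrow> u \<in> slit A \<and> fst u \<in> U"
  using in_carrier by (auto simp: sset_def slit_eq)

lemma ssetD: "u \<in> sset A U \<Longrightarrow> fst u \<in> U" "u \<in> sset A U \<Longrightarrow> snd u \<in> fibre A u" "u \<in> sset A U \<Longrightarrow> u \<in> slit A"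
  using in_carrier by (auto simp: sset_def slit_eq)

lemma srep_tmap: "u \<in> sset A U \<Longrightarrow> rep Y (tmap \<phi> u) = coords \<phi> (Y u)"
  by (simp add: srep_def)

lemma srep_pt: "rep Y z = coords \<phi> (Y (pt z))"
  by (simp add: srep_def)

lemma section_smooth_iff:
  assumes Y: "\<And>u. u \<in> sset A U \<Longrightarrow> Y u \<in> fibre A u"
  shows "(\<forall>u\<in>sset A U. smooth_at (slit_atlas A) (tangent_atlas A) (\<lambda>w. (fst w, Y w)) u) \<longleftrightarrow>
    smooth_on cdom (rep Y)"
proof -
  interpret T: chart "tangent_atlas A" "tset A U" "tmap \<phi>" by (rule chart_tangent)
  have sub: "(\<lambda>w. (fst w, Y w)) ` sset A U \<subseteq> tset A U"
    using Y by (auto simp: tset_def sset_def)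
  have eq: "(tmap \<phi> \<circ> (\<lambda>w. (fst w, Y w)) \<circ> pt) z = (fst z, rep Y z)" if "z \<in> cdom" for z
    using that by (auto simp: fst_pt srep_pt)
  have "smooth_on cdom (\<lambda>z. fst z)" by (rule smooth_on_linear[OF bounded_linear_fst])
  then have "smooth_on cdom (rep Y) \<longleftrightarrow> smooth_on cdom (\<lambda>z. (fst z, rep Y z))"
    using smooth_on_Pair[OF open_cdom] smooth_on_snd[OF open_cdom, of "\<lambda>z. (fst z, rep Y z)"] by auto
  also have "\<dots> \<longleftrightarrow> smooth_on cdom (tmap \<phi> \<circ> (\<lambda>w. (fst w, Y w)) \<circ> pt)"
    by (rule smooth_on_cong[OF open_cdom]) (rule eq[symmetric])
  also have "\<dots> \<longleftrightarrow> (\<forall>u\<in>sset A U. smooth_at (slit_atlas A) (tangent_atlas A) (\<lambda>w. (fst w, Y w)) u)"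
    using smooth_on_chart_iff[OF S.atlas S.chart T.atlas T.chart sub] cdom_eq by simp
  finally show ?thesis by simp
qed

lemma section_smooth_at:
  assumes "\<And>u. u \<in> sset A U \<Longrightarrow> Y u \<in> fibre A u" "smooth_on cdom (rep Y)" "u \<in> sset A U"
  shows "smooth_at (slit_atlas A) (tangent_atlas A) (\<lambda>w. (fst w, Y w)) u"
  using section_smooth_iff[of Y] assms by blast

lemma section_smooth: "Y \<in> sections A \<Longrightarrow> smooth_on cdom (rep Y)"
  using section_smooth_iff[of Y] by (auto simp: sections_def sset_iff)

lemma section_fibre: "Y \<in> sections A \<Longrightarrow> u \<in> sset A U \<Longrightarrow> Y u \<in> fibre A u"
  by (auto simp: sections_def sset_iff)

lemma section_tv:
  "Y \<in> sections A \<Longrightarrow> u \<in> sset A U \<Longrightarrow> Y u = tv A U \<phi> (fst u) (rep Y (tmap \<phi> u))"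
  using section_fibre[of Y u] ssetD(1)[of u] by (simp add: srep_tmap)

lemma field_smooth:
  assumes "X \<in> vector_fields (slit_atlas A)"
  shows "smooth_on cdom (\<lambda>z. coords (tmap \<phi>) (X (pt z)))"
  using S.smooth_field_coords[of X] assms S.in_carrier by (auto simp: vector_fields_def cdom_eq)

lemma STv_apply:
  assumes "smooth_on cdom (\<lambda>z. h (pt z))" "u \<in> sset A U"
  shows "STv u \<xi> h = dird (\<lambda>z. h (pt z)) (tmap \<phi> u) \<xi>"
proof -
  have "smooth_fun_at (slit_atlas A) h u"
    using S.smooth_fun_chart_iff[of h] assms by (simp add: cdom_eq comp_def)
  from S.tv_apply[OF this] show ?thesis by (simp add: comp_def)
qed

lemma smooth_at_fst: "u \<in> sset A U \<Longrightarrow> smooth_at (slit_atlas A) A fst u"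
proof -
  have "smooth_on cdom (\<lambda>z. fst z)" by (rule smooth_on_linear[OF bounded_linear_fst])
  then have "smooth_on cdom (\<phi> \<circ> fst \<circ> pt)"
    by (rule smooth_on_transform[OF _ open_cdom]) (auto simp: fst_pt)
  moreover have "fst ` sset A U \<subseteq> U" by (auto simp: sset_def)
  ultimately show "u \<in> sset A U \<Longrightarrow> smooth_at (slit_atlas A) A fst u"
    using smooth_on_chart_iff[OF S.atlas S.chart atlas chart, of fst] cdom_eq by auto
qed

lemma rho_STv:
  assumes u: "u \<in> sset A U"
  shows "rho A u (STv u \<xi>) = tv A U \<phi> (fst u) (fst \<xi>)"
proof -
  have "dird (\<phi> \<circ> fst \<circ> pt) (tmap \<phi> u) \<xi> = dird fst (tmap \<phi> u) \<xi>"
    by (rule dird_cong_open[OF open_cdom tmap_in[OF u]]) (auto simp: fst_pt)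
  also have "\<dots> = fst \<xi>"
    by (rule dird_eqI) (rule bounded_linear_imp_has_derivative[OF bounded_linear_fst])
  finally show ?thesis
    using differential_tv[OF S.atlas S.chart u atlas chart ssetD(1)[OF u] smooth_at_fst[OF u]]
    by (simp add: rho_def)
qed

lemma gamma_tv:
  assumes u: "u \<in> sset A U"
  shows "gamma A u (tv A U \<phi> (fst u) e) = STv u (0, e)"
proof -
  define y where "y = coords \<phi> (snd u)"
  have p: "fst u \<in> U" using ssetD[OF u] by simp
  have y: "snd u = tv A U \<phi> (fst u) y" "y \<noteq> 0"
    using u p by (auto simp: y_def sset_def tv_zero) (metis tv_coords tv_zero)
  define c where "c = (\<lambda>t. (fst u, snd u + t *\<^sub>T tv A U \<phi> (fst u) e))"
  have c: "c t = (fst u, tv A U \<phi> (fst u) (y + t *\<^sub>R e))" for t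
    using p by (simp add: c_def y(1) tv_add tv_scale)
  have c0: "c 0 = u" unfolding c using y by (simp add: prod_eq_iff)
  have "velocity (slit_atlas A) c = STv (c 0) (0, e)"
  proof (rule S.velocity_eq_tv)
    have "((\<lambda>t. y + t *\<^sub>R e) \<longlongrightarrow> y + 0 *\<^sub>R e) (nhds 0)"
      by (intro tendsto_intros filterlim_ident)
    then have "\<forall>\<^sub>F t in nhds 0. y + t *\<^sub>R e \<noteq> 0"
      using y(2) by (intro tendsto_imp_eventually_ne) auto
    then show "\<forall>\<^sub>F t in nhds 0. c t \<in> sset A U"
      by eventually_elim (use p in \<open>simp add: c sset_def tv_eq_0_iff\<close>)
    show "((\<lambda>t. tmap \<phi> (c t)) has_vector_derivative (0, e)) (at 0)"
      unfolding c using p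
      by (auto simp: has_vector_derivative_def intro!: derivative_eq_intros)
  qed
  then show ?thesis unfolding c0 by (simp add: gamma_def c_def)
qed

text \<open>Differentiating \<open>w \<mapsto> Y w f\<close> produces a second derivative of \<open>f\<close> besides the derivative of the
  components of \<open>Y\<close>; the former is symmetric and cancels in a Lie bracket.\<close>

lemma STv_section_apply:
  assumes Y: "\<And>w. w \<in> sset A U \<Longrightarrow> Y w \<in> fibre A w" "smooth_on cdom (rep Y)"
    and u: "u \<in> sset A U" and f: "smooth_fun_at A f (fst u)"
  shows "STv u \<xi> (\<lambda>w. Y w f) =
    dird (\<lambda>x. dird (f \<circ> \<phi>inv) x (coords \<phi> (Y u))) (\<phi> (fst u)) (fst \<xi>) +
    tv A U \<phi> (fst u) (dird (rep Y) (tmap \<phi> u) \<xi>) f"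
proof -
  have p: "fst u \<in> U" using ssetD[OF u] by simp
  let ?z = "tmap \<phi> u"
  obtain W where W: "open W" "\<phi> (fst u) \<in> W" "W \<subseteq> \<phi> ` U" "smooth_on W (f \<circ> \<phi>inv)"
      "\<And>x. x \<in> W \<Longrightarrow> smooth_fun_at A f (\<phi>inv x)" using smooth_fun_at_nearby[OF f p] by blast
  define Om where "Om = W \<times> (- {0::'e})"
  have Om: "open Om" "?z \<in> Om" "Om \<subseteq> cdom"
    using W tmap_in[OF u] by (auto simp: Om_def open_Times open_Compl_0 fst_tmap mem_Times_iff)
  define T where "T = (\<lambda>z::'e \<times> 'e. dird (f \<circ> \<phi>inv) (fst z))"
  have eq: "Y (pt z) f = T z (rep Y z)" if "z \<in> Om" for z
  proof -
    have z: "z \<in> cdom" "fst z \<in> W" "fst z \<in> \<phi> ` U" using that Om W(3) by (auto simp: Om_def)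
    then have "Y (pt z) = tv A U \<phi> (\<phi>inv (fst z)) (rep Y z)"
      using Y(1)[OF pt_in] by (simp add: srep_pt fst_pt)
    then show ?thesis using W(5)[of "fst z"] z by (simp add: tv_def T_def)
  qed
  have fs: "smooth_on Om (\<lambda>z. fst z)" by (rule smooth_on_linear[OF bounded_linear_fst])
  have Tlin: "linear (T z)" if "z \<in> Om" for z
    unfolding T_def by (rule smooth_on_linear_dird[OF W(4)]) (use that in \<open>auto simp: Om_def\<close>)
  have Tsm: "smooth_on Om (\<lambda>z. T z e)" for e
    unfolding T_def
    by (rule smooth_on_compose[OF smooth_on_dird[OF W(4)] W(1) fs Om(1)]) (auto simp: Om_def)
  have Ysm: "smooth_on Om (rep Y)" using smooth_on_subset[OF Y(2) Om(3)] .
  have sm: "smooth_on Om (\<lambda>z. Y (pt z) f)"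
    by (rule smooth_on_transform[OF smooth_on_linear_apply[OF Om(1) Tlin Tsm Ysm] Om(1) eq])
  have "smooth_fun_at (slit_atlas A) (\<lambda>w. Y w f) u"
    using sm Om cdom_eq by (intro S.smooth_fun_atI[OF u Om(1,2)]) (simp_all add: comp_def)
  then have "STv u \<xi> (\<lambda>w. Y w f) = dird (\<lambda>z. Y (pt z) f) ?z \<xi>"
    using S.tv_apply by (simp add: comp_def)
  also have "\<dots> = dird (\<lambda>z. T z (rep Y z)) ?z \<xi>"
    by (rule dird_cong_open[OF Om(1,2) eq])
  also have "\<dots> = dird (\<lambda>z. T z (rep Y ?z)) ?z \<xi> + T ?z (dird (rep Y) ?z \<xi>)"
    by (rule dird_linear_apply[OF Om(1,2) Tlin Tsm Ysm])
  also have "dird (\<lambda>z. T z (rep Y ?z)) ?z \<xi> =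
      dird (\<lambda>x. dird (f \<circ> \<phi>inv) x (rep Y ?z)) (fst ?z) (dird (\<lambda>z. fst z) ?z \<xi>)"
    unfolding T_def using W(2)
    by (intro dird_chain[OF fs Om(2) smooth_on_dird[OF W(4)]]) (simp add: fst_tmap)
  also have "dird (\<lambda>z. fst z) ?z \<xi> = fst \<xi>"
    by (rule dird_eqI) (rule bounded_linear_imp_has_derivative[OF bounded_linear_fst])
  finally show ?thesis
    by (simp add: srep_tmap[OF u] fst_tmap T_def tv_apply[OF f] comp_def)
qed

text \<open>On functions lifted from the base a field acts only through its projection. The projected bracket is
  therefore determined by the projections near \<open>u\<close> and by the values of the fields at \<open>u\<close>, which makes the
  torsion conditions pointwise in the connection.\<close>

lemma rho_lie_bracket:
  assumes X: "X' u = STv u \<xi>" "\<And>w. w \<in> slit A \<Longrightarrow> rho A w (X' w) = X w" "X \<in> sections A"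
    and Y: "Y' u = STv u \<zeta>" "\<And>w. w \<in> slit A \<Longrightarrow> rho A w (Y' w) = Y w" "Y \<in> sections A"
    and u: "u \<in> sset A U"
  shows "rho A u (lie_bracket (slit_atlas A) X' Y' u) =
    tv A U \<phi> (fst u) (dird (rep Y) (tmap \<phi> u) \<xi> - dird (rep X) (tmap \<phi> u) \<zeta>)"
proof (rule ext)
  fix f
  have p: "fst u \<in> U" using ssetD[OF u] by simp
  show "rho A u (lie_bracket (slit_atlas A) X' Y' u) f =
    tv A U \<phi> (fst u) (dird (rep Y) (tmap \<phi> u) \<xi> - dird (rep X) (tmap \<phi> u) \<zeta>) f"
  proof (cases "smooth_fun_at A f (fst u)")
    case True
    obtain W where W: "open W" "\<phi> (fst u) \<in> W" "W \<subseteq> \<phi> ` U" "smooth_on W (f \<circ> \<phi>inv)"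
      "\<And>x. x \<in> W \<Longrightarrow> smooth_fun_at A f (\<phi>inv x)" using smooth_fun_at_nearby[OF True p] by blast
    define Om where "Om = W \<times> (- {0::'e})"
    have Om: "open Om" "tmap \<phi> u \<in> Om" "Om \<subseteq> cdom"
      using W tmap_in[OF u] by (auto simp: Om_def open_Times open_Compl_0 fst_tmap mem_Times_iff)
    \<comment> \<open>Near \<open>u\<close> the lifted function is differentiated by the projection of the field.\<close>
    have germ: "STv u \<eta> (\<lambda>q. Z' q (f \<circ> fst)) = STv u \<eta> (\<lambda>q. Z q f)"
      if "\<And>w. w \<in> slit A \<Longrightarrow> rho A w (Z' w) = Z w" for Z' Z and \<eta>
    proof (rule S.tv_cong_germ[OF u Om(1,2)])
      show "Om \<subseteq> tmap \<phi> ` sset A U" using Om(3) cdom_eq by simp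
      fix z assume z: "z \<in> Om"
      then have "pt z \<in> slit A" "smooth_fun_at A f (fst (pt z))"
        using ssetD(3)[OF pt_in] fst_pt[of z] Om(3) W(5)[of "fst z"] by (auto simp: Om_def)
      then show "Z' (pt z) (f \<circ> fst) = Z (pt z) f"
        using that[of "pt z", symmetric] by (simp add: rho_def differential_def)
    qed
    have fsm: "smooth_fun_at (slit_atlas A) (f \<circ> fst) u"
    proof (rule S.smooth_fun_atI[OF u Om(1,2)])
      show "Om \<subseteq> tmap \<phi> ` sset A U" using Om(3) cdom_eq by simp
      have "smooth_on Om (\<lambda>z. (f \<circ> \<phi>inv) (fst z))"
        by (rule smooth_on_compose[OF W(4,1) smooth_on_linear[OF bounded_linear_fst] Om(1)])
          (auto simp: Om_def)
      then show "smooth_on Om (f \<circ> fst \<circ> pt)"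
        by (rule smooth_on_transform[OF _ Om(1)]) (simp add: fst_pt subsetD[OF Om(3)])
    qed
    have XY: "fst \<xi> = coords \<phi> (X u)" "fst \<zeta> = coords \<phi> (Y u)"
      using X(1) X(2)[OF ssetD(3)[OF u]] Y(1) Y(2)[OF ssetD(3)[OF u]] rho_STv[OF u] p
      by (metis coords_tv)+
    have app: "STv u \<eta> (\<lambda>w. Z w f) =
      dird (\<lambda>x. dird (f \<circ> \<phi>inv) x (coords \<phi> (Z u))) (\<phi> (fst u)) (fst \<eta>) +
      tv A U \<phi> (fst u) (dird (rep Z) (tmap \<phi> u) \<eta>) f" if "Z \<in> sections A" for Z \<eta>
      using STv_section_apply[OF section_fibre[OF that] section_smooth[OF that] u True] .
    have "rho A u (lie_bracket (slit_atlas A) X' Y' u) f =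
        X' u (\<lambda>q. Y' q (f \<circ> fst)) - Y' u (\<lambda>q. X' q (f \<circ> fst))"
      using True fsm by (simp add: rho_def differential_def lie_bracket_def)
    also have "X' u (\<lambda>q. Y' q (f \<circ> fst)) = STv u \<xi> (\<lambda>q. Y q f)"
      unfolding X(1) by (rule germ) (rule Y(2))
    also have "Y' u (\<lambda>q. X' q (f \<circ> fst)) = STv u \<zeta> (\<lambda>q. X q f)"
      unfolding Y(1) by (rule germ) (rule X(2))
    also have "STv u \<xi> (\<lambda>q. Y q f) - STv u \<zeta> (\<lambda>q. X q f) =
        tv A U \<phi> (fst u) (dird (rep Y) (tmap \<phi> u) \<xi>) f
        - tv A U \<phi> (fst u) (dird (rep X) (tmap \<phi> u) \<zeta>) f"
      unfolding app[OF X(3)] app[OF Y(3)] XY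
      using second_dird_symmetric[OF W(4,1,2), of "coords \<phi> (X u)" "coords \<phi> (Y u)"] by simp
    finally show ?thesis using p by (simp add: tv_diff)
  qed (simp add: rho_def differential_def tv_def)
qed

lemma srep_fundamental: "z \<in> cdom \<Longrightarrow> rep (fundamental_section A) z = snd z"
  using ssetD(3)[OF pt_in[of z]] fst_tmap(2)[of "pt z"] by (simp add: srep_pt fundamental_section_def tmap_pt)

end

section \<open>Global sections\<close>

lemma sectionsI:
  assumes "smooth_atlas A" "Y \<in> (\<Pi>\<^sub>E u\<in>slit A. fibre A u)"
    and "\<And>U \<phi>. (U, \<phi>) \<in> A \<Longrightarrow> smooth_on (\<phi> ` U \<times> (- {0})) (srep A U \<phi> Y)"
  shows "Y \<in> sections A"
proof -
  have "smooth_at (slit_atlas A) (tangent_atlas A) (\<lambda>w. (fst w, Y w)) u" if u: "u \<in> slit A" for u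
  proof -
    obtain U \<phi> where U: "(U, \<phi>) \<in> A" "fst u \<in> U" using u by (auto simp: slit_eq elim: carrierE)
    then interpret slit_chart A U \<phi> using slit_chartI assms(1) by blast
    show ?thesis
    proof (rule section_smooth_at[OF _ assms(3)[OF U(1)]])
      show "Y w \<in> fibre A w" if "w \<in> sset A U" for w
        using assms(2) ssetD(3)[OF that] by (rule PiE_mem)
    qed (use u U(2) sset_iff in blast)
  qed
  then show ?thesis using assms(2) by (auto simp: sections_def)
qed

lemma section_mem: "Y \<in> sections A \<Longrightarrow> u \<in> slit A \<Longrightarrow> Y u \<in> fibre A u"
  by (auto simp: sections_def)

lemma section_ext: "Y \<in> sections A \<Longrightarrow> Y = restrict Y (slit A)"
  by (auto simp: sections_def PiE_iff extensional_restrict)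

lemma fibre_closed:
  assumes "smooth_atlas A" "u \<in> slit A"
  shows "v \<in> fibre A u \<Longrightarrow> w \<in> fibre A u \<Longrightarrow> v + w \<in> fibre A u"
    "v \<in> fibre A u \<Longrightarrow> w \<in> fibre A u \<Longrightarrow> v - w \<in> fibre A u"
    "v \<in> fibre A u \<Longrightarrow> a *\<^sub>T v \<in> fibre A u" "0 \<in> fibre A u"
proof -
  have c: "fst u \<in> carrier A" "snd u \<in> fibre A u" using assms(2) by (auto simp: slit_eq)
  show "v \<in> fibre A u \<Longrightarrow> w \<in> fibre A u \<Longrightarrow> v + w \<in> fibre A u"
    by (rule tangent_space_closed(2)[OF assms(1) c(1)])
  show "v \<in> fibre A u \<Longrightarrow> w \<in> fibre A u \<Longrightarrow> v - w \<in> fibre A u"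
    by (rule tangent_space_closed(5)[OF assms(1) c(1)])
  show "v \<in> fibre A u \<Longrightarrow> a *\<^sub>T v \<in> fibre A u"
    by (rule tangent_space_closed(3)[OF assms(1) c(1) _ c(2)])
  show "0 \<in> fibre A u"
    by (rule tangent_space_closed(4)[OF assms(1) c(1) c(2) c(2)])
qed

lemma section_add:
  assumes A: "smooth_atlas A" and Y: "Y \<in> sections A" "Y' \<in> sections A"
  shows "(\<lambda>w\<in>slit A. Y w + Y' w) \<in> sections A"
proof (rule sectionsI[OF A])
  show "(\<lambda>w\<in>slit A. Y w + Y' w) \<in> (\<Pi>\<^sub>E u\<in>slit A. fibre A u)"
    unfolding restrict_PiE_iff using fibre_closed(1)[OF A] section_mem Y by blast
  fix U \<phi> assume "(U, \<phi>) \<in> A"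
  then interpret slit_chart A U \<phi> using slit_chartI A by blast
  have "smooth_on cdom (\<lambda>z. srep A U \<phi> Y z + srep A U \<phi> Y' z)"
    using section_smooth Y by (intro smooth_on_add open_cdom)
  then show "smooth_on cdom (srep A U \<phi> (\<lambda>w\<in>slit A. Y w + Y' w))"
    by (rule smooth_on_transform[OF _ open_cdom])
      (use ssetD(3)[OF pt_in] in \<open>simp add: srep_pt coords_def sum.distrib scaleR_add_left\<close>)
qed

lemma section_smult:
  assumes A: "smooth_atlas A" and Y: "Y \<in> sections A" and f: "smooth_fun (slit_atlas A) f"
  shows "(\<lambda>w\<in>slit A. f w *\<^sub>T Y w) \<in> sections A"
proof (rule sectionsI[OF A])
  show "(\<lambda>w\<in>slit A. f w *\<^sub>T Y w) \<in> (\<Pi>\<^sub>E u\<in>slit A. fibre A u)"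
    unfolding restrict_PiE_iff using fibre_closed(3)[OF A] section_mem[OF Y] by blast
  fix U \<phi> assume "(U, \<phi>) \<in> A"
  then interpret slit_chart A U \<phi> using slit_chartI A by blast
  have "smooth_on cdom (\<lambda>z. f (pt z))"
    using f S.smooth_fun_chart_iff[of f] S.in_carrier by (simp add: smooth_fun_def cdom_eq comp_def)
  then have "smooth_on cdom (\<lambda>z. f (pt z) *\<^sub>R srep A U \<phi> Y z)"
    using section_smooth Y by (intro smooth_on_scaleR open_cdom)
  then show "smooth_on cdom (srep A U \<phi> (\<lambda>w\<in>slit A. f w *\<^sub>T Y w))"
    by (rule smooth_on_transform[OF _ open_cdom])
      (use ssetD(3)[OF pt_in] in \<open>simp add: srep_pt coords_def tscale_def scaleR_sum_right\<close>)
qed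

lemma fundamental_in_sections:
  assumes A: "smooth_atlas A"
  shows "fundamental_section A \<in> sections A"
proof (rule sectionsI[OF A])
  show "fundamental_section A \<in> (\<Pi>\<^sub>E u\<in>slit A. fibre A u)"
    by (auto simp: fundamental_section_def slit_eq)
  fix U \<phi> assume "(U, \<phi>) \<in> A"
  then interpret slit_chart A U \<phi> using slit_chartI A by blast
  show "smooth_on cdom (srep A U \<phi> (fundamental_section A))"
    by (rule smooth_on_transform[OF smooth_on_linear[OF bounded_linear_snd] open_cdom srep_fundamental])
qed

text \<open>Multiplication by such a function extends sections over the chart domain to global ones.\<close>

definition cutoff :: "('p, 'e::euclidean_space) atlas \<Rightarrow> 'p set \<Rightarrow> ('p \<Rightarrow> 'e) \<Rightarrow> ('p \<Rightarrow> real) \<Rightarrow> bool" where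
  "cutoff A U \<phi> s \<longleftrightarrow> smooth_on (\<phi> ` U) (s \<circ> inv_into U \<phi>) \<and>
     (\<exists>K\<subseteq>U. closedin (manifold_topology A) K \<and> (\<forall>q\<in>carrier A - K. s q = 0))"

context slit_chart
begin

text \<open>The closed coordinate ball that carries the bump function is compact, hence closed in the Hausdorff
  manifold.\<close>

lemma ex_cutoff:
  assumes H: "Hausdorff_space (manifold_topology A)" and p: "p \<in> U"
  shows "\<exists>s. cutoff A U \<phi> s \<and> s p \<noteq> 0"
proof -
  obtain r where r: "r > 0" "cball (\<phi> p) r \<subseteq> \<phi> ` U"
    using open_image p open_contains_cball by blast
  define K where "K = \<phi>inv ` cball (\<phi> p) r"
  define s where "s = (\<lambda>q. if q \<in> U then bump (\<phi> p) r (\<phi> q) else 0)"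
  have "continuous_map (top_of_set (\<phi> ` U)) (manifold_topology A) \<phi>inv"
    unfolding continuous_map_def
  proof (intro conjI allI impI)
    have "open (\<psi> ` (carrier A \<inter> V))" if "(V, \<psi>) \<in> A" for V \<psi>
    proof -
      have "carrier A \<inter> V = V" using that by (auto simp: carrier_def)
      then show ?thesis using atlas that by (auto simp: smooth_atlas_def)
    qed
    then have "openin (manifold_topology A) (carrier A)"
      using openin_manifold_topology[OF atlas] by auto
    then have "topspace (manifold_topology A) = carrier A"
      using openin_manifold_topology[OF atlas] by (meson openin_subset openin_topspace subset_antisym)
    then show "\<phi>inv \<in> topspace (top_of_set (\<phi> ` U)) \<rightarrow> topspace (manifold_topology A)"
      using in_carrier by auto
    fix W assume "openin (manifold_topology A) W"
    then have "open (\<phi> ` (W \<inter> U))" using openin_manifold_topology[OF atlas] chart by auto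
    moreover have "{x \<in> topspace (top_of_set (\<phi> ` U)). \<phi>inv x \<in> W} = \<phi> ` (W \<inter> U)" by auto
    ultimately show "openin (top_of_set (\<phi> ` U)) {x \<in> topspace (top_of_set (\<phi> ` U)). \<phi>inv x \<in> W}"
      by (metis open_openin_trans inf_le2 image_mono open_image)
  qed
  moreover have "compactin (top_of_set (\<phi> ` U)) (cball (\<phi> p) r)"
    using r(2) by (simp add: compactin_subtopology)
  ultimately have "compactin (manifold_topology A) K"
    unfolding K_def using image_compactin by blast
  then have "closedin (manifold_topology A) K" using compactin_imp_closedin[OF H] by blast
  moreover have "K \<subseteq> U" using r(2) by (auto simp: K_def)
  moreover have "s q = 0" if "q \<notin> K" for q
  proof (cases "q \<in> U")
    case True
    then have "\<phi> q \<notin> cball (\<phi> p) r" using that by (metis K_def image_eqI inv_chart)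
    then show ?thesis using r(1) by (simp add: s_def bump_eq_0 dist_commute)
  qed (simp add: s_def)
  moreover have "smooth_on (\<phi> ` U) (s \<circ> \<phi>inv)"
    by (rule smooth_on_transform[OF smooth_on_subset[OF smooth_on_bump[of "\<phi> p" r]] open_image]) (auto simp: s_def)
  ultimately have "cutoff A U \<phi> s" unfolding cutoff_def by blast
  moreover have "s p \<noteq> 0" using bump_pos[of "\<phi> p" "\<phi> p" r] r(1) p by (simp add: s_def)
  ultimately show ?thesis by blast
qed

lemma cutoff_smooth:
  assumes "cutoff A U \<phi> s"
  shows "smooth_on cdom (\<lambda>z. s (\<phi>inv (fst z)))"
proof -
  have "smooth_on (\<phi> ` U) (s \<circ> \<phi>inv)" using assms unfolding cutoff_def by blast
  then have "smooth_on cdom (\<lambda>z. (s \<circ> \<phi>inv) (fst z))"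
    by (rule smooth_on_compose[OF _ open_image smooth_on_linear[OF bounded_linear_fst] open_cdom]) auto
  then show ?thesis by simp
qed

text \<open>Near a point outside the chart domain the extension by zero vanishes, because the support of the
  cutoff function is closed in the whole manifold.\<close>

lemma cutoff_vanishes_nearby:
  assumes s: "cutoff A U \<phi> s" and V: "(V, \<psi>) \<in> A" and u: "u \<in> sset A V" "fst u \<notin> U"
  shows "\<exists>Om. open Om \<and> tmap \<psi> u \<in> Om \<and> Om \<subseteq> tmap \<psi> ` sset A V \<and>
    (\<forall>z\<in>Om. s (fst (inv_into (sset A V) (tmap \<psi>) z)) = 0)"
proof -
  interpret V: slit_chart A V \<psi> using slit_chartI[OF atlas V] .
  from s obtain K where K: "K \<subseteq> U" "closedin (manifold_topology A) K" "\<And>q. q \<in> carrier A - K \<Longrightarrow> s q = 0"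
    unfolding cutoff_def by blast
  have top: "topspace (manifold_topology A) \<subseteq> carrier A"
    using openin_topspace openin_manifold_topology[OF atlas] by blast
  have "openin (manifold_topology A) (topspace (manifold_topology A) - K)"
    using K(2) by (simp add: closedin_def)
  then have o: "open (\<psi> ` ((topspace (manifold_topology A) - K) \<inter> V))"
    using openin_manifold_topology[OF atlas] V by auto
  have "openin (manifold_topology A) V"
    using openin_manifold_topology[OF atlas, of V] V.in_carrier chart.transition(1)[OF chart.intro[OF atlas] V]
    by (auto simp: Int_commute)
  then have sub: "V \<subseteq> topspace (manifold_topology A)" by (rule openin_subset)
  define W where "W = \<psi> ` (V - K)"
  have "(topspace (manifold_topology A) - K) \<inter> V = V - K" using sub by auto
  then have W: "open W" using o by (simp add: W_def)
  have "tmap \<psi> u \<in> W \<times> (- {0})"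
    using u K(1) V.tmap_in[OF u(1)] V.ssetD[OF u(1)] by (auto simp: W_def mem_Times_iff V.fst_tmap)
  moreover have "s (fst (V.pt z)) = 0" if "z \<in> W \<times> (- {0})" for z
  proof -
    have "fst z \<in> \<psi> ` (V - K)" using that by (simp add: W_def mem_Times_iff)
    then obtain q where q: "q \<in> V" "q \<notin> K" "fst z = \<psi> q" by (elim imageE DiffE)
    have "z \<in> V.cdom" using that by (auto simp: W_def)
    then show ?thesis using q K(3)[of q] V.in_carrier by (simp add: V.fst_pt)
  qed
  moreover have "W \<times> (- {0}) \<subseteq> tmap \<psi> ` sset A V" unfolding V.cdom_eq by (auto simp: W_def)
  moreover have "open (W \<times> (- {0 :: 'e}))" using W open_Compl_0 by (rule open_Times)
  ultimately show ?thesis by (intro exI[of _ "W \<times> (- {0})"] conjI ballI)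
qed

lemma cutoff_fun:
  assumes s: "cutoff A U \<phi> s" and h: "smooth_on cdom (\<lambda>z. h (pt z))"
  shows "smooth_fun (slit_atlas A) (\<lambda>u. if fst u \<in> U then s (fst u) * h u else 0)"
  unfolding smooth_fun_def
proof
  let ?f = "\<lambda>u. if fst u \<in> U then s (fst u) * h u else 0"
  fix u assume u: "u \<in> slit A"
  show "smooth_fun_at (slit_atlas A) ?f u"
  proof (cases "fst u \<in> U")
    case True
    have "smooth_on cdom (\<lambda>z. s (\<phi>inv (fst z)) * h (pt z))"
      by (intro smooth_on_mult open_cdom cutoff_smooth s h)
    then have "smooth_on cdom (?f \<circ> pt)"
      by (rule smooth_on_transform[OF _ open_cdom]) (auto simp: fst_pt)
    then show ?thesis using S.smooth_fun_chart_iff[of ?f] True u sset_iff cdom_eq by auto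
  next
    case False
    obtain V \<psi> where V: "(V, \<psi>) \<in> A" "fst u \<in> V" using u by (auto simp: slit_eq elim: carrierE)
    then interpret V: slit_chart A V \<psi> using slit_chartI atlas by blast
    have uV: "u \<in> sset A V" using u V V.sset_iff by blast
    from cutoff_vanishes_nearby[OF s V(1) uV False] obtain Om where
      Om: "open Om" "tmap \<psi> u \<in> Om" "Om \<subseteq> tmap \<psi> ` sset A V" "\<And>z. z \<in> Om \<Longrightarrow> s (fst (V.pt z)) = 0" by blast
    have "smooth_on Om (?f \<circ> V.pt)"
      by (rule smooth_on_transform[OF smooth_on_const[of _ 0] Om(1)]) (use Om(4) in auto)
    then show ?thesis by (rule V.S.smooth_fun_atI[OF uV Om(1-3)])
  qed
qed

lemma cutoff_section:
  assumes s: "cutoff A U \<phi> s" and Y: "\<And>u. u \<in> sset A U \<Longrightarrow> Y u \<in> fibre A u" "smooth_on cdom (rep Y)"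
  shows "(\<lambda>u\<in>slit A. if fst u \<in> U then s (fst u) *\<^sub>T Y u else 0) \<in> sections A"
proof -
  let ?Y = "\<lambda>u\<in>slit A. if fst u \<in> U then s (fst u) *\<^sub>T Y u else 0"
  have fib: "?Y \<in> (\<Pi>\<^sub>E u\<in>slit A. fibre A u)"
    using fibre_closed[OF atlas] Y(1) sset_iff by auto
  have sm: "smooth_at (slit_atlas A) (tangent_atlas A) (\<lambda>w. (fst w, ?Y w)) u" if u: "u \<in> slit A" for u
  proof (cases "fst u \<in> U")
    case True
    have "smooth_on cdom (\<lambda>z. s (\<phi>inv (fst z)) *\<^sub>R rep Y z)"
      by (intro smooth_on_scaleR open_cdom cutoff_smooth s Y)
    then have "smooth_on cdom (rep ?Y)"
      by (rule smooth_on_transform[OF _ open_cdom])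
        (use ssetD[OF pt_in] in \<open>auto simp: srep_pt coords_def tscale_def scaleR_sum_right fst_pt\<close>)
    then show ?thesis
    proof (rule section_smooth_at[rotated])
      show "?Y w \<in> fibre A w" if "w \<in> sset A U" for w
        using fib ssetD(3)[OF that] by (rule PiE_mem)
    qed (use u True sset_iff in blast)
  next
    case False
    obtain V \<psi> where V: "(V, \<psi>) \<in> A" "fst u \<in> V" using u by (auto simp: slit_eq elim: carrierE)
    then interpret V: slit_chart A V \<psi> using slit_chartI atlas by blast
    interpret T: chart "tangent_atlas A" "tset A V" "tmap \<psi>" by (rule V.chart_tangent)
    have uV: "u \<in> sset A V" using u V V.sset_iff by blast
    from cutoff_vanishes_nearby[OF s V(1) uV False] obtain Om where
      Om: "open Om" "tmap \<psi> u \<in> Om" "Om \<subseteq> tmap \<psi> ` sset A V" "\<And>z. z \<in> Om \<Longrightarrow> s (fst (V.pt z)) = 0" by blast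
    have cdom_V: "z \<in> V.cdom" if "z \<in> Om" for z
      using subsetD[OF Om(3) that] by (simp only: V.cdom_eq)
    note in_V = V.pt_in[OF cdom_V] cdom_V
    have "smooth_on Om (\<lambda>z. (fst z, 0 :: 'e))"
      by (intro smooth_on_Pair Om smooth_on_const smooth_on_linear bounded_linear_fst)
    then have "smooth_on Om (tmap \<psi> \<circ> (\<lambda>w. (fst w, ?Y w)) \<circ> V.pt)"
    proof (rule smooth_on_transform[OF _ Om(1)])
      fix z assume z: "z \<in> Om"
      have "?Y (V.pt z) = 0"
        using Om(4)[OF z] V.ssetD(3)[OF in_V(1)[OF z]] by (simp add: tscale_def fun_eq_iff)
      moreover have "\<psi> (fst (V.pt z)) = fst z" using in_V(2)[OF z] by (auto simp: V.fst_pt)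
      ultimately show "(tmap \<psi> \<circ> (\<lambda>w. (fst w, ?Y w)) \<circ> V.pt) z = (fst z, 0)"
        by (simp add: coords_def)
    qed
    moreover have "(\<lambda>w. (fst w, ?Y w)) ` V.pt ` Om \<subseteq> tset A V"
    proof (clarsimp simp only: image_iff)
      fix z assume "z \<in> Om"
      then show "(fst (V.pt z), ?Y (V.pt z)) \<in> tset A V"
        using PiE_mem[OF fib V.ssetD(3)[OF in_V(1)]] V.ssetD(1)[OF in_V(1)] by (simp add: tset_def)
    qed
    moreover have "(fst u, ?Y u) \<in> tset A V" using PiE_mem[OF fib u] V(2) by (simp add: tset_def)
    ultimately show ?thesis
      by (intro smooth_atI[OF V.S.chart uV T.chart _ Om(1-3)])
  qed
  show ?thesis unfolding sections_def using fib sm by blast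
qed

end

section \<open>Connections in coordinates\<close>

text \<open>What it means for \<open>d\<close> to be the value at \<open>u\<close> of a linear connection, apart from smoothness in \<open>u\<close>.\<close>

definition connection_at ::
  "('p, 'e::euclidean_space) atlas \<Rightarrow> 'p tpoint \<Rightarrow> ('p tpoint tvec \<Rightarrow> 'p bsection \<Rightarrow> 'p tvec) \<Rightarrow> bool" where
  "connection_at A u d \<longleftrightarrow>
     d \<in> (\<Pi>\<^sub>E X\<in>tangent_space (slit_atlas A) u. sections A \<rightarrow>\<^sub>E fibre A u) \<and>
     (\<forall>X\<in>tangent_space (slit_atlas A) u. \<forall>X'\<in>tangent_space (slit_atlas A) u. \<forall>a b. \<forall>Y\<in>sections A.
        d (a *\<^sub>T X + b *\<^sub>T X') Y = a *\<^sub>T d X Y + b *\<^sub>T d X' Y) \<and>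
     (\<forall>X\<in>tangent_space (slit_atlas A) u. \<forall>Y\<in>sections A. \<forall>Y'\<in>sections A.
        d X (\<lambda>w\<in>slit A. Y w + Y' w) = d X Y + d X Y') \<and>
     (\<forall>X\<in>tangent_space (slit_atlas A) u. \<forall>f. \<forall>Y\<in>sections A. smooth_fun (slit_atlas A) f \<longrightarrow>
        d X (\<lambda>w\<in>slit A. f w *\<^sub>T Y w) = X f *\<^sub>T Y u + f u *\<^sub>T d X Y)"

lemma linear_connection_iff:
  "linear_connection A D \<longleftrightarrow> D \<in> extensional (slit A) \<and> (\<forall>u\<in>slit A. connection_at A u (D u)) \<and>
     (\<forall>X\<in>vector_fields (slit_atlas A). \<forall>Y\<in>sections A. (\<lambda>u\<in>slit A. D u (X u) Y) \<in> sections A)"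
  unfolding linear_connection_def connection_at_def PiE_iff[of D] by blast

text \<open>The pointwise part of regularity.\<close>

definition splits :: "('p, 'e::euclidean_space) atlas \<Rightarrow> 'p connection \<Rightarrow> 'p tpoint \<Rightarrow> bool" where
  "splits A D u \<longleftrightarrow> connection_at A u (D u) \<and> (\<forall>X\<in>tangent_space (slit_atlas A) u.
     \<exists>!VH. VH \<in> vertical_space A u \<times> horizontal_space A D u \<and> X = fst VH + snd VH)"

lemma regular_connection_iff:
  "regular_connection A D \<longleftrightarrow> D \<in> extensional (slit A) \<and> (\<forall>u\<in>slit A. splits A D u) \<and>
     (\<forall>X\<in>vector_fields (slit_atlas A). \<forall>Y\<in>sections A. (\<lambda>u\<in>slit A. D u (X u) Y) \<in> sections A)"
  unfolding regular_connection_def linear_connection_iff splits_def ball_conj_distrib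
  by (simp only: conj_ac)

text \<open>The covariant derivative with connection coefficients \<open>\<Gamma>\<close>: the derivative of the components of \<open>Y\<close>
  corrected by a term of order zero.\<close>

definition conn_of :: "('p, 'e::euclidean_space) atlas \<Rightarrow> 'p set \<Rightarrow> ('p \<Rightarrow> 'e) \<Rightarrow> ('e \<times> 'e \<Rightarrow> 'e \<Rightarrow> 'e) \<Rightarrow>
    'p tpoint \<Rightarrow> 'p tpoint tvec \<Rightarrow> 'p bsection \<Rightarrow> 'p tvec" where
  "conn_of A U \<phi> \<Gamma> u = (\<lambda>X\<in>tangent_space (slit_atlas A) u. \<lambda>Y\<in>sections A.
     tv A U \<phi> (fst u) (dird (srep A U \<phi> Y) (tmap \<phi> u) (coords (tmap \<phi>) X) +
       \<Gamma> (coords (tmap \<phi>) X) (srep A U \<phi> Y (tmap \<phi> u))))"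

lemma coords_add: "coords \<phi> (v + w) = coords \<phi> v + coords \<phi> w"
  by (simp add: coords_def sum.distrib scaleR_add_left)

lemma coords_scale: "coords \<phi> (a *\<^sub>T v) = a *\<^sub>R coords \<phi> v"
  by (simp add: coords_def tscale_def scaleR_sum_right)

lemma coords_0: "coords \<phi> 0 = 0"
  by (simp add: coords_def)

lemma coords_sum: "coords \<phi> (\<Sum>i\<in>I. v i) = (\<Sum>i\<in>I. coords \<phi> (v i))"
  by (induction I rule: infinite_finite_induct)
    (simp_all only: sum.infinite sum.empty sum.insert coords_add coords_0 not_False_eq_True)

lemma connection_atD:
  assumes "connection_at A u d" "X \<in> tangent_space (slit_atlas A) u" "Y \<in> sections A"
  shows "d X Y \<in> fibre A u"
    "X' \<in> tangent_space (slit_atlas A) u \<Longrightarrow> d (a *\<^sub>T X + b *\<^sub>T X') Y = a *\<^sub>T d X Y + b *\<^sub>T d X' Y"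
    "Y' \<in> sections A \<Longrightarrow> d X (\<lambda>w\<in>slit A. Y w + Y' w) = d X Y + d X Y'"
    "smooth_fun (slit_atlas A) f \<Longrightarrow> d X (\<lambda>w\<in>slit A. f w *\<^sub>T Y w) = X f *\<^sub>T Y u + f u *\<^sub>T d X Y"
proof -
  have "d X \<in> sections A \<rightarrow>\<^sub>E fibre A u" using assms(1,2) unfolding connection_at_def by blast
  then show "d X Y \<in> fibre A u" using assms(3) by (rule PiE_mem)
qed (use assms in \<open>simp_all add: connection_at_def\<close>)

lemma smooth_fun_const: "smooth_atlas A \<Longrightarrow> smooth_fun A (\<lambda>_. c)"
  unfolding smooth_fun_def
proof
  fix p assume A: "smooth_atlas A" "p \<in> carrier A"
  then obtain U \<phi> where U: "(U, \<phi>) \<in> A" "p \<in> U" by (auto elim: carrierE)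
  then interpret chart A U \<phi> using A by unfold_locales
  show "smooth_fun_at A (\<lambda>_. c) p"
    using smooth_fun_chart_iff[of "\<lambda>_. c"] U(2) by (simp add: comp_def smooth_on_const)
qed

lemma zero_section:
  assumes "smooth_atlas A"
  shows "(\<lambda>w\<in>slit A. 0) \<in> sections A"
proof -
  have "(\<lambda>w\<in>slit A. 0 *\<^sub>T fundamental_section A w) = (\<lambda>w\<in>slit A. 0)"
    by (rule restrict_ext) (simp add: tscale_def zero_fun_def)
  then show ?thesis
    using section_smult[OF assms fundamental_in_sections smooth_fun_const[OF smooth_atlas_slit], of 0] assms
    by metis
qed

lemma connection_at_zero:
  assumes A: "smooth_atlas A" and d: "connection_at A u d" and X: "X \<in> tangent_space (slit_atlas A) u"
  shows "d X (\<lambda>w\<in>slit A. 0) = 0"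
proof -
  have "d X (\<lambda>w\<in>slit A. 0) + d X (\<lambda>w\<in>slit A. 0) = d X (\<lambda>w\<in>slit A. 0)"
    using connection_atD(3)[OF d X zero_section[OF A] zero_section[OF A]] by (simp cong: restrict_cong)
  then show ?thesis by simp
qed

lemma section_sum:
  assumes A: "smooth_atlas A" and I: "finite I"
    and f: "\<And>i. i \<in> I \<Longrightarrow> smooth_fun (slit_atlas A) (f i)" and Y: "\<And>i. i \<in> I \<Longrightarrow> Y i \<in> sections A"
  shows "(\<lambda>w\<in>slit A. \<Sum>i\<in>I. f i w *\<^sub>T Y i w) \<in> sections A"
    "connection_at A u d \<Longrightarrow> X \<in> tangent_space (slit_atlas A) u \<Longrightarrow>
      d X (\<lambda>w\<in>slit A. \<Sum>i\<in>I. f i w *\<^sub>T Y i w) = (\<Sum>i\<in>I. X (f i) *\<^sub>T Y i u + f i u *\<^sub>T d X (Y i))"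
  using I f Y
proof (induction I rule: finite_induct)
  case empty
  { case 1 show ?case unfolding sum.empty by (rule zero_section[OF A]) }
  { case 2 show ?case unfolding sum.empty by (rule connection_at_zero[OF A 2(1,2)]) }
next
  case (insert i I)
  have S: "(\<lambda>w\<in>slit A. \<Sum>i\<in>I. f i w *\<^sub>T Y i w) \<in> sections A"
    and F: "(\<lambda>w\<in>slit A. f i w *\<^sub>T Y i w) \<in> sections A"
    if "\<And>j. j \<in> insert i I \<Longrightarrow> smooth_fun (slit_atlas A) (f j)" "\<And>j. j \<in> insert i I \<Longrightarrow> Y j \<in> sections A"
    using insert.IH(1) section_smult[OF A that(2)[of i] that(1)[of i]] that by blast+
  have eq: "(\<lambda>w\<in>slit A. \<Sum>i\<in>insert i I. f i w *\<^sub>T Y i w) =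
    (\<lambda>w\<in>slit A. (\<lambda>w\<in>slit A. f i w *\<^sub>T Y i w) w + (\<lambda>w\<in>slit A. \<Sum>i\<in>I. f i w *\<^sub>T Y i w) w)"
    using insert.hyps by (intro restrict_ext) simp
  { case 1 show ?case unfolding eq by (intro section_add[OF A] F S 1) }
  { case 2
    have "d X (\<lambda>w\<in>slit A. \<Sum>i\<in>I. f i w *\<^sub>T Y i w) = (\<Sum>i\<in>I. X (f i) *\<^sub>T Y i u + f i u *\<^sub>T d X (Y i))"
      using insert.IH(2)[OF 2(1,2)] 2(3,4) by blast
    moreover have "d X (\<lambda>w\<in>slit A. f i w *\<^sub>T Y i w) = X (f i) *\<^sub>T Y i u + f i u *\<^sub>T d X (Y i)"
      using 2 by (intro connection_atD(4)[OF 2(1,2)]) auto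
    ultimately show ?case
      using connection_atD(3)[OF 2(1,2) F[OF 2(3,4)] S[OF 2(3,4)]] arg_cong[OF eq, of "d X"]
      by (simp only: sum.insert[OF insert.hyps]) }
qed

locale manifold_chart = slit_chart +
  assumes hausdorff: "Hausdorff_space (manifold_topology A)"
begin

abbreviation "scoords \<equiv> coords (tmap \<phi>)"

lemma STv_in: "u \<in> sset A U \<Longrightarrow> STv u \<xi> \<in> tangent_space (slit_atlas A) u"
  by (rule S.tv_in)

lemma STv_scoords: "u \<in> sset A U \<Longrightarrow> X \<in> tangent_space (slit_atlas A) u \<Longrightarrow> STv u (scoords X) = X"
  by (rule S.tv_coords)

lemma scoords_STv: "u \<in> sset A U \<Longrightarrow> scoords (STv u \<xi>) = \<xi>"
  by (rule S.coords_tv)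

lemma conn_of_STv:
  "u \<in> sset A U \<Longrightarrow> Y \<in> sections A \<Longrightarrow> conn_of A U \<phi> \<Gamma> u (STv u \<xi>) Y =
    tv A U \<phi> (fst u) (dird (rep Y) (tmap \<phi> u) \<xi> + \<Gamma> \<xi> (rep Y (tmap \<phi> u)))"
  by (simp add: conn_of_def STv_in scoords_STv)

lemma srep_linear_dird:
  "u \<in> sset A U \<Longrightarrow> Y \<in> sections A \<Longrightarrow> linear (dird (rep Y) (tmap \<phi> u))"
  by (rule smooth_on_linear_dird[OF section_smooth tmap_in])

lemma srep_add:
  "z \<in> cdom \<Longrightarrow> rep (\<lambda>w\<in>slit A. Y w + Y' w) z = rep Y z + rep Y' z"
  using ssetD(3)[OF pt_in] by (simp add: srep_pt coords_add)

lemma srep_smult: "z \<in> cdom \<Longrightarrow> rep (\<lambda>w\<in>slit A. f w *\<^sub>T Y w) z = f (pt z) *\<^sub>R rep Y z"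
  using ssetD(3)[OF pt_in] by (simp add: srep_pt coords_scale)

text \<open>The Leibniz rule comes from the derivative term, the remaining term being linear over functions.\<close>

lemma connection_at_conn_of:
  assumes u: "u \<in> sset A U" and \<Gamma>: "bilinear \<Gamma>"
  shows "connection_at A u (conn_of A U \<phi> \<Gamma> u)"
proof -
  let ?z = "tmap \<phi> u" and ?d = "conn_of A U \<phi> \<Gamma> u"
  have p: "fst u \<in> U" and z: "?z \<in> cdom" using ssetD(1)[OF u] tmap_in[OF u] .
  have G1: "\<And>\<xi>. linear (\<Gamma> \<xi>)" and G2: "\<And>v. linear (\<lambda>\<xi>. \<Gamma> \<xi> v)" using \<Gamma> by (auto simp: bilinear_def)
  note sp = S.tangent_space_eq[OF u]
  have 1: "?d \<in> (\<Pi>\<^sub>E X\<in>tangent_space (slit_atlas A) u. sections A \<rightarrow>\<^sub>E fibre A u)"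
    unfolding conn_of_def using p by simp
  have 2: "?d (a *\<^sub>T X + b *\<^sub>T X') Y = a *\<^sub>T ?d X Y + b *\<^sub>T ?d X' Y"
    if X: "X \<in> tangent_space (slit_atlas A) u" "X' \<in> tangent_space (slit_atlas A) u" and Y: "Y \<in> sections A"
    for a b X X' Y
  proof -
    obtain \<xi> \<xi>' where "X = STv u \<xi>" "X' = STv u \<xi>'" using X sp by auto
    then show ?thesis
      using S.tv_linear[OF u, of a \<xi> b \<xi>', symmetric] p
      by (simp add: conn_of_STv u Y tv_linear[symmetric] linear_add[OF srep_linear_dird[OF u Y]]
          linear_cmul[OF srep_linear_dird[OF u Y]] linear_add[OF G2] linear_cmul[OF G2] algebra_simps)
  qed
  have 3: "?d X (\<lambda>w\<in>slit A. Y w + Y' w) = ?d X Y + ?d X Y'"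
    if X: "X \<in> tangent_space (slit_atlas A) u" and Y: "Y \<in> sections A" "Y' \<in> sections A" for X Y Y'
  proof -
    obtain \<xi> where \<xi>: "X = STv u \<xi>" using X sp by auto
    have "dird (rep (\<lambda>w\<in>slit A. Y w + Y' w)) ?z \<xi> =
        dird (\<lambda>z. rep Y z + rep Y' z) ?z \<xi>"
      by (rule dird_cong_open[OF open_cdom z srep_add])
    also have "\<dots> = dird (rep Y) ?z \<xi> + dird (rep Y') ?z \<xi>"
      by (rule dird_eqI) (intro has_derivative_add smooth_on_has_derivative[OF section_smooth z] Y)
    finally show ?thesis
      unfolding \<xi> using section_add[OF atlas Y] p
      by (simp add: conn_of_STv u Y tv_add[symmetric] srep_add[OF z] linear_add[OF G1] algebra_simps)
  qed
  have 4: "?d X (\<lambda>w\<in>slit A. f w *\<^sub>T Y w) = X f *\<^sub>T Y u + f u *\<^sub>T ?d X Y"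
    if X: "X \<in> tangent_space (slit_atlas A) u" and Y: "Y \<in> sections A" and f: "smooth_fun (slit_atlas A) f" for X Y f
  proof -
    obtain \<xi> where \<xi>: "X = STv u \<xi>" using X sp by auto
    have fs: "smooth_on cdom (\<lambda>z. f (pt z))"
      using f S.smooth_fun_chart_iff[of f] S.in_carrier by (simp add: smooth_fun_def cdom_eq comp_def)
    have "dird (rep (\<lambda>w\<in>slit A. f w *\<^sub>T Y w)) ?z \<xi> = dird (\<lambda>z. f (pt z) *\<^sub>R rep Y z) ?z \<xi>"
      by (rule dird_cong_open[OF open_cdom z srep_smult])
    also have "\<dots> = f (pt ?z) *\<^sub>R dird (rep Y) ?z \<xi> + dird (\<lambda>z. f (pt z)) ?z \<xi> *\<^sub>R rep Y ?z"
      by (rule dird_eqI)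
        (intro has_derivative_scaleR smooth_on_has_derivative[OF section_smooth[OF Y] z] smooth_on_has_derivative[OF fs z])
    also have "dird (\<lambda>z. f (pt z)) ?z \<xi> = X f" unfolding \<xi> by (rule STv_apply[OF fs u, symmetric])
    finally have D: "dird (rep (\<lambda>w\<in>slit A. f w *\<^sub>T Y w)) ?z \<xi> =
        f u *\<^sub>R dird (rep Y) ?z \<xi> + X f *\<^sub>R rep Y ?z"
      unfolding S.inv_chart[OF u] .
    have "Y u = tv A U \<phi> (fst u) (rep Y ?z)"
      using srep_tmap[OF u] section_fibre[OF Y u] p by simp
    then have "X f *\<^sub>T Y u + f u *\<^sub>T ?d X Y = tv A U \<phi> (fst u) (X f *\<^sub>R rep Y ?z +
        f u *\<^sub>R (dird (rep Y) ?z \<xi> + \<Gamma> \<xi> (rep Y ?z)))"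
      using p by (simp add: \<xi> conn_of_STv u Y tv_linear tv_add tv_scale)
    also have "\<dots> = ?d X (\<lambda>w\<in>slit A. f w *\<^sub>T Y w)"
      using u unfolding \<xi> conn_of_STv[OF u section_smult[OF atlas Y f]] D[unfolded \<xi>] srep_smult[OF z]
      by (simp add: linear_cmul[OF G1] algebra_simps)
    finally show ?thesis ..
  qed
  show ?thesis unfolding connection_at_def using 1 2 3 4 by blast
qed

lemma frame_section:
  assumes s: "cutoff A U \<phi> s"
  shows "(\<lambda>u\<in>slit A. if fst u \<in> U then s (fst u) *\<^sub>T tv A U \<phi> (fst u) e else 0) \<in> sections A"
proof (rule cutoff_section[OF s])
  show "tv A U \<phi> (fst u) e \<in> fibre A u" if "u \<in> sset A U" for u using ssetD(1)[OF that] by simp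
  show "smooth_on cdom (rep (\<lambda>u. tv A U \<phi> (fst u) e))"
    by (rule smooth_on_transform[OF smooth_on_const[of _ e] open_cdom]) (auto simp: srep_pt fst_pt)
qed

text \<open>A frame section with the cutoff function normalised at the given point.\<close>

lemma ex_section:
  assumes u: "u \<in> sset A U"
  shows "\<exists>Y\<in>sections A. rep Y (tmap \<phi> u) = e"
proof -
  obtain s where s: "cutoff A U \<phi> s" "s (fst u) \<noteq> 0" using ex_cutoff[OF hausdorff] ssetD(1)[OF u] by blast
  show ?thesis
  proof (rule bexI[OF _ frame_section[OF s(1), of "inverse (s (fst u)) *\<^sub>R e"]])
    show "rep (\<lambda>w\<in>slit A. if fst w \<in> U then s (fst w) *\<^sub>T
        tv A U \<phi> (fst w) (inverse (s (fst u)) *\<^sub>R e) else 0) (tmap \<phi> u) = e"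
      using u ssetD[OF u] s(2) by (simp add: srep_tmap coords_scale)
  qed
qed

text \<open>Multiplied by the square of a cutoff function, every section is a combination of global frame
  sections with global coefficients. The Leibniz rule then expresses the covariant derivative of the
  section through those of the frame, so that it is given by connection coefficients.\<close>

lemma connection_at_coefficients:
  assumes d: "connection_at A u d" and u: "u \<in> sset A U"
  shows "\<exists>\<Gamma>. bilinear \<Gamma> \<and> d = conn_of A U \<phi> \<Gamma> u"
proof -
  let ?z = "tmap \<phi> u" and ?T = "tangent_space (slit_atlas A) u"
  have p: "fst u \<in> U" and z: "?z \<in> cdom" and us: "u \<in> slit A" using ssetD[OF u] tmap_in[OF u] by auto
  obtain s where s: "cutoff A U \<phi> s" "s (fst u) \<noteq> 0" using ex_cutoff[OF hausdorff p] by blast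
  define F where "F e = (\<lambda>u\<in>slit A. if fst u \<in> U then s (fst u) *\<^sub>T tv A U \<phi> (fst u) e else 0)" for e
  have F: "F e \<in> sections A" for e unfolding F_def by (rule frame_section[OF s(1)])
  define \<sigma> where "\<sigma> = (\<lambda>z::'b \<times> 'b. s (\<phi>inv (fst z)))"
  have \<sigma>: "smooth_on cdom \<sigma>" unfolding \<sigma>_def by (rule cutoff_smooth[OF s(1)])
  define ds where "ds = dird \<sigma> ?z"
  have ds: "linear ds" "(\<sigma> has_derivative ds) (at ?z)"
    unfolding ds_def by (rule smooth_on_linear_dird[OF \<sigma> z], rule smooth_on_has_derivative[OF \<sigma> z])
  define S where "S = s (fst u)"
  have \<sigma>z: "\<sigma> ?z = S" using p by (simp add: \<sigma>_def S_def fst_tmap)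
  have S0: "S \<noteq> 0" using s(2) by (simp add: S_def)
  have \<sigma>pt: "s (fst (pt z)) = \<sigma> z" if "z \<in> cdom" for z using that by (auto simp: \<sigma>_def fst_pt)
  \<comment> \<open>The derivative of the factor \<open>\<sigma>\<close> of the frame section \<open>F b\<close> is subtracted.\<close>
  define \<Gamma> where "\<Gamma> \<xi> v = (1 / S) *\<^sub>R (\<Sum>b\<in>Basis. (v \<bullet> b) *\<^sub>R (coords \<phi> (d (STv u \<xi>) (F b)) - ds \<xi> *\<^sub>R b))"
    for \<xi> v
  have dlin: "coords \<phi> (d (STv u (a *\<^sub>R \<xi> + b *\<^sub>R \<xi>')) (F e)) =
      a *\<^sub>R coords \<phi> (d (STv u \<xi>) (F e)) + b *\<^sub>R coords \<phi> (d (STv u \<xi>') (F e))" for a b \<xi> \<xi>' e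
    using connection_atD(2)[OF d STv_in[OF u] F STv_in[OF u], of a \<xi> b \<xi>' e]
    by (simp add: S.tv_linear[OF u] coords_add coords_scale)
  have bil: "bilinear \<Gamma>" unfolding bilinear_def
  proof (intro conjI allI)
    fix \<xi> show "linear (\<Gamma> \<xi>)" unfolding \<Gamma>_def
      by (rule linearI)
        (simp_all add: inner_add_left scaleR_add_left sum.distrib scaleR_add_right scaleR_sum_right mult_ac)
  next
    fix v show "linear (\<lambda>\<xi>. \<Gamma> \<xi> v)"
    proof -
      define H where "H b \<xi> = coords \<phi> (d (STv u \<xi>) (F b)) - ds \<xi> *\<^sub>R b" for b \<xi>
      have H: "linear (H b)" for b unfolding H_def
        by (rule linearI)
          (use dlin[of 1 _ 1] dlin[of _ _ 0] in \<open>simp_all add: linear_add[OF ds(1)] linear_cmul[OF ds(1)]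
            scaleR_add_left scaleR_diff_right\<close>)
      show ?thesis unfolding \<Gamma>_def H_def[symmetric]
        by (rule linearI)
          (simp_all add: linear_add[OF H] linear_cmul[OF H] scaleR_add_right sum.distrib scaleR_sum_right mult_ac)
    qed
  qed
  have main: "d (STv u \<xi>) Y = conn_of A U \<phi> \<Gamma> u (STv u \<xi>) Y" if Y: "Y \<in> sections A" for \<xi> Y
  proof -
    define y where "y = rep Y"
    have y: "smooth_on cdom y" unfolding y_def by (rule section_smooth[OF Y])
    have yd: "(y has_derivative dird y ?z) (at ?z)" by (rule smooth_on_has_derivative[OF y z])
    \<comment> \<open>The functions below are global, and \<open>g Y\<close> is the combination of the frame sections \<open>F b\<close> with coefficients \<open>f b\<close>.\<close>
    define g where "g = (\<lambda>w :: 'a tpoint. if fst w \<in> U then s (fst w) * s (fst w) else 0)"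
    define f where "f b = (\<lambda>w :: 'a tpoint. if fst w \<in> U then s (fst w) * (coords \<phi> (Y w) \<bullet> b) else 0)" for b
    have gpt: "g (pt z) = \<sigma> z * \<sigma> z" if "z \<in> cdom" for z
      using \<sigma>pt[OF that] ssetD(1)[OF pt_in[OF that]] by (simp add: g_def)
    have fpt: "f b (pt z) = \<sigma> z * (y z \<bullet> b)" if "z \<in> cdom" for z b
      using \<sigma>pt[OF that] ssetD(1)[OF pt_in[OF that]] by (simp add: f_def y_def srep_pt)
    have g: "smooth_fun (slit_atlas A) g" unfolding g_def
      by (rule cutoff_fun[OF s(1)]) (rule smooth_on_transform[OF \<sigma> open_cdom \<sigma>pt])
    have f: "smooth_fun (slit_atlas A) (f b)" for b unfolding f_def
    proof (rule cutoff_fun[OF s(1)])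
      have "smooth_on cdom (\<lambda>z. y z \<bullet> b)" by (intro smooth_on_inner open_cdom y smooth_on_const)
      then show "smooth_on cdom (\<lambda>z. coords \<phi> (Y (pt z)) \<bullet> b)" by (simp add: y_def srep_pt)
    qed
    have gsm: "smooth_on cdom (\<lambda>z. g (pt z))"
      by (rule smooth_on_transform[OF smooth_on_mult[OF open_cdom \<sigma> \<sigma>] open_cdom gpt])
    have fsm: "smooth_on cdom (\<lambda>z. f b (pt z))" for b
      by (rule smooth_on_transform[OF smooth_on_mult[OF open_cdom \<sigma> smooth_on_inner[OF open_cdom y smooth_on_const]]
            open_cdom fpt])
    have Xg: "STv u \<xi> g = S * ds \<xi> + S * ds \<xi>"
    proof -
      have "STv u \<xi> g = dird (\<lambda>z. g (pt z)) ?z \<xi>" by (rule STv_apply[OF gsm u])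
      also have "\<dots> = dird (\<lambda>z. \<sigma> z * \<sigma> z) ?z \<xi>" by (rule dird_cong_open[OF open_cdom z gpt])
      also have "\<dots> = \<sigma> ?z * ds \<xi> + ds \<xi> * \<sigma> ?z" by (rule dird_eqI[OF has_derivative_mult[OF ds(2) ds(2)]])
      finally show ?thesis by (simp add: \<sigma>z)
    qed
    have Xf: "STv u \<xi> (f b) = S * (dird y ?z \<xi> \<bullet> b) + ds \<xi> * (y ?z \<bullet> b)" for b
    proof -
      have "STv u \<xi> (f b) = dird (\<lambda>z. f b (pt z)) ?z \<xi>" by (rule STv_apply[OF fsm u])
      also have "\<dots> = dird (\<lambda>z. \<sigma> z * (y z \<bullet> b)) ?z \<xi>" by (rule dird_cong_open[OF open_cdom z fpt])
      also have "\<dots> = \<sigma> ?z * (dird y ?z \<xi> \<bullet> b) + ds \<xi> * (y ?z \<bullet> b)"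
        by (rule dird_eqI[OF has_derivative_mult[OF ds(2) has_derivative_inner_left[OF yd]]])
      finally show ?thesis by (simp add: \<sigma>z)
    qed
    have gu: "g u = S * S" and fu: "f b u = S * (y ?z \<bullet> b)" for b
      using p u by (simp_all add: g_def f_def S_def y_def srep_tmap)
    have Fu: "coords \<phi> (F e u) = S *\<^sub>R e" for e
      using us p by (simp add: F_def coords_scale S_def)
    have eq: "(\<lambda>w\<in>slit A. g w *\<^sub>T Y w) = (\<lambda>w\<in>slit A. \<Sum>b\<in>Basis. f b w *\<^sub>T F b w)"
    proof (rule restrict_ext)
      fix w assume w: "w \<in> slit A"
      show "g w *\<^sub>T Y w = (\<Sum>b\<in>Basis. f b w *\<^sub>T F b w)"
      proof (cases "fst w \<in> U")
        case True
        have Yw: "Y w \<in> fibre A w" using section_mem[OF Y w] .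
        have "f b w *\<^sub>T F b w = tv A U \<phi> (fst w) ((s (fst w) * s (fst w)) *\<^sub>R (coords \<phi> (Y w) \<bullet> b) *\<^sub>R b)" for b
          using True w by (simp add: f_def F_def tv_scale[symmetric] mult_ac)
        then have "(\<Sum>b\<in>Basis. f b w *\<^sub>T F b w) =
            (\<Sum>b\<in>Basis. tv A U \<phi> (fst w) ((s (fst w) * s (fst w)) *\<^sub>R (coords \<phi> (Y w) \<bullet> b) *\<^sub>R b))" by simp
        also have "\<dots> = tv A U \<phi> (fst w) (\<Sum>b\<in>Basis. (s (fst w) * s (fst w)) *\<^sub>R (coords \<phi> (Y w) \<bullet> b) *\<^sub>R b)"
          using sum_comp_morphism[of "tv A U \<phi> (fst w)" "\<lambda>b. (s (fst w) * s (fst w)) *\<^sub>R (coords \<phi> (Y w) \<bullet> b) *\<^sub>R b" Basis]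
            tv_zero[OF True] tv_add[OF True] by (simp add: comp_def)
        also have "\<dots> = g w *\<^sub>T Y w"
          using True Yw by (simp add: scaleR_sum_right[symmetric] euclidean_representation tv_scale g_def del: scaleR_scaleR)
        finally show ?thesis ..
      next
        case False
        then have "f b w *\<^sub>T F b w = 0" "g w *\<^sub>T Y w = 0" for b
          by (simp_all add: f_def g_def tscale_def zero_fun_def)
        then show ?thesis by (simp only: sum.neutral_const)
      qed
    qed
    have "(S * ds \<xi> + S * ds \<xi>) *\<^sub>R y ?z + (S * S) *\<^sub>R coords \<phi> (d (STv u \<xi>) Y)
        = coords \<phi> (d (STv u \<xi>) (\<lambda>w\<in>slit A. g w *\<^sub>T Y w))"
      unfolding connection_atD(4)[OF d STv_in[OF u] Y g]
      using u by (simp add: coords_add coords_scale Xg gu y_def srep_tmap)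
    also have "\<dots> = (\<Sum>b\<in>Basis. (S * (dird y ?z \<xi> \<bullet> b) + ds \<xi> * (y ?z \<bullet> b)) *\<^sub>R S *\<^sub>R b +
        (S * (y ?z \<bullet> b)) *\<^sub>R coords \<phi> (d (STv u \<xi>) (F b)))"
      unfolding eq section_sum(2)[OF atlas finite_Basis f F d STv_in[OF u]]
      by (simp add: coords_sum coords_add coords_scale Xf fu Fu)
    also have "\<dots> = (S * S) *\<^sub>R (\<Sum>b\<in>Basis. (dird y ?z \<xi> \<bullet> b) *\<^sub>R b) + (S * ds \<xi>) *\<^sub>R (\<Sum>b\<in>Basis. (y ?z \<bullet> b) *\<^sub>R b)
        + (\<Sum>b\<in>Basis. (S * (y ?z \<bullet> b)) *\<^sub>R coords \<phi> (d (STv u \<xi>) (F b)))"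
      by (simp add: scaleR_sum_right sum.distrib[symmetric] algebra_simps)
    also have "(\<Sum>b\<in>Basis. (S * (y ?z \<bullet> b)) *\<^sub>R coords \<phi> (d (STv u \<xi>) (F b))) =
        (S * S) *\<^sub>R \<Gamma> \<xi> (y ?z) + (S * ds \<xi>) *\<^sub>R (\<Sum>b\<in>Basis. (y ?z \<bullet> b) *\<^sub>R b)"
      unfolding \<Gamma>_def using S0
      by (simp add: scaleR_sum_right sum.distrib[symmetric] algebra_simps)
    finally have "(S * S) *\<^sub>R coords \<phi> (d (STv u \<xi>) Y) = (S * S) *\<^sub>R (dird y ?z \<xi> + \<Gamma> \<xi> (y ?z))"
      unfolding scaleR_add_left by (simp add: euclidean_representation scaleR_add_right add_ac)
    then have "coords \<phi> (d (STv u \<xi>) Y) = dird y ?z \<xi> + \<Gamma> \<xi> (y ?z)"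
      using S0 by (simp del: scaleR_add_right)
    moreover have "d (STv u \<xi>) Y \<in> fibre A u" using connection_atD(1)[OF d STv_in[OF u] Y] .
    ultimately have "d (STv u \<xi>) Y = tv A U \<phi> (fst u) (dird y ?z \<xi> + \<Gamma> \<xi> (y ?z))"
      using tv_coords[OF p] by metis
    then show ?thesis by (simp add: conn_of_STv[OF u Y] y_def)
  qed
  have "d = conn_of A U \<phi> \<Gamma> u"
  proof (rule PiE_ext)
    show d': "d \<in> (\<Pi>\<^sub>E X\<in>?T. sections A \<rightarrow>\<^sub>E fibre A u)" using d by (simp add: connection_at_def)
    show c': "conn_of A U \<phi> \<Gamma> u \<in> (\<Pi>\<^sub>E X\<in>?T. sections A \<rightarrow>\<^sub>E fibre A u)"
      using connection_at_conn_of[OF u bil] by (simp add: connection_at_def)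
    fix X assume X: "X \<in> ?T"
    show "d X = conn_of A U \<phi> \<Gamma> u X"
    proof (rule PiE_ext[OF PiE_mem[OF d' X] PiE_mem[OF c' X]])
      fix Y assume "Y \<in> sections A"
      then show "d X Y = conn_of A U \<phi> \<Gamma> u X Y" using main[of Y "scoords X"] STv_scoords[OF u X] by simp
    qed
  qed
  then show ?thesis using bil by blast
qed

end

section \<open>Torsions in coordinates\<close>

context manifold_chart
begin

lemma vertical_iff:
  assumes u: "u \<in> sset A U"
  shows "STv u \<xi> \<in> vertical_space A u \<longleftrightarrow> fst \<xi> = 0"
  using ssetD(1)[OF u] by (simp add: vertical_space_def STv_in[OF u] rho_STv[OF u] tv_eq_0_iff)

text \<open>The fundamental section has the fibre coordinate \<open>y\<close> as its components, and the derivative of \<open>y\<close> is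
  the fibre component of the direction.\<close>

lemma connection_map_coords:
  assumes u: "u \<in> sset A U" and D: "D u = conn_of A U \<phi> \<Gamma> u"
  shows "connection_map A D u (STv u \<xi>) = tv A U \<phi> (fst u) (snd \<xi> + \<Gamma> \<xi> (coords \<phi> (snd u)))"
proof -
  let ?\<eta> = "fundamental_section A" and ?z = "tmap \<phi> u"
  have "dird (rep ?\<eta>) ?z \<xi> = dird snd ?z \<xi>"
    by (rule dird_cong_open[OF open_cdom tmap_in[OF u] srep_fundamental])
  also have "\<dots> = snd \<xi>"
    by (rule dird_eqI) (rule bounded_linear_imp_has_derivative[OF bounded_linear_snd])
  finally show ?thesis
    unfolding connection_map_def D conn_of_STv[OF u fundamental_in_sections[OF atlas]] srep_fundamental[OF tmap_in[OF u]]
    by (simp add: fst_tmap)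
qed

lemma horizontal_iff:
  assumes u: "u \<in> sset A U" and D: "D u = conn_of A U \<phi> \<Gamma> u"
  shows "STv u \<xi> \<in> horizontal_space A D u \<longleftrightarrow> snd \<xi> + \<Gamma> \<xi> (coords \<phi> (snd u)) = 0"
  using ssetD(1)[OF u]
  by (simp add: horizontal_space_def STv_in[OF u] connection_map_coords[of u D, OF assms] tv_eq_0_iff)

text \<open>If the vertical coefficients annihilate the fundamental section, the connection map is the
  identity on vertical vectors and the decomposition can be written down.\<close>

lemma splits_conn_of:
  assumes u: "u \<in> sset A U" and D: "D u = conn_of A U \<phi> \<Gamma> u" and \<Gamma>: "bilinear \<Gamma>"
    and vert: "\<And>b. \<Gamma> (0, b) (coords \<phi> (snd u)) = 0"
  shows "splits A D u"
  unfolding splits_def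
proof (intro conjI ballI)
  show "connection_at A u (D u)" unfolding D by (rule connection_at_conn_of[OF u \<Gamma>])
  define y where "y = coords \<phi> (snd u)"
  have \<Gamma>0: "\<Gamma> \<xi> y = \<Gamma> (fst \<xi>, 0) y" for \<xi>
    using bilinear_ladd[OF \<Gamma>, of "(fst \<xi>, 0)" "(0, snd \<xi>)" y] vert by (simp add: y_def)
  note hor = horizontal_iff[of u D, OF u D, folded y_def] and ver = vertical_iff[OF u]
  have sp: "tangent_space (slit_atlas A) u = range (STv u)" by (rule S.tangent_space_eq[OF u])
  fix X assume "X \<in> tangent_space (slit_atlas A) u"
  then obtain \<xi> where X: "X = STv u \<xi>" using sp by auto
  let ?V = "(0, snd \<xi> + \<Gamma> \<xi> y)" and ?H = "(fst \<xi>, - \<Gamma> \<xi> y)"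
  show "\<exists>!VH. VH \<in> vertical_space A u \<times> horizontal_space A D u \<and> X = fst VH + snd VH"
  proof (rule ex1I[of _ "(STv u ?V, STv u ?H)"])
    show "(STv u ?V, STv u ?H) \<in> vertical_space A u \<times> horizontal_space A D u \<and>
        X = fst (STv u ?V, STv u ?H) + snd (STv u ?V, STv u ?H)"
      using \<Gamma>0[of \<xi>] \<Gamma>0[of ?H] by (simp add: ver hor X S.tv_add[OF u, symmetric])
  next
    fix VH assume VH: "VH \<in> vertical_space A u \<times> horizontal_space A D u \<and> X = fst VH + snd VH"
    then have "fst VH \<in> tangent_space (slit_atlas A) u" "snd VH \<in> tangent_space (slit_atlas A) u"
      by (auto simp: vertical_space_def horizontal_space_def)
    then obtain v h where vh: "fst VH = STv u v" "snd VH = STv u h" using sp by auto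
    have v: "fst v = 0" and h: "snd h + \<Gamma> h y = 0" using VH vh ver hor by (auto simp: mem_Times_iff)
    have "STv u \<xi> = STv u (v + h)" using VH vh by (simp add: X S.tv_add[OF u])
    then have \<xi>: "\<xi> = v + h" by (simp add: S.tv_inject[OF u])
    then have "\<Gamma> \<xi> y = \<Gamma> h y" using \<Gamma>0[of \<xi>] \<Gamma>0[of h] v by simp
    then have e: "snd h = - \<Gamma> \<xi> y" using h by (simp add: eq_neg_iff_add_eq_0)
    have f: "fst \<xi> = fst h" "snd \<xi> = snd v + snd h" using \<xi> v by simp_all
    have "h = ?H" "v = ?V" using f e v by (simp_all add: prod_eq_iff)
    then show "VH = (STv u ?V, STv u ?H)" using vh by (simp add: prod_eq_iff[of VH])
  qed
qed

text \<open>The horizontal part of any lift of \<open>v\<close> is again a lift of \<open>v\<close>, so every vector of the fibre has a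
  horizontal lift.\<close>

lemma horizontal_map_chart:
  assumes D: "splits A D u" and u: "u \<in> sset A U" and v: "v \<in> fibre A u"
  shows "horizontal_map A D u v \<in> horizontal_space A D u" "rho A u (horizontal_map A D u v) = v"
proof -
  have p: "fst u \<in> U" using ssetD(1)[OF u] .
  obtain VH where VH: "VH \<in> vertical_space A u \<times> horizontal_space A D u"
    "STv u (coords \<phi> v, 0) = fst VH + snd VH"
    using D STv_in[OF u] unfolding splits_def by blast
  then have "fst VH \<in> tangent_space (slit_atlas A) u" "snd VH \<in> tangent_space (slit_atlas A) u"
    by (auto simp: vertical_space_def horizontal_space_def)
  then obtain a h where ah: "fst VH = STv u a" "snd VH = STv u h"
    using S.tangent_space_eq[OF u] by auto
  have "fst a = 0" using VH(1) ah vertical_iff[OF u] by (auto simp: mem_Times_iff)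
  moreover have "(coords \<phi> v, 0) = a + h"
    using VH(2) ah by (simp add: S.tv_add[OF u, symmetric] S.tv_inject[OF u])
  ultimately have "fst h = coords \<phi> v" by (metis add_0 fst_add fst_conv)
  then have "rho A u (snd VH) = v" using ah p v by (simp add: rho_STv[OF u])
  then have "v \<in> rho A u ` horizontal_space A D u" using VH(1) by (auto simp: mem_Times_iff)
  then show "horizontal_map A D u v \<in> horizontal_space A D u" "rho A u (horizontal_map A D u v) = v"
    unfolding horizontal_map_def by (rule inv_into_into, rule f_inv_into_f)
qed

end

lemma manifold_chartI:
  assumes "smooth_manifold A" "u \<in> slit A"
  obtains U \<phi> where "manifold_chart A U \<phi>" "u \<in> sset A U"
proof -
  obtain U \<phi> where U: "(U, \<phi>) \<in> A" "fst u \<in> U" using assms(2) by (auto simp: slit_eq elim: carrierE)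
  have "slit_chart A U \<phi>" using assms(1) slit_chartI[OF _ U(1)] by (simp add: smooth_manifold_def)
  moreover from this have "u \<in> sset A U" using slit_chart.sset_iff U(2) assms(2) by blast
  ultimately show ?thesis
    using assms(1) that unfolding manifold_chart_def manifold_chart_axioms_def smooth_manifold_def by blast
qed

lemma horizontal_map:
  assumes "smooth_manifold A" "splits A D u" "u \<in> slit A" "v \<in> fibre A u"
  shows "horizontal_map A D u v \<in> horizontal_space A D u" "rho A u (horizontal_map A D u v) = v"
proof -
  obtain U \<phi> where "manifold_chart A U \<phi>" "u \<in> sset A U" using manifold_chartI[OF assms(1,3)] .
  then show "horizontal_map A D u v \<in> horizontal_space A D u" "rho A u (horizontal_map A D u v) = v"
    using manifold_chart.horizontal_map_chart assms(2,4) by blast+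
qed

context manifold_chart
begin

text \<open>Here \<open>\<beta> v\<close> is the fibre component of the horizontal lift of the vector with components \<open>v\<close>.\<close>

context
  fixes D :: "'a connection" and u \<Gamma> \<beta>
  assumes M: "smooth_manifold A" and splits_all: "\<forall>w\<in>slit A. splits A D w"
    and u: "u \<in> sset A U" and D: "D u = conn_of A U \<phi> \<Gamma> u" and \<Gamma>: "bilinear \<Gamma>"
  defines "\<beta> \<equiv> \<lambda>v. snd (scoords (horizontal_map A D u (tv A U \<phi> (fst u) v)))"
begin

lemmas splits_at = bspec[OF splits_all]

lemma horizontal_map_coords:
  "horizontal_map A D u (tv A U \<phi> (fst u) v) = STv u (v, \<beta> v)"
  "\<beta> v + \<Gamma> (v, \<beta> v) (coords \<phi> (snd u)) = 0"
proof -
  have p: "fst u \<in> U" and us: "u \<in> slit A" using ssetD[OF u] by auto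
  let ?X = "horizontal_map A D u (tv A U \<phi> (fst u) v)"
  have h: "?X \<in> horizontal_space A D u" "rho A u ?X = tv A U \<phi> (fst u) v"
    using horizontal_map[OF M splits_at[OF us] us, of "tv A U \<phi> (fst u) v"] p by auto
  then have "?X \<in> tangent_space (slit_atlas A) u" by (simp add: horizontal_space_def)
  then have X: "?X = STv u (scoords ?X)" using STv_scoords[OF u] by simp
  then have "tv A U \<phi> (fst u) (fst (scoords ?X)) = tv A U \<phi> (fst u) v"
    using h(2) rho_STv[OF u] by metis
  then have "scoords ?X = (v, \<beta> v)" using tv_inject[OF p] by (simp add: \<beta>_def prod_eq_iff)
  then show 1: "?X = STv u (v, \<beta> v)" using X by simp
  then show "\<beta> v + \<Gamma> (v, \<beta> v) (coords \<phi> (snd u)) = 0"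
    using h(1) horizontal_iff[of u D, OF u D] by simp
qed

lemma rho_beta_section:
  assumes Y: "Y \<in> sections A" and w: "w \<in> slit A"
  shows "rho A w (beta_section A D Y w) = Y w"
  using w by (simp add: beta_section_def horizontal_map(2)[OF M splits_at[OF w] w section_mem[OF Y w]])

lemma rho_field_beta:
  assumes Y: "Y \<in> sections A"
  shows "rho_field A (beta_section A D Y) = Y"
proof -
  have "rho_field A (beta_section A D Y) = restrict Y (slit A)"
    unfolding rho_field_def by (rule restrict_ext) (rule rho_beta_section[OF Y])
  also have "\<dots> = Y" by (rule section_ext[OF Y, symmetric])
  finally show ?thesis .
qed

lemma rho_gamma_section:
  assumes Y: "Y \<in> sections A" and w: "w \<in> slit A"
  shows "rho A w (gamma_section A Y w) = 0"
proof -
  obtain V \<psi> where V: "manifold_chart A V \<psi>" "w \<in> sset A V" using manifold_chartI[OF M w] .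
  then interpret V: manifold_chart A V \<psi> by blast
  have "Y w = tv A V \<psi> (fst w) (coords \<psi> (Y w))"
    using V.section_fibre[OF Y V(2)] V.ssetD(1)[OF V(2)] by simp
  then have "gamma A w (Y w) = V.STv w (0, coords \<psi> (Y w))" using V.gamma_tv[OF V(2)] by metis
  then show ?thesis
    using w V.rho_STv[OF V(2)] V.tv_zero[OF V.ssetD(1)[OF V(2)]] by (simp add: gamma_section_def)
qed

lemma rho_field_gamma: "Y \<in> sections A \<Longrightarrow> rho_field A (gamma_section A Y) = (\<lambda>w\<in>slit A. 0)"
  unfolding rho_field_def using rho_gamma_section by (intro restrict_ext) blast

lemma beta_section_coords:
  "Y \<in> sections A \<Longrightarrow> beta_section A D Y u = STv u (rep Y (tmap \<phi> u), \<beta> (rep Y (tmap \<phi> u)))"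
  using horizontal_map_coords(1)[of "rep Y (tmap \<phi> u)"] section_tv[OF _ u, of Y] ssetD(3)[OF u]
  unfolding beta_section_def by (simp only: restrict_apply')

lemma gamma_section_coords:
  "Y \<in> sections A \<Longrightarrow> gamma_section A Y u = STv u (0, rep Y (tmap \<phi> u))"
  using gamma_tv[OF u, of "rep Y (tmap \<phi> u)"] section_tv[OF _ u, of Y] ssetD(3)[OF u]
  unfolding gamma_section_def by (simp only: restrict_apply')

text \<open>The derivatives of the components of \<open>X\<close> and \<open>Y\<close> cancel against the projected bracket, leaving only
  connection coefficients. The same happens for the mixed torsion.\<close>

lemma horizontal_torsion_coords:
  assumes X: "X \<in> sections A" and Y: "Y \<in> sections A"
  shows "horizontal_torsion A D X Y u = tv A U \<phi> (fst u)
    (\<Gamma> (rep X (tmap \<phi> u), \<beta> (rep X (tmap \<phi> u))) (rep Y (tmap \<phi> u)) -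
     \<Gamma> (rep Y (tmap \<phi> u), \<beta> (rep Y (tmap \<phi> u))) (rep X (tmap \<phi> u)))"
  unfolding horizontal_torsion_def torsion_def rho_field_beta[OF X] rho_field_beta[OF Y]
  using ssetD(3)[OF u] ssetD(1)[OF u]
    rho_lie_bracket[OF beta_section_coords[OF X] rho_beta_section[OF X] X
      beta_section_coords[OF Y] rho_beta_section[OF Y] Y u]
  by (simp add: D beta_section_coords X Y conn_of_STv[OF u] tv_diff[symmetric])

lemma mixed_torsion_coords:
  assumes X: "X \<in> sections A" and Y: "Y \<in> sections A"
  shows "mixed_torsion A D X Y u =
    tv A U \<phi> (fst u) (\<Gamma> (0, rep X (tmap \<phi> u)) (rep Y (tmap \<phi> u)))"
proof -
  let ?x = "rep X (tmap \<phi> u)" and ?y = "rep Y (tmap \<phi> u)"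
  let ?O = "\<lambda>w\<in>slit A. (0 :: 'a tvec)"
  have p: "fst u \<in> U" and us: "u \<in> slit A" using ssetD[OF u] by auto
  have O: "?O \<in> sections A" by (rule zero_section[OF atlas])
  have "dird (rep ?O) (tmap \<phi> u) \<xi> = dird (\<lambda>_. 0) (tmap \<phi> u) \<xi>" for \<xi>
  proof (rule dird_cong_open[OF open_cdom tmap_in[OF u]])
    fix z assume "z \<in> cdom"
    then show "rep ?O z = 0"
      using ssetD(3)[OF pt_in] by (simp only: srep_pt restrict_apply' coords_0)
  qed
  then have dO: "dird (rep ?O) (tmap \<phi> u) \<xi> = 0" for \<xi> by simp
  have g0: "rho A w (gamma_section A X w) = ?O w" if "w \<in> slit A" for w
    using rho_gamma_section[OF X that] that by simp
  have "rho A u (lie_bracket (slit_atlas A) (gamma_section A X) (beta_section A D Y) u) =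
      tv A U \<phi> (fst u) (dird (rep Y) (tmap \<phi> u) (0, ?x) - dird (rep ?O) (tmap \<phi> u) (?y, \<beta> ?y))"
    by (rule rho_lie_bracket[OF gamma_section_coords[OF X] g0 O beta_section_coords[OF Y] rho_beta_section[OF Y] Y u])
  also have "\<dots> = tv A U \<phi> (fst u) (dird (rep Y) (tmap \<phi> u) (0, ?x))" by (simp add: dO)
  finally have br: "rho A u (lie_bracket (slit_atlas A) (gamma_section A X) (beta_section A D Y) u) =
      tv A U \<phi> (fst u) (dird (rep Y) (tmap \<phi> u) (0, ?x))" .
  have "beta_section A D Y u \<in> tangent_space (slit_atlas A) u"
    unfolding beta_section_coords[OF Y] by (rule STv_in[OF u])
  then have z: "D u (beta_section A D Y u) ?O = 0"
    using connection_at_zero[OF atlas] splits_at[OF us] unfolding splits_def by blast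
  have "mixed_torsion A D X Y u = D u (gamma_section A X u) Y - D u (beta_section A D Y u) ?O -
      tv A U \<phi> (fst u) (dird (rep Y) (tmap \<phi> u) (0, ?x))"
    unfolding mixed_torsion_def torsion_def rho_field_beta[OF Y] rho_field_gamma[OF X]
    using us by (simp only: restrict_apply' br)
  also have "\<dots> = tv A U \<phi> (fst u) (\<Gamma> (0, ?x) ?y)"
    unfolding z unfolding D gamma_section_coords[OF X] conn_of_STv[OF u Y] tv_add[OF p] by (simp only: diff_zero add_diff_cancel_left')
  finally show ?thesis .
qed

end

end

section \<open>The Finsler metric in coordinates\<close>

lemma linear_dird_family:
  assumes S: "open S" "z \<in> S" and T: "\<And>z. z \<in> S \<Longrightarrow> linear (T z)" "\<And>e. smooth_on S (\<lambda>z. T z e)"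
  shows "linear (\<lambda>e. dird (\<lambda>z. T z e) z \<xi>)"
proof (rule linearI)
  fix e e'
  have "dird (\<lambda>z. T z (e + e')) z \<xi> = dird (\<lambda>z. T z e + T z e') z \<xi>"
    by (rule dird_cong_open[OF S]) (simp add: linear_add[OF T(1)])
  also have "\<dots> = dird (\<lambda>z. T z e) z \<xi> + dird (\<lambda>z. T z e') z \<xi>"
    by (rule dird_eqI) (intro has_derivative_add smooth_on_has_derivative[OF T(2) S(2)])
  finally show "dird (\<lambda>z. T z (e + e')) z \<xi> = dird (\<lambda>z. T z e) z \<xi> + dird (\<lambda>z. T z e') z \<xi>" .
next
  fix c e
  have "dird (\<lambda>z. T z (c *\<^sub>R e)) z \<xi> = dird (\<lambda>z. c *\<^sub>R T z e) z \<xi>"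
    by (rule dird_cong_open[OF S]) (simp add: linear_cmul[OF T(1)])
  also have "\<dots> = c *\<^sub>R dird (\<lambda>z. T z e) z \<xi>"
    by (rule dird_eqI) (intro has_derivative_scaleR_right smooth_on_has_derivative[OF T(2) S(2)])
  finally show "dird (\<lambda>z. T z (c *\<^sub>R e)) z \<xi> = c *\<^sub>R dird (\<lambda>z. T z e) z \<xi>" .
qed

locale finsler_chart = manifold_chart +
  fixes L :: "'a tpoint \<Rightarrow> real"
  assumes finsler: "finsler_manifold A L"
begin

definition En :: "'b \<times> 'b \<Rightarrow> real" where
  "En z = energy L (pt z)"

text \<open>The fibrewise Hessian of the energy in coordinates, and its first derivative in the direction \<open>\<xi>\<close>.\<close>

definition G :: "'b \<times> 'b \<Rightarrow> 'b \<Rightarrow> 'b \<Rightarrow> real" where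
  "G z v w = dird (\<lambda>z. dird En z (0, w)) z (0, v)"

definition dG :: "'b \<times> 'b \<Rightarrow> 'b \<times> 'b \<Rightarrow> 'b \<Rightarrow> 'b \<Rightarrow> real" where
  "dG z \<xi> v w = dird (\<lambda>z. G z v w) z \<xi>"

lemma En_smooth: "smooth_on cdom En"
proof -
  have "smooth_on cdom (\<lambda>z. L (pt z))"
    using finsler S.smooth_fun_chart_iff[of L] S.in_carrier
    by (simp add: finsler_manifold_def smooth_fun_def cdom_eq comp_def)
  then have "smooth_on cdom (\<lambda>z. L (pt z) * L (pt z) * (1 / 2))"
    by (intro smooth_on_mult open_cdom smooth_on_const)
  then show ?thesis
    by (rule smooth_on_transform[OF _ open_cdom]) (simp add: En_def energy_def power2_eq_square)
qed

lemma En1_smooth: "smooth_on cdom (\<lambda>z. dird En z (0, w))"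
  by (rule smooth_on_dird[OF En_smooth])

lemma G_smooth: "smooth_on cdom (\<lambda>z. G z v w)"
  unfolding G_def by (rule smooth_on_dird[OF En1_smooth])

lemma G_sym: "z \<in> cdom \<Longrightarrow> G z v w = G z w v"
  unfolding G_def by (rule second_dird_symmetric[OF En_smooth open_cdom])

lemma linear_Pair_0: "linear (\<lambda>b. (0 :: 'b, b :: 'b))"
  by (rule linearI) auto

lemma G_linear_left: "z \<in> cdom \<Longrightarrow> linear (\<lambda>v. G z v w)"
  using linear_compose[OF linear_Pair_0 smooth_on_linear_dird[OF En1_smooth]]
  by (simp add: G_def comp_def)

lemma G_linear_right:
  assumes "z \<in> cdom"
  shows "linear (\<lambda>w. G z v w)"
proof -
  have "(\<lambda>w. G z v w) = (\<lambda>w. G z w v)" by (rule ext) (rule G_sym[OF assms])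
  then show ?thesis using G_linear_left[OF assms] by simp
qed

lemma dG_linear_dir: "z \<in> cdom \<Longrightarrow> linear (\<lambda>\<xi>. dG z \<xi> v w)"
  unfolding dG_def by (rule smooth_on_linear_dird[OF G_smooth])

lemma dG_sym: "z \<in> cdom \<Longrightarrow> dG z \<xi> v w = dG z \<xi> w v"
  unfolding dG_def by (rule dird_cong_open[OF open_cdom _ G_sym])

lemma dG_linear: "z \<in> cdom \<Longrightarrow> linear (\<lambda>v. dG z \<xi> v w)"
  unfolding dG_def by (rule linear_dird_family[OF open_cdom _ G_linear_left G_smooth])

lemma dG_smooth: "smooth_on cdom (\<lambda>z. dG z \<xi> v w)"
  unfolding dG_def by (rule smooth_on_dird[OF G_smooth])

text \<open>A third derivative of the energy along the fibre.\<close>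

lemma dG_vertical_sym: "z \<in> cdom \<Longrightarrow> dG z (0, c) v w = dG z (0, v) c w"
  unfolding dG_def G_def by (rule second_dird_symmetric[OF En1_smooth open_cdom])

lemma energy_tv: "p \<in> U \<Longrightarrow> e \<noteq> 0 \<Longrightarrow> energy L (p, tv A U \<phi> p e) = En (\<phi> p, e)"
  unfolding En_def by (subst pt_eq) auto

text \<open>The function \<open>h\<close> may differ from the coordinate expression where the line leaves the slit bundle, for
  instance at the zero vector.\<close>

lemma deriv_line:
  assumes f: "smooth_on cdom f" and z: "z \<in> cdom"
    and h: "\<And>t. z + t *\<^sub>R (0, e) \<in> cdom \<Longrightarrow> h t = f (z + t *\<^sub>R (0, e))"
  shows "deriv h 0 = dird f z (0, e)"
proof -
  define W where "W = {t \<in> UNIV. z + t *\<^sub>R (0, e) \<in> cdom}"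
  have "smooth_on UNIV (\<lambda>t::real. z + t *\<^sub>R (0, e))"
    by (intro smooth_on_add smooth_on_const smooth_on_linear bounded_linear_scaleR_left) simp
  then have "open W" unfolding W_def by (intro open_vimage_smooth open_cdom open_UNIV)
  moreover have "0 \<in> W"
    unfolding W_def using z by (simp only: mem_Collect_eq UNIV_I simp_thms scaleR_zero_left add_0_right)
  ultimately have "\<forall>\<^sub>F t in nhds 0. t \<in> W" by (rule eventually_nhds_in_open)
  then have ev: "\<forall>\<^sub>F t in nhds 0. h t = f (z + t *\<^sub>R (0, e))"
    by eventually_elim (simp add: W_def h)
  have "((\<lambda>t. f (z + t *\<^sub>R (0, e))) has_real_derivative dird f (z + 0 *\<^sub>R (0, e)) (0, e)) (at 0)"
    by (rule DERIV_along_line[OF f]) (use z in \<open>simp only: scaleR_zero_left add_0_right\<close>)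
  then have "(h has_real_derivative dird f (z + 0 *\<^sub>R (0, e)) (0, e)) (at 0)"
    by (rule iffD2[OF DERIV_cong_ev[OF refl ev refl]])
  from DERIV_imp_deriv[OF this] show ?thesis by (simp only: scaleR_zero_left add_0_right)
qed

lemma finsler_metric_coords:
  assumes u: "u \<in> sset A U"
  shows "finsler_metric L u (tv A U \<phi> (fst u) v) (tv A U \<phi> (fst u) w) = G (tmap \<phi> u) v w"
proof -
  let ?p = "fst u" and ?y = "coords \<phi> (snd u)" and ?z = "tmap \<phi> u"
  have p: "?p \<in> U" using ssetD(1)[OF u] .
  have z: "?z = (\<phi> ?p, ?y)" by (simp add: prod_eq_iff fst_tmap)
  have y: "snd u = tv A U \<phi> ?p ?y" using p ssetD(2)[OF u] by simp
  have pt: "(?p, snd u + s *\<^sub>T tv A U \<phi> ?p v + t *\<^sub>T tv A U \<phi> ?p w) = (?p, tv A U \<phi> ?p (?y + s *\<^sub>R v + t *\<^sub>R w))" for s t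
    using p by (subst y) (simp add: tv_add tv_scale)
  have inner: "deriv (\<lambda>t. energy L (?p, snd u + s *\<^sub>T tv A U \<phi> ?p v + t *\<^sub>T tv A U \<phi> ?p w)) 0 =
      dird En (?z + s *\<^sub>R (0, v)) (0, w)" if s: "?z + s *\<^sub>R (0, v) \<in> cdom" for s
  proof (rule deriv_line[OF En_smooth s])
    fix t assume "?z + s *\<^sub>R (0, v) + t *\<^sub>R (0, w) \<in> cdom"
    then have "?y + s *\<^sub>R v + t *\<^sub>R w \<noteq> 0" by (simp add: z)
    then show "energy L (?p, snd u + s *\<^sub>T tv A U \<phi> ?p v + t *\<^sub>T tv A U \<phi> ?p w) =
        En (?z + s *\<^sub>R (0, v) + t *\<^sub>R (0, w))"
      unfolding pt using p by (simp add: energy_tv z)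
  qed
  show ?thesis unfolding finsler_metric_def G_def
    by (rule deriv_line[OF En1_smooth tmap_in[OF u]]) (rule inner)
qed

lemma G_inner_form:
  assumes z: "z \<in> cdom"
  shows "inner_form (G z)"
  unfolding inner_form_def bilinear_def
proof (intro conjI allI impI)
  fix v :: 'b assume v: "v \<noteq> 0"
  let ?u = "pt z"
  have u: "?u \<in> sset A U" using pt_in[OF z] .
  have "tv A U \<phi> (fst ?u) v \<noteq> 0" "tv A U \<phi> (fst ?u) v \<in> fibre A ?u"
    using v ssetD(1)[OF u] by (simp_all add: tv_eq_0_iff)
  then have "finsler_metric L ?u (tv A U \<phi> (fst ?u) v) (tv A U \<phi> (fst ?u) v) > 0"
    using finsler ssetD(3)[OF u] unfolding finsler_manifold_def by blast
  then show "G z v v > 0" unfolding finsler_metric_coords[OF u] tmap_pt[OF z] .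
qed (use z G_sym G_linear_left G_linear_right in auto)

text \<open>Differentiation along the fibre lowers the degree of homogeneity by one.\<close>

lemma vertical_scaling:
  assumes f: "smooth_on cdom f" and t: "t > 0" and z: "z \<in> cdom"
    and hom: "\<And>z. z \<in> cdom \<Longrightarrow> f (fst z, t *\<^sub>R snd z) = c * f z"
  shows "t * dird f (fst z, t *\<^sub>R snd z) (0, w) = c * (dird f z (0, w) :: real)"
proof -
  have bl: "bounded_linear (\<lambda>z :: 'b \<times> 'b. (fst z, t *\<^sub>R snd z))"
    by (intro bounded_linear_Pair bounded_linear_fst bounded_linear_scaleR_right
        bounded_linear_compose[OF bounded_linear_scaleR_right] bounded_linear_snd)
  have hz: "(fst z, t *\<^sub>R snd z) \<in> cdom" using z t by auto
  have "((\<lambda>z. f (fst z, t *\<^sub>R snd z)) has_derivative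
      (\<lambda>\<xi>. dird f (fst z, t *\<^sub>R snd z) (fst \<xi>, t *\<^sub>R snd \<xi>))) (at z)"
    by (rule has_derivative_compose[OF bounded_linear_imp_has_derivative[OF bl] smooth_on_has_derivative[OF f hz]])
  from dird_eqI[OF this, of "(0, w)"]
  have "dird (\<lambda>z. f (fst z, t *\<^sub>R snd z)) z (0, w) = dird f (fst z, t *\<^sub>R snd z) (0, t *\<^sub>R w)" by simp
  also have "\<dots> = dird f (fst z, t *\<^sub>R snd z) (t *\<^sub>R (0, w))" by simp
  also have "\<dots> = t * dird f (fst z, t *\<^sub>R snd z) (0, w)"
    unfolding linear_cmul[OF smooth_on_linear_dird[OF f hz]] by simp
  also have "dird (\<lambda>z. f (fst z, t *\<^sub>R snd z)) z (0, w) = dird (\<lambda>z. c * f z) z (0, w)"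
    by (rule dird_cong_open[OF open_cdom z hom])
  also have "\<dots> = c * dird f z (0, w)"
    by (rule dird_eqI[OF has_derivative_mult_right[OF smooth_on_has_derivative[OF f z]]])
  finally show ?thesis ..
qed

lemma En_homogeneous:
  assumes t: "t > 0" and z: "z \<in> cdom"
  shows "En (fst z, t *\<^sub>R snd z) = t\<^sup>2 * En z"
proof -
  let ?p = "\<phi>inv (fst z)"
  have p: "?p \<in> U" "\<phi> ?p = fst z" using z by auto
  have "L (?p, t *\<^sub>T tv A U \<phi> ?p (snd z)) = t * L (?p, tv A U \<phi> ?p (snd z))"
  proof -
    have "\<forall>p\<in>carrier A. \<forall>v\<in>tangent_space A p. \<forall>t>0. L (p, t *\<^sub>T v) = t * L (p, v)"
      using finsler unfolding finsler_manifold_def by (elim conjE)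
    then show ?thesis using t in_carrier[OF p(1)] tv_in[OF p(1)] by simp
  qed
  then have "energy L (?p, tv A U \<phi> ?p (t *\<^sub>R snd z)) = t\<^sup>2 * energy L (?p, tv A U \<phi> ?p (snd z))"
    using p by (simp add: energy_def tv_scale power_mult_distrib)
  then show ?thesis using energy_tv[OF p(1)] t z p(2) by (auto simp: mem_Times_iff)
qed

lemma G_homogeneous:
  assumes t: "t > 0" and z: "z \<in> cdom"
  shows "G (fst z, t *\<^sub>R snd z) v w = G z v w"
proof -
  have 1: "dird En (fst z, t *\<^sub>R snd z) (0, w) = t * dird En z (0, w)" if "z \<in> cdom" for z
  proof -
    have "t * dird En (fst z, t *\<^sub>R snd z) (0, w) = t\<^sup>2 * dird En z (0, w)"
      by (rule vertical_scaling[OF En_smooth t that]) (rule En_homogeneous[OF t])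
    then show ?thesis using t by (simp add: power2_eq_square)
  qed
  have "t * dird (\<lambda>z. dird En z (0, w)) (fst z, t *\<^sub>R snd z) (0, v) = t * dird (\<lambda>z. dird En z (0, w)) z (0, v)"
    by (rule vertical_scaling[OF En1_smooth t z]) (rule 1)
  then show ?thesis using t by (simp add: G_def)
qed

text \<open>The metric is homogeneous of degree \<open>0\<close> on the fibres, hence Euler's relation.\<close>

lemma dG_radial:
  assumes z: "z \<in> cdom"
  shows "dG z (0, snd z) v w = 0"
proof -
  have ev: "\<forall>\<^sub>F t :: real in nhds 0. t \<in> {-1<..}" by (rule eventually_nhds_in_open) simp_all
  have ev2: "\<forall>\<^sub>F t in nhds 0. G (z + t *\<^sub>R (0, snd z)) v w = G z v w"
    using ev
  proof eventually_elim
    case (elim t)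
    have "z + t *\<^sub>R (0, snd z) = (fst z, (1 + t) *\<^sub>R snd z)" by (simp add: prod_eq_iff algebra_simps)
    then show ?case using G_homogeneous[of "1 + t" z] elim z by simp
  qed
  have 0: "((\<lambda>t. G (z + t *\<^sub>R (0, snd z)) v w) has_real_derivative 0) (at 0)"
    by (rule iffD2[OF DERIV_cong_ev[OF refl ev2 refl]]) simp
  have "((\<lambda>t. G (z + t *\<^sub>R (0, snd z)) v w) has_real_derivative
      dird (\<lambda>z. G z v w) (z + 0 *\<^sub>R (0, snd z)) (0, snd z)) (at 0)"
    by (rule DERIV_along_line[OF G_smooth]) (use z in \<open>simp only: scaleR_zero_left add_0_right\<close>)
  from DERIV_unique[OF this 0] show ?thesis unfolding dG_def by (simp only: scaleR_zero_left add_0_right)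
qed

text \<open>The derivatives of the components of \<open>Y\<close> and \<open>Z\<close> cancel, so that metricity is a condition on the
  coefficients alone.\<close>

lemma metric_derivative_coords:
  assumes u: "u \<in> sset A U" and D: "D u = conn_of A U \<phi> \<Gamma> u"
    and Y: "Y \<in> sections A" and Z: "Z \<in> sections A"
  defines "y \<equiv> rep Y (tmap \<phi> u)" and "z \<equiv> rep Z (tmap \<phi> u)"
  shows "STv u \<xi> (\<lambda>w. finsler_metric L w (Y w) (Z w)) - finsler_metric L u (D u (STv u \<xi>) Y) (Z u)
      - finsler_metric L u (Y u) (D u (STv u \<xi>) Z) =
    dG (tmap \<phi> u) \<xi> y z - G (tmap \<phi> u) (\<Gamma> \<xi> y) z - G (tmap \<phi> u) y (\<Gamma> \<xi> z)"
proof -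
  let ?x = "tmap \<phi> u" and ?Y = "rep Y" and ?Z = "rep Z"
  have x: "?x \<in> cdom" by (rule tmap_in[OF u])
  have Ysm: "smooth_on cdom ?Y" and Zsm: "smooth_on cdom ?Z" using section_smooth Y Z by auto
  note tvY = section_tv[OF Y] section_tv[OF Z]
  have eq: "finsler_metric L (pt x) (Y (pt x)) (Z (pt x)) = G x (?Y x) (?Z x)" if "x \<in> cdom" for x
    unfolding tvY[OF pt_in[OF that]] finsler_metric_coords[OF pt_in[OF that]] tmap_pt[OF that] ..
  have s1: "smooth_on cdom (\<lambda>x. G x e (?Z x))" for e
    by (rule smooth_on_linear_apply[OF open_cdom G_linear_right G_smooth Zsm])
  have s2: "smooth_on cdom (\<lambda>x. G x (?Y x) (?Z x))"
    by (rule smooth_on_linear_apply[OF open_cdom G_linear_left s1 Ysm])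
  have "STv u \<xi> (\<lambda>w. finsler_metric L w (Y w) (Z w)) =
      dird (\<lambda>x. finsler_metric L (pt x) (Y (pt x)) (Z (pt x))) ?x \<xi>"
    by (rule STv_apply[OF smooth_on_transform[OF s2 open_cdom eq] u])
  also have "\<dots> = dird (\<lambda>x. G x (?Y x) (?Z x)) ?x \<xi>" by (rule dird_cong_open[OF open_cdom x eq])
  also have "\<dots> = dird (\<lambda>x. G x y (?Z x)) ?x \<xi> + G ?x (dird ?Y ?x \<xi>) z"
    unfolding y_def z_def by (rule dird_linear_apply[OF open_cdom x G_linear_left s1 Ysm])
  also have "dird (\<lambda>x. G x y (?Z x)) ?x \<xi> = dG ?x \<xi> y z + G ?x y (dird ?Z ?x \<xi>)"
    unfolding dG_def z_def by (rule dird_linear_apply[OF open_cdom x G_linear_right G_smooth Zsm])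
  finally have X: "STv u \<xi> (\<lambda>w. finsler_metric L w (Y w) (Z w)) =
      dG ?x \<xi> y z + G ?x y (dird ?Z ?x \<xi>) + G ?x (dird ?Y ?x \<xi>) z" .
  show ?thesis
    unfolding X D conn_of_STv[OF u Y] conn_of_STv[OF u Z]
    using tvY[OF u] unfolding y_def z_def
    by (simp add: finsler_metric_coords[OF u] linear_add[OF G_linear_left[OF x]] linear_add[OF G_linear_right[OF x]])
qed

end

section \<open>The algebra of the Cartan coefficients\<close>

text \<open>The parameters stand for the values at a point of the metric \<open>g\<close>, its first derivative \<open>dg (a, b)\<close> in
  the direction with base component \<open>a\<close> and fibre component \<open>b\<close>, and the fibre coordinate \<open>y\<close>. The following
  are, in turn, the canonical spray, the canonical nonlinear connection, the derivative of the metric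
  along horizontal lifts, the Christoffel symbols formed with this derivative, and the Cartan tensor
  with an index raised.\<close>

definition spray_coef :: "('e::real_vector \<Rightarrow> 'e \<Rightarrow> real) \<Rightarrow> ('e \<times> 'e \<Rightarrow> 'e \<Rightarrow> 'e \<Rightarrow> real) \<Rightarrow> 'e \<Rightarrow> 'e" where
  "spray_coef g dg y = sharp g (\<lambda>w. dg (y, 0) y w - dg (w, 0) y y / 2)"

definition nonlinear_coef :: "('e::real_vector \<Rightarrow> 'e \<Rightarrow> real) \<Rightarrow> ('e \<times> 'e \<Rightarrow> 'e \<Rightarrow> 'e \<Rightarrow> real) \<Rightarrow> 'e \<Rightarrow> 'e \<Rightarrow> 'e" where
  "nonlinear_coef g dg y v = sharp g (\<lambda>w.
     (dg (v, 0) y w + dg (y, 0) v w - dg (w, 0) v y - dg (0, spray_coef g dg y) v w) / 2)"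

definition hderiv :: "('e::real_vector \<Rightarrow> 'e \<Rightarrow> real) \<Rightarrow> ('e \<times> 'e \<Rightarrow> 'e \<Rightarrow> 'e \<Rightarrow> real) \<Rightarrow> 'e \<Rightarrow> 'e \<Rightarrow> 'e \<Rightarrow> 'e \<Rightarrow> real" where
  "hderiv g dg y v = dg (v, - nonlinear_coef g dg y v)"

definition horizontal_coef :: "('e::real_vector \<Rightarrow> 'e \<Rightarrow> real) \<Rightarrow> ('e \<times> 'e \<Rightarrow> 'e \<Rightarrow> 'e \<Rightarrow> real) \<Rightarrow> 'e \<Rightarrow> 'e \<Rightarrow> 'e \<Rightarrow> 'e" where
  "horizontal_coef g dg y v w = sharp g (\<lambda>z. (hderiv g dg y v w z + hderiv g dg y w v z - hderiv g dg y z v w) / 2)"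

definition vertical_coef :: "('e::real_vector \<Rightarrow> 'e \<Rightarrow> real) \<Rightarrow> ('e \<times> 'e \<Rightarrow> 'e \<Rightarrow> 'e \<Rightarrow> real) \<Rightarrow> 'e \<Rightarrow> 'e \<Rightarrow> 'e" where
  "vertical_coef g dg b w = sharp g (\<lambda>z. dg (0, b) w z / 2)"

text \<open>A direction \<open>(a, b)\<close> is the sum of the horizontal lift \<open>(a, - N a)\<close> and the vertical vector
  \<open>(0, b + N a)\<close>.\<close>

definition cartan_coef :: "('e::real_vector \<Rightarrow> 'e \<Rightarrow> real) \<Rightarrow> ('e \<times> 'e \<Rightarrow> 'e \<Rightarrow> 'e \<Rightarrow> real) \<Rightarrow> 'e \<Rightarrow> 'e \<times> 'e \<Rightarrow> 'e \<Rightarrow> 'e" where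
  "cartan_coef g dg y \<xi> w = horizontal_coef g dg y (fst \<xi>) w +
     vertical_coef g dg (snd \<xi> + nonlinear_coef g dg y (fst \<xi>)) w"

lemma linear_half: "linear f \<Longrightarrow> linear (\<lambda>x. f x / (2::real))"
  by (auto simp: linear_iff add_divide_distrib)

lemma linear_sharp:
  fixes g :: "'e::euclidean_space \<Rightarrow> 'e \<Rightarrow> real"
  assumes g: "inner_form g" and H: "\<And>v. linear (H v)" "\<And>w. linear (\<lambda>v. H v w)"
  shows "linear (\<lambda>v. sharp g (H v))"
proof -
  have b: "bilinear g" using g by (simp add: inner_form_def)
  show ?thesis
    by (rule linearI; rule inner_form_cancel[OF g])
      (simp_all add: sharp_works[OF g H(1)] bilinear_ladd[OF b] bilinear_lmul[OF b] linear_add[OF H(2)] linear_cmul[OF H(2)])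
qed

text \<open>The assumption \<open>vert_sym\<close> holds because \<open>g\<close> is a Hessian along the fibre, and \<open>radial\<close> is Euler's relation
  for a metric of degree \<open>0\<close>.\<close>

locale cartan_data =
  fixes g :: "'e::euclidean_space \<Rightarrow> 'e \<Rightarrow> real" and dg :: "'e \<times> 'e \<Rightarrow> 'e \<Rightarrow> 'e \<Rightarrow> real" and y :: 'e
  assumes g: "inner_form g"
    and lin1: "linear (\<lambda>\<xi>. dg \<xi> v w)"
    and lin2: "linear (\<lambda>v. dg \<xi> v w)"
    and sym: "dg \<xi> v w = dg \<xi> w v"
    and vert_sym: "dg (0, c) v w = dg (0, v) c w"
    and radial: "dg (0, y) v w = 0"
begin

abbreviation "spray \<equiv> spray_coef g dg y"
abbreviation "N \<equiv> nonlinear_coef g dg y"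
abbreviation "\<delta> \<equiv> hderiv g dg y"
abbreviation "H \<equiv> horizontal_coef g dg y"
abbreviation "C \<equiv> vertical_coef g dg"

lemma bilin: "bilinear g" and gsym: "g v w = g w v"
  using g by (auto simp: inner_form_def)

lemma lin3: "linear (\<lambda>w. dg \<xi> v w)"
proof -
  have "(\<lambda>w. dg \<xi> v w) = (\<lambda>w. dg \<xi> w v)" by (rule ext) (rule sym)
  then show ?thesis using lin2 by simp
qed

lemma lin1_comp: "linear f \<Longrightarrow> linear (\<lambda>x. dg (f x) v w)"
  using linear_compose[OF _ lin1] by (simp add: comp_def)

lemma lin_fst: "linear (\<lambda>a :: 'e. (a, 0 :: 'e))" and lin_snd: "linear (\<lambda>b :: 'e. (0 :: 'e, b))"
  by (auto simp: linear_iff)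

lemmas lins = linear_half linear_compose_add linear_compose_sub lin2 lin3 lin1_comp[OF lin_fst] lin1_comp[OF lin_snd]

lemma vert_y: "dg (0, b) y w = 0" "dg (0, b) w y = 0"
  using vert_sym[of b y w] sym[of "(0, b)" w y] radial by simp_all

lemma dg_split: "dg (a, b) v w = dg (a, 0) v w + dg (0, b) v w"
  using linear_add[OF lin1, of "(a, 0)" "(0, b)"] by simp

lemma dg_neg: "dg (0, - b) v w = - dg (0, b) v w"
  using linear_neg[OF lin1, of "(0, b)" v w] by simp

lemma spray_works: "g spray w = dg (y, 0) y w - dg (w, 0) y y / 2"
  unfolding spray_coef_def by (rule sharp_works[OF g]) (intro lins)

lemma N_works: "2 * g (N v) w = dg (v, 0) y w + dg (y, 0) v w - dg (w, 0) v y - dg (0, spray) v w"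
proof -
  have "g (N v) w = (dg (v, 0) y w + dg (y, 0) v w - dg (w, 0) v y - dg (0, spray) v w) / 2"
    unfolding nonlinear_coef_def by (rule sharp_works[OF g]) (intro lins)
  then show ?thesis by simp
qed

lemma N_linear: "linear N"
  unfolding nonlinear_coef_def[abs_def] by (rule linear_sharp[OF g]) (intro lins)+

lemma lin_hor: "linear (\<lambda>v. (v, - N v))"
  using N_linear by (auto simp: linear_iff)

lemma \<delta>_linear: "linear (\<lambda>v. \<delta> v w z)" "linear (\<lambda>w. \<delta> v w z)" "linear (\<lambda>z. \<delta> v w z)"
  unfolding hderiv_def by (rule lin1_comp[OF lin_hor] lin2 lin3)+

lemma \<delta>_sym: "\<delta> v w z = \<delta> v z w"
  unfolding hderiv_def by (rule sym)

lemma H_works: "2 * g (H v w) z = \<delta> v w z + \<delta> w v z - \<delta> z v w"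
proof -
  have "g (H v w) z = (\<delta> v w z + \<delta> w v z - \<delta> z v w) / 2"
    unfolding horizontal_coef_def
    by (rule sharp_works[OF g]) (intro linear_half linear_compose_add linear_compose_sub \<delta>_linear)
  then show ?thesis by simp
qed

lemma H_sym: "H v w = H w v"
proof (rule inner_form_cancel[OF g])
  fix z show "g (H v w) z = g (H w v) z"
    using H_works[of v w z] H_works[of w v z] \<delta>_sym[of z v w] by simp
qed

lemma C_works: "2 * g (C b w) z = dg (0, b) w z"
proof -
  have "g (C b w) z = dg (0, b) w z / 2"
    unfolding vertical_coef_def by (rule sharp_works[OF g]) (intro lins)
  then show ?thesis by simp
qed

lemma H_linear: "linear (\<lambda>v. H v w)" "linear (\<lambda>w. H v w)"
proof -
  have lin: "linear (\<lambda>v. H v w)" for w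
    unfolding horizontal_coef_def
    by (rule linear_sharp[OF g]) (intro linear_half linear_compose_add linear_compose_sub \<delta>_linear)+
  then show "linear (\<lambda>v. H v w)" .
  have "(\<lambda>w. H v w) = (\<lambda>w. H w v)" by (rule ext) (rule H_sym)
  then show "linear (\<lambda>w. H v w)" using lin[of v] by simp
qed

lemma C_linear: "linear (\<lambda>b. C b w)" "linear (\<lambda>w. C b w)"
  unfolding vertical_coef_def by (rule linear_sharp[OF g]; intro lins)+

lemma cancel_half: "(\<And>w. 2 * g e w = 2 * g e' w) \<Longrightarrow> e = e'"
  by (rule inner_form_cancel[OF g]) simp

lemma g_0: "g 0 w = 0"
  by (rule bilinear_lzero[OF bilin])

lemma C_y: "C b y = 0"
  by (rule cancel_half) (simp only: C_works vert_y g_0 mult_zero_right)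

lemma N_y: "N y = spray"
  by (rule cancel_half) (simp add: N_works spray_works vert_y)

text \<open>The nonlinear connection from which the horizontal derivatives are formed is the one that the resulting
  coefficients induce. The terms with a vertical derivative drop out by \<open>vert_y\<close>, except for the one along
  the spray.\<close>

lemma H_y: "H v y = N v"
proof (rule cancel_half)
  fix w
  have "\<delta> v y w = dg (v, 0) y w" "\<delta> w v y = dg (w, 0) v y" for v w
    unfolding hderiv_def by (subst dg_split, simp add: vert_y)+
  moreover have "\<delta> y v w = dg (y, 0) v w - dg (0, spray) v w"
    unfolding hderiv_def N_y by (subst dg_split) (simp add: dg_neg)
  ultimately show "2 * g (H v y) w = 2 * g (N v) w" unfolding H_works N_works by simp
qed

abbreviation "\<Gamma> \<equiv> cartan_coef g dg y"

lemma cartan_bilinear: "bilinear \<Gamma>"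
  unfolding bilinear_def cartan_coef_def
proof (intro conjI allI)
  fix \<xi> :: "'e \<times> 'e" show "linear (\<lambda>w. H (fst \<xi>) w + C (snd \<xi> + N (fst \<xi>)) w)"
    by (intro linear_compose_add H_linear C_linear)
next
  fix w
  show "linear (\<lambda>\<xi>. H (fst \<xi>) w + C (snd \<xi> + N (fst \<xi>)) w)"
    by (rule linearI)
      (simp_all add: linear_add[OF H_linear(1)] linear_add[OF C_linear(1)] linear_add[OF N_linear]
        linear_cmul[OF H_linear(1)] linear_cmul[OF C_linear(1)] linear_cmul[OF N_linear] algebra_simps)
qed

lemma cartan_vertical: "\<Gamma> (0, b) w = C b w"
  by (simp add: cartan_coef_def linear_0[OF N_linear] linear_0[OF H_linear(1)])

lemma cartan_metric: "dg \<xi> v w = g (\<Gamma> \<xi> v) w + g v (\<Gamma> \<xi> w)"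
proof -
  obtain a b where \<xi>: "\<xi> = (a, b)" by (cases \<xi>)
  have "dg \<xi> v w = dg ((a, - N a) + (0, b + N a)) v w" by (simp add: \<xi>)
  also have "\<dots> = \<delta> a v w + dg (0, b + N a) v w" unfolding linear_add[OF lin1] hderiv_def ..
  also have "\<delta> a v w = g (H a v) w + g v (H a w)"
    using H_works[of a v w] H_works[of a w v] gsym[of v] \<delta>_sym[of a v w] \<delta>_sym[of v a w] \<delta>_sym[of w a v] by simp
  also have "dg (0, b + N a) v w = g (C (b + N a) v) w + g v (C (b + N a) w)"
    using C_works[of "b + N a" v w] C_works[of "b + N a" w v] gsym[of v] sym[of _ v w] by simp
  finally show ?thesis
    by (simp add: \<xi> cartan_coef_def bilinear_ladd[OF bilin] bilinear_radd[OF bilin])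
qed

lemma cartan_mixed: "g (\<Gamma> (0, b) v) w = g (\<Gamma> (0, b) w) v"
  using C_works[of b v w] C_works[of b w v] sym[of "(0, b)" v w] by (simp add: cartan_vertical)

text \<open>The equations for \<open>b\<close> and \<open>c\<close> say that \<open>(v, b)\<close> and \<open>(w, c)\<close> are horizontal.\<close>

lemma cartan_horizontal:
  assumes "b + \<Gamma> (v, b) y = 0" "c + \<Gamma> (w, c) y = 0"
  shows "\<Gamma> (v, b) w = \<Gamma> (w, c) v"
proof -
  have "b = - N v" "c = - N w"
    using assms by (simp_all add: cartan_coef_def C_y H_y eq_neg_iff_add_eq_0)
  then show ?thesis using H_sym[of v w] by (simp add: cartan_coef_def linear_0[OF C_linear(1)])
qed

text \<open>Metricity and the symmetry of the mixed torsion fix the vertical part, which annihilates \<open>y\<close>.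
  The Koszul formula expresses the horizontal part through the horizontal lift \<open>\<beta>\<close>, and evaluating it
  at \<open>y\<close>, first in direction \<open>y\<close> and then in every direction, determines \<open>\<beta>\<close> itself.\<close>

lemma cartan_unique:
  assumes G: "bilinear G"
    and M: "\<And>\<xi> v w. dg \<xi> v w = g (G \<xi> v) w + g v (G \<xi> w)"
    and T: "\<And>b v w. g (G (0, b) v) w = g (G (0, b) w) v"
    and \<beta>: "\<And>v. \<beta> v + G (v, \<beta> v) y = 0"
    and Q: "\<And>v w. G (v, \<beta> v) w = G (w, \<beta> w) v"
  shows "G = \<Gamma>"
proof -
  have vert: "G (0, b) v = C b v" for b v
  proof (rule cancel_half)
    fix w show "2 * g (G (0, b) v) w = 2 * g (C b v) w"
      using M[of "(0, b)" v w] T[of b v w] gsym[of v "G (0, b) w"] C_works[of b v w] by simp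
  qed
  define K where "K v w = G (v, \<beta> v) w" for v w
  define d where "d v = dg (v, \<beta> v)" for v
  have koszul: "2 * g (K v w) z = d v w z + d w v z - d z v w" for v w z
    using M[of "(v, \<beta> v)" w z] M[of "(w, \<beta> w)" v z] M[of "(z, \<beta> z)" v w]
      Q[of w v] Q[of z v] Q[of z w] gsym[of w "K v z"] gsym[of v "K w z"] gsym[of v "K z w"]
    by (simp add: K_def d_def gsym)
  have dy: "d v y z = dg (v, 0) y z" "d z v y = dg (z, 0) v y" for v z
    unfolding d_def by (subst dg_split, simp add: vert_y)+
  have Ky: "K v y = - \<beta> v" for v
    using \<beta>[of v] by (simp add: K_def eq_neg_iff_add_eq_0 add.commute)
  have \<beta>y: "\<beta> y = - spray"
  proof -
    have "- \<beta> y = spray"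
    proof (rule cancel_half)
      fix w show "2 * g (- \<beta> y) w = 2 * g spray w"
        using koszul[of y y w] by (simp add: Ky dy spray_works)
    qed
    then show ?thesis by (metis minus_minus)
  qed
  have \<beta>N: "\<beta> v = - N v" for v
  proof -
    have "- \<beta> v = N v"
    proof (rule cancel_half)
      fix w
      have "d y v w = dg (y, 0) v w - dg (0, spray) v w"
        unfolding d_def \<beta>y by (subst dg_split) (simp add: dg_neg)
      then show "2 * g (- \<beta> v) w = 2 * g (N v) w"
        using koszul[of v y w] by (simp add: Ky dy N_works)
    qed
    then show ?thesis by (metis minus_minus)
  qed
  have hor: "K v w = H v w" for v w
  proof (rule cancel_half)
    fix z show "2 * g (K v w) z = 2 * g (H v w) z"
      unfolding koszul H_works by (simp add: d_def hderiv_def \<beta>N)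
  qed
  show ?thesis
  proof (intro ext)
    fix \<xi> w
    have "G \<xi> w = G ((fst \<xi>, \<beta> (fst \<xi>)) + (0, snd \<xi> - \<beta> (fst \<xi>))) w" by simp
    also have "\<dots> = K (fst \<xi>) w + G (0, snd \<xi> - \<beta> (fst \<xi>)) w"
      unfolding bilinear_ladd[OF G] K_def ..
    finally show "G \<xi> w = \<Gamma> \<xi> w" by (simp add: hor vert \<beta>N cartan_coef_def)
  qed
qed

end

section \<open>The Cartan connection\<close>

text \<open>The conditions of the theorem at a single point, where they determine the connection.\<close>

definition cartan_conditions :: "('p, 'e::euclidean_space) atlas \<Rightarrow> ('p tpoint \<Rightarrow> real) \<Rightarrow> 'p connection \<Rightarrow> 'p tpoint \<Rightarrow> bool" where
  "cartan_conditions A L D u \<longleftrightarrow>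
     (\<forall>X\<in>tangent_space (slit_atlas A) u. \<forall>Y\<in>sections A. \<forall>Z\<in>sections A.
        X (\<lambda>w. finsler_metric L w (Y w) (Z w)) - finsler_metric L u (D u X Y) (Z u)
          - finsler_metric L u (Y u) (D u X Z) = 0) \<and>
     (\<forall>X\<in>sections A. \<forall>Y\<in>sections A. horizontal_torsion A D X Y u = 0) \<and>
     (\<forall>X\<in>sections A. \<forall>Y\<in>sections A. \<forall>Z\<in>sections A.
        finsler_metric L u (mixed_torsion A D X Y u) (Z u) = finsler_metric L u (mixed_torsion A D X Z u) (Y u))"

context finsler_chart
begin

lemma manifold: "smooth_manifold A"
  using finsler by (simp add: finsler_manifold_def)

lemma cartan_data: "z \<in> cdom \<Longrightarrow> cartan_data (G z) (dG z) (snd z)"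
  by (rule cartan_data.intro)
    (rule G_inner_form dG_linear_dir dG_linear dG_sym dG_vertical_sym dG_radial, assumption)+

definition chart_coef :: "'b \<times> 'b \<Rightarrow> 'b \<times> 'b \<Rightarrow> 'b \<Rightarrow> 'b" where
  "chart_coef z = cartan_coef (G z) (dG z) (snd z)"

lemma dG_smooth_args:
  assumes "smooth_on cdom a" "smooth_on cdom v" "smooth_on cdom w"
  shows "smooth_on cdom (\<lambda>z. dG z (a z) (v z) (w z))"
proof -
  have 1: "smooth_on cdom (\<lambda>z. dG z e f (w z))" for e f
    by (rule smooth_on_linear_apply[OF open_cdom cartan_data.lin3[OF cartan_data] dG_smooth assms(3)])
  have 2: "smooth_on cdom (\<lambda>z. dG z e (v z) (w z))" for e
    by (rule smooth_on_linear_apply[OF open_cdom dG_linear 1 assms(2)])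
  show ?thesis
    by (rule smooth_on_linear_apply[OF open_cdom dG_linear_dir 2 assms(1)])
qed

lemma smooth_sharp:
  assumes "\<And>z. z \<in> cdom \<Longrightarrow> linear (h z)" "\<And>w. smooth_on cdom (\<lambda>z. h z w)"
  shows "smooth_on cdom (\<lambda>z. sharp (G z) (h z))"
  by (rule smooth_on_sharp[OF open_cdom G_inner_form G_smooth assms])

lemma smooth_half: "smooth_on cdom (f :: _ \<Rightarrow> real) \<Longrightarrow> smooth_on cdom (\<lambda>z. f z / 2)"
  using smooth_on_mult[OF open_cdom _ smooth_on_const, of f "1 / 2"] by simp

lemma snd_smooth: "smooth_on cdom (\<lambda>z. snd z)"
  by (rule smooth_on_linear[OF bounded_linear_snd])

lemmas smooth_rules = smooth_half smooth_on_diff[OF open_cdom] smooth_on_add[OF open_cdom] dG_smooth_args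
  snd_smooth smooth_on_const smooth_on_Pair[OF open_cdom] smooth_on_minus[OF open_cdom]

lemma spray_smooth: "smooth_on cdom (\<lambda>z. spray_coef (G z) (dG z) (snd z))"
  unfolding spray_coef_def
proof (rule smooth_sharp)
  fix z assume "z \<in> cdom"
  then interpret cartan_data "G z" "dG z" "snd z" by (rule cartan_data)
  show "linear (\<lambda>w. dG z (snd z, 0) (snd z) w - dG z (w, 0) (snd z) (snd z) / 2)" by (intro lins)
qed (intro smooth_rules)

lemma nonlinear_smooth: "smooth_on cdom v \<Longrightarrow> smooth_on cdom (\<lambda>z. nonlinear_coef (G z) (dG z) (snd z) (v z))"
  unfolding nonlinear_coef_def
proof (rule smooth_sharp)
  fix z assume "z \<in> cdom"
  then interpret cartan_data "G z" "dG z" "snd z" by (rule cartan_data)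
  show "linear (\<lambda>w. (dG z (v z, 0) (snd z) w + dG z (snd z, 0) (v z) w - dG z (w, 0) (v z) (snd z) -
      dG z (0, spray) (v z) w) / 2)" by (intro lins)
qed (intro smooth_rules spray_smooth)

lemma hderiv_smooth:
  "smooth_on cdom v \<Longrightarrow> smooth_on cdom w \<Longrightarrow> smooth_on cdom x \<Longrightarrow>
    smooth_on cdom (\<lambda>z. hderiv (G z) (dG z) (snd z) (v z) (w z) (x z))"
  unfolding hderiv_def by (intro smooth_rules nonlinear_smooth)

lemma chart_coef_smooth:
  assumes \<xi>: "smooth_on cdom \<xi>" and w: "smooth_on cdom w"
  shows "smooth_on cdom (\<lambda>z. chart_coef z (\<xi> z) (w z))"
proof -
  have f: "smooth_on cdom (\<lambda>z. fst (\<xi> z))" and s: "smooth_on cdom (\<lambda>z. snd (\<xi> z))"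
    using smooth_on_fst smooth_on_snd \<xi> open_cdom by blast+
  have "smooth_on cdom (\<lambda>z. horizontal_coef (G z) (dG z) (snd z) (fst (\<xi> z)) (w z))"
    unfolding horizontal_coef_def
  proof (rule smooth_sharp)
    fix z assume "z \<in> cdom"
    then interpret cartan_data "G z" "dG z" "snd z" by (rule cartan_data)
    show "linear (\<lambda>x. (\<delta> (fst (\<xi> z)) (w z) x + \<delta> (w z) (fst (\<xi> z)) x - \<delta> x (fst (\<xi> z)) (w z)) / 2)"
      by (intro linear_half linear_compose_add linear_compose_sub \<delta>_linear)
  qed (intro smooth_rules hderiv_smooth f w)
  moreover have "smooth_on cdom (\<lambda>z. vertical_coef (G z) (dG z)
      (snd (\<xi> z) + nonlinear_coef (G z) (dG z) (snd z) (fst (\<xi> z))) (w z))"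
    unfolding vertical_coef_def
  proof (rule smooth_sharp)
    fix z assume "z \<in> cdom"
    then interpret cartan_data "G z" "dG z" "snd z" by (rule cartan_data)
    show "linear (\<lambda>x. dG z (0, snd (\<xi> z) + N (fst (\<xi> z))) (w z) x / 2)" by (intro lins)
  qed (intro smooth_rules nonlinear_smooth f s w)
  ultimately show ?thesis unfolding chart_coef_def cartan_coef_def by (intro smooth_rules)
qed

definition cartan_at :: "'a tpoint \<Rightarrow> 'a tpoint tvec \<Rightarrow> 'a bsection \<Rightarrow> 'a tvec" where
  "cartan_at u = conn_of A U \<phi> (chart_coef (tmap \<phi> u)) u"

lemma cartan_data_at:
  "u \<in> sset A U \<Longrightarrow> cartan_data (G (tmap \<phi> u)) (dG (tmap \<phi> u)) (coords \<phi> (snd u))"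
  using cartan_data[OF tmap_in[of u]] by (simp add: fst_tmap)

lemma chart_coef_at: "chart_coef (tmap \<phi> u) = cartan_coef (G (tmap \<phi> u)) (dG (tmap \<phi> u)) (coords \<phi> (snd u))"
  by (simp add: chart_coef_def fst_tmap)

lemma cartan_at_splits:
  assumes u: "u \<in> sset A U" and D: "D u = cartan_at u"
  shows "splits A D u"
proof (rule splits_conn_of[OF u])
  interpret cartan_data "G (tmap \<phi> u)" "dG (tmap \<phi> u)" "coords \<phi> (snd u)" by (rule cartan_data_at[OF u])
  show "D u = conn_of A U \<phi> (chart_coef (tmap \<phi> u)) u" using D by (simp add: cartan_at_def)
  show "bilinear (chart_coef (tmap \<phi> u))" unfolding chart_coef_at by (rule cartan_bilinear)
  show "chart_coef (tmap \<phi> u) (0, b) (coords \<phi> (snd u)) = 0" for b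
    unfolding chart_coef_at by (simp add: cartan_vertical C_y)
qed

lemma cartan_at_conditions:
  assumes u: "u \<in> sset A U" and splits: "\<forall>w\<in>slit A. splits A D w" and Du: "D u = cartan_at u"
  shows "cartan_conditions A L D u"
  unfolding cartan_conditions_def
proof (intro conjI ballI)
  interpret cartan_data "G (tmap \<phi> u)" "dG (tmap \<phi> u)" "coords \<phi> (snd u)" by (rule cartan_data_at[OF u])
  have D: "D u = conn_of A U \<phi> (chart_coef (tmap \<phi> u)) u" using Du by (simp add: cartan_at_def)
  have bil: "bilinear (chart_coef (tmap \<phi> u))" unfolding chart_coef_at by (rule cartan_bilinear)
  note T = manifold splits u D bil
  {
    fix X Y Z assume X: "X \<in> tangent_space (slit_atlas A) u" and Y: "Y \<in> sections A" and Z: "Z \<in> sections A"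
    obtain \<xi> where \<xi>: "X = STv u \<xi>" using X S.tangent_space_eq[OF u] by auto
    show "X (\<lambda>w. finsler_metric L w (Y w) (Z w)) - finsler_metric L u (D u X Y) (Z u)
        - finsler_metric L u (Y u) (D u X Z) = 0"
      unfolding \<xi> metric_derivative_coords[of u D, OF u D Y Z] chart_coef_at
      using cartan_metric[of \<xi> "rep Y (tmap \<phi> u)" "rep Z (tmap \<phi> u)"] by simp
  }
  {
    fix X Y assume X: "X \<in> sections A" and Y: "Y \<in> sections A"
    let ?\<beta> = "\<lambda>v. snd (scoords (horizontal_map A D u (tv A U \<phi> (fst u) v)))"
    have "?\<beta> v + chart_coef (tmap \<phi> u) (v, ?\<beta> v) (coords \<phi> (snd u)) = 0" for v
      by (rule horizontal_map_coords(2)[of D u, OF T])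
    from cartan_horizontal[OF this[unfolded chart_coef_at] this[unfolded chart_coef_at]]
    show "horizontal_torsion A D X Y u = 0"
      unfolding horizontal_torsion_coords[of D u, OF T X Y] chart_coef_at
      using ssetD(1)[OF u] by (simp add: tv_eq_0_iff)
  }
  {
    fix X Y Z assume X: "X \<in> sections A" and Y: "Y \<in> sections A" and Z: "Z \<in> sections A"
    show "finsler_metric L u (mixed_torsion A D X Y u) (Z u) = finsler_metric L u (mixed_torsion A D X Z u) (Y u)"
      unfolding mixed_torsion_coords[of D u, OF T X Y] mixed_torsion_coords[of D u, OF T X Z]
        section_tv[OF Y u] section_tv[OF Z u] finsler_metric_coords[OF u] chart_coef_at
      by (rule cartan_mixed)
  }
qed

text \<open>Every vector at the point is the value of a global section, so the conditions on sections give the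
  algebraic equations for all vectors.\<close>

lemma cartan_at_unique:
  assumes u: "u \<in> sset A U" and splits: "\<forall>w\<in>slit A. splits A D w" and cond: "cartan_conditions A L D u"
  shows "D u = cartan_at u"
proof -
  interpret cartan_data "G (tmap \<phi> u)" "dG (tmap \<phi> u)" "coords \<phi> (snd u)" by (rule cartan_data_at[OF u])
  let ?z = "tmap \<phi> u"
  have p: "fst u \<in> U" and us: "u \<in> slit A" using ssetD[OF u] by auto
  have "connection_at A u (D u)" using splits us by (simp add: splits_def)
  then obtain \<Gamma>' where \<Gamma>': "bilinear \<Gamma>'" and D: "D u = conn_of A U \<phi> \<Gamma>' u"
    using connection_at_coefficients[OF _ u] by blast
  note T = manifold splits u D \<Gamma>'
  let ?\<beta> = "\<lambda>v. snd (scoords (horizontal_map A D u (tv A U \<phi> (fst u) v)))"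
  have sec: "\<exists>Y\<in>sections A. rep Y ?z = e" for e by (rule ex_section[OF u])
  have "\<Gamma>' = cartan_coef (G ?z) (dG ?z) (coords \<phi> (snd u))"
  proof (rule cartan_unique[OF \<Gamma>', where \<beta> = ?\<beta>])
    fix \<xi> v w
    obtain Y Z where Y: "Y \<in> sections A" "rep Y ?z = v" and Z: "Z \<in> sections A" "rep Z ?z = w"
      using sec[of v] sec[of w] by blast
    have "STv u \<xi> (\<lambda>w. finsler_metric L w (Y w) (Z w)) - finsler_metric L u (D u (STv u \<xi>) Y) (Z u)
        - finsler_metric L u (Y u) (D u (STv u \<xi>) Z) = 0"
      using cond STv_in[OF u] Y(1) Z(1) unfolding cartan_conditions_def by simp
    then show "dG ?z \<xi> v w = G ?z (\<Gamma>' \<xi> v) w + G ?z v (\<Gamma>' \<xi> w)"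
      unfolding metric_derivative_coords[of u D, OF u D Y(1) Z(1)] Y(2) Z(2) by simp
  next
    fix b v w
    obtain X Y Z where X: "X \<in> sections A" "rep X ?z = b"
      and Y: "Y \<in> sections A" "rep Y ?z = v" and Z: "Z \<in> sections A" "rep Z ?z = w"
      using sec[of v] sec[of w] sec[of b] by blast
    have "finsler_metric L u (mixed_torsion A D X Y u) (Z u) = finsler_metric L u (mixed_torsion A D X Z u) (Y u)"
      using cond X(1) Y(1) Z(1) unfolding cartan_conditions_def by simp
    then show "G ?z (\<Gamma>' (0, b) v) w = G ?z (\<Gamma>' (0, b) w) v"
      unfolding mixed_torsion_coords[of D u, OF T X(1) Y(1)] mixed_torsion_coords[of D u, OF T X(1) Z(1)]
        section_tv[OF Y(1) u] section_tv[OF Z(1) u] finsler_metric_coords[OF u] X(2) Y(2) Z(2) .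
  next
    fix v show "?\<beta> v + \<Gamma>' (v, ?\<beta> v) (coords \<phi> (snd u)) = 0"
      by (rule horizontal_map_coords(2)[of D u, OF T])
  next
    fix v w
    obtain X Y where X: "X \<in> sections A" "rep X ?z = v" and Y: "Y \<in> sections A" "rep Y ?z = w"
      using sec[of v] sec[of w] by blast
    have "horizontal_torsion A D X Y u = 0"
      using cond X(1) Y(1) unfolding cartan_conditions_def by simp
    then show "\<Gamma>' (v, ?\<beta> v) w = \<Gamma>' (w, ?\<beta> w) v"
      unfolding horizontal_torsion_coords[of D u, OF T X(1) Y(1)] X(2) Y(2)
      using p by (simp add: tv_eq_0_iff)
  qed
  then show ?thesis by (simp add: D cartan_at_def chart_coef_at)
qed

lemma cartan_at_smooth:
  assumes D: "\<And>u. u \<in> sset A U \<Longrightarrow> D u = cartan_at u"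
    and X: "X \<in> vector_fields (slit_atlas A)" and Y: "Y \<in> sections A"
  shows "smooth_on cdom (srep A U \<phi> (\<lambda>u\<in>slit A. D u (X u) Y))"
proof -
  define \<xi> where "\<xi> = (\<lambda>z. scoords (X (pt z)))"
  have \<xi>: "smooth_on cdom \<xi>" unfolding \<xi>_def by (rule field_smooth[OF X])
  have Ys: "smooth_on cdom (srep A U \<phi> Y)" by (rule section_smooth[OF Y])
  have "smooth_on cdom (\<lambda>z. dird (srep A U \<phi> Y) z (\<xi> z) + chart_coef z (\<xi> z) (srep A U \<phi> Y z))"
    by (intro smooth_on_add open_cdom chart_coef_smooth \<xi> Ys
        smooth_on_linear_apply[OF open_cdom smooth_on_linear_dird[OF Ys] smooth_on_dird[OF Ys] \<xi>])
  then show ?thesis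
  proof (rule smooth_on_transform[OF _ open_cdom])
    fix z assume z: "z \<in> cdom"
    have u: "pt z \<in> sset A U" by (rule pt_in[OF z])
    have "X (pt z) \<in> tangent_space (slit_atlas A) (pt z)"
      using X S.in_carrier[OF u] by (auto simp: vector_fields_def)
    then have Xz: "X (pt z) = STv (pt z) (\<xi> z)" using STv_scoords[OF u] by (simp add: \<xi>_def)
    have "srep A U \<phi> (\<lambda>u\<in>slit A. D u (X u) Y) z = coords \<phi> (cartan_at (pt z) (STv (pt z) (\<xi> z)) Y)"
      using ssetD(3)[OF u] by (simp add: srep_pt D[OF u] Xz)
    then show "srep A U \<phi> (\<lambda>u\<in>slit A. D u (X u) Y) z =
        dird (srep A U \<phi> Y) z (\<xi> z) + chart_coef z (\<xi> z) (srep A U \<phi> Y z)"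
      using ssetD(1)[OF u] by (simp add: cartan_at_def conn_of_STv[OF u Y] tmap_pt[OF z])
  qed
qed

end

lemma finsler_chartI:
  assumes "finsler_manifold A L" "u \<in> slit A"
  obtains U \<phi> where "finsler_chart A U \<phi> L" "u \<in> sset A U"
proof -
  have "smooth_manifold A" using assms(1) by (simp add: finsler_manifold_def)
  then obtain U \<phi> where "manifold_chart A U \<phi>" "u \<in> sset A U" using manifold_chartI assms(2) by blast
  then show ?thesis using that assms(1) by (simp add: finsler_chart_def finsler_chart_axioms_def)
qed

lemma finsler_chart_of_chart:
  assumes "finsler_manifold A L" "(U, \<phi>) \<in> A"
  shows "finsler_chart A U \<phi> L"
  using assms slit_chartI[of A U \<phi>]
  by (simp add: finsler_chart_def finsler_chart_axioms_def manifold_chart_def manifold_chart_axioms_def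
      finsler_manifold_def smooth_manifold_def)

lemma conditions_iff:
  "metric_connection A (finsler_metric L) D \<and>
     (\<forall>X\<in>sections A. \<forall>Y\<in>sections A. \<forall>u\<in>slit A. horizontal_torsion A D X Y u = 0) \<and>
     (\<forall>X\<in>sections A. \<forall>Y\<in>sections A. \<forall>Z\<in>sections A. \<forall>u\<in>slit A.
        finsler_metric L u (mixed_torsion A D X Y u) (Z u) = finsler_metric L u (mixed_torsion A D X Z u) (Y u))
   \<longleftrightarrow> (\<forall>u\<in>slit A. cartan_conditions A L D u)"
  unfolding metric_connection_def cartan_conditions_def by (auto simp del: split_paired_All)

theorem theorem3p7:
  fixes A :: "('p, 'e::euclidean_space) atlas"
    and L :: "'p tpoint \<Rightarrow> real"
  assumes "finsler_manifold A L"
  shows "\<exists>!D. regular_connection A D \<and>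
           metric_connection A (finsler_metric L) D \<and>
           (\<forall>X\<in>sections A. \<forall>Y\<in>sections A. \<forall>u\<in>slit A. horizontal_torsion A D X Y u = 0) \<and>
           (\<forall>X\<in>sections A. \<forall>Y\<in>sections A. \<forall>Z\<in>sections A. \<forall>u\<in>slit A.
              finsler_metric L u (mixed_torsion A D X Y u) (Z u) =
              finsler_metric L u (mixed_torsion A D X Z u) (Y u))"
  unfolding conditions_iff
proof -
  have atlas: "smooth_atlas A" using assms by (simp add: finsler_manifold_def smooth_manifold_def)
  have "\<forall>u\<in>slit A. \<exists>d. \<exists>U \<phi>. finsler_chart A U \<phi> L \<and> u \<in> sset A U \<and> d = finsler_chart.cartan_at A U \<phi> L u"
  proof
    fix u assume "u \<in> slit A"
    then obtain U \<phi> where "finsler_chart A U \<phi> L" "u \<in> sset A U" by (rule finsler_chartI[OF assms])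
    then show "\<exists>d. \<exists>U \<phi>. finsler_chart A U \<phi> L \<and> u \<in> sset A U \<and> d = finsler_chart.cartan_at A U \<phi> L u"
      by blast
  qed
  from bchoice[OF this] obtain D0 where D0: "\<And>u. u \<in> slit A \<Longrightarrow>
      \<exists>U \<phi>. finsler_chart A U \<phi> L \<and> u \<in> sset A U \<and> D0 u = finsler_chart.cartan_at A U \<phi> L u"
    by blast
  \<comment> \<open>The chosen charts may vary from point to point.\<close>
  define D where "D = restrict D0 (slit A)"
  have D: "\<exists>U \<phi>. finsler_chart A U \<phi> L \<and> u \<in> sset A U \<and> D u = finsler_chart.cartan_at A U \<phi> L u"
    if "u \<in> slit A" for u
    using D0[OF that] that by (simp add: D_def)
  have splits: "\<forall>u\<in>slit A. splits A D u"
  proof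
    fix u assume "u \<in> slit A"
    then obtain U \<phi> where "finsler_chart A U \<phi> L" "u \<in> sset A U" "D u = finsler_chart.cartan_at A U \<phi> L u"
      using D by blast
    then show "splits A D u" by (rule finsler_chart.cartan_at_splits)
  qed
  have cond: "cartan_conditions A L D u" if u: "u \<in> slit A" for u
  proof -
    obtain U \<phi> where U: "finsler_chart A U \<phi> L" "u \<in> sset A U" "D u = finsler_chart.cartan_at A U \<phi> L u"
      using D[OF u] by blast
    show ?thesis by (rule finsler_chart.cartan_at_conditions[OF U(1,2), of D, OF splits U(3)])
  qed
  have smooth: "(\<lambda>u\<in>slit A. D u (X u) Y) \<in> sections A"
    if X: "X \<in> vector_fields (slit_atlas A)" and Y: "Y \<in> sections A" for X Y
  proof (rule sectionsI[OF atlas])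
    have "D u (X u) Y \<in> fibre A u" if u: "u \<in> slit A" for u
    proof -
      have "connection_at A u (D u)" using splits u by (simp add: splits_def)
      moreover have "X u \<in> tangent_space (slit_atlas A) u" using X u by (auto simp: vector_fields_def)
      ultimately show ?thesis using connection_atD(1) Y by blast
    qed
    then show "(\<lambda>u\<in>slit A. D u (X u) Y) \<in> (\<Pi>\<^sub>E u\<in>slit A. fibre A u)" unfolding restrict_PiE_iff by blast
    fix U \<phi> assume "(U, \<phi>) \<in> A"
    then interpret finsler_chart A U \<phi> L by (rule finsler_chart_of_chart[OF assms])
    \<comment> \<open>By uniqueness the connection has the same expression in this chart as in the chosen ones.\<close>
    have "D u = cartan_at u" if "u \<in> sset A U" for u
      using cartan_at_unique[OF that splits cond[OF ssetD(3)[OF that]]] .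
    then show "smooth_on (\<phi> ` U \<times> (- {0})) (srep A U \<phi> (\<lambda>u\<in>slit A. D u (X u) Y))"
      by (rule cartan_at_smooth[where D = D, OF _ X Y])
  qed
  show "\<exists>!D. regular_connection A D \<and> (\<forall>u\<in>slit A. cartan_conditions A L D u)"
  proof (rule ex1I[of _ D])
    show "regular_connection A D \<and> (\<forall>u\<in>slit A. cartan_conditions A L D u)"
      unfolding regular_connection_iff using splits cond smooth by (simp add: D_def)
  next
    fix D' assume D': "regular_connection A D' \<and> (\<forall>u\<in>slit A. cartan_conditions A L D' u)"
    show "D' = D"
    proof (rule extensionalityI[of _ "slit A"])
      show "D' \<in> extensional (slit A)" "D \<in> extensional (slit A)"
        using D' by (simp_all add: regular_connection_iff D_def)
      fix u assume u: "u \<in> slit A"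
      obtain U \<phi> where U: "finsler_chart A U \<phi> L" "u \<in> sset A U" using finsler_chartI[OF assms u] .
      then interpret finsler_chart A U \<phi> L by blast
      have "D' u = cartan_at u"
        by (rule cartan_at_unique[OF U(2)]) (use D' u in \<open>simp_all add: regular_connection_iff\<close>)
      also have "\<dots> = D u"
        by (rule cartan_at_unique[OF U(2) splits cond[OF u], symmetric])
      finally show "D' u = D u" .
    qed
  qed
qed

end
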